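(* Let $\mathbf{E}$ be a finite set, $n\in\mathbb{N}$, let $\mathsf{G}_{1},\ldots,\mathsf{G}_{n+1}$ be $|\mathbf{E}|\times|\mathbf{E}|$ matrices with non-negative off-diagonal entries and zero row sums, and let $q_{1},\ldots,q_{n}>0$. Let $Z=(N,Y)$ be the time-homogeneous Markov chain on $(\widetilde{\Omega},\widetilde{\mathcal{F}},\widetilde{\mathbb{P}})$ with state space $\{0,\ldots,n\}\times\mathbf{E}$ and generator $\widetilde{\mathsf{G}}$ whose diagonal blocks are $\mathsf{G}_{k+1}-q_{k+1}\mathsf{I}$ on $\{k\}\times\mathbf{E}$ ($k=0,\ldots,n-1$) and $\mathsf{G}_{n+1}$ on $\{n\}\times\mathbf{E}$, whose blocks from $\{k\}\times\mathbf{E}$ to $\{k+1\}\times\mathbf{E}$ are $q_{k+1}\mathsf{I}$ ($k=0,\ldots,n-1$), and all other blocks zero. For $i\in\mathbf{E}$ let $\widetilde{\mathbb{P}}^{i}(\cdot)=\widetilde{\mathbb{P}}(\cdot\mid Z_0=(0,i))$, let $S_k=\inf\{t\ge0: N_t=k\}$ for $k=1,\ldots,n$, and let $\widetilde{\mathcal{F}}^{Y}_\infty=\sigma(Y_t,\,t\ge0)$. Then for any $i\in\mathbf{E}$, any $0<s_1<\cdots<s_n$, and any cylinder set $A=\{(Y_{u_1},\ldots,Y_{u_m})\in B\}$ with $0\le u_1<\cdots<u_m$, $B\subseteq\mathbf{E}^m$, $m\in\mathbb{N}$, the limit $$\overline{\mathbb{P}}^{i}(A;s_1,\ldots,s_n):=\lim_{\Delta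 s_k\to0,\,k=1,\ldots,n}\frac{\widetilde{\mathbb{P}}^{i}\big(A,\ s_k<S_k\le s_k+\Delta s_k,\ k=1,\ldots,n\big)}{\widetilde{\mathbb{P}}^{i}\big(s_k<S_k\le s_k+\Delta s_k,\ k=1,\ldots,n\big)}$$ exists, and $\overline{\mathbb{P}}^{i}(\cdot\,;s_1,\ldots,s_n)$ extends to a probability measure on $(\widetilde{\Omega},\widetilde{\mathcal{F}}^{Y}_\infty)$. Moreover, for every $A\in\widetilde{\mathcal{F}}^{Y}_\infty$ the function $(s_1,\ldots,s_n)\mapsto\overline{\mathbb{P}}^{i}(A;s_1,\ldots,s_n)$ is Borel measurable on $\{(s_1,\ldots,s_n)\in\mathbb{R}^n: 0<s_1<\cdots<s_n\}$, and, with $s_0:=0$, $$\widetilde{\mathbb{P}}^{i}(A)=\int_0^\infty\int_{s_1}^\infty\cdots\int_{s_{n-1}}^\infty\overline{\mathbb{P}}^{i}(A;s_1,\ldots,s_n)\prod_{k=1}^n\Big(q_k e^{-q_k(s_k-s_{k-1})}\Big)\,ds_n\cdots ds_2\,ds_1 .$$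
   Context: A generator matrix here means a square matrix with non-negative off-diagonal entries and zero row sums; $\mathsf{I}$ is the identity matrix. *)

theory Defs
  imports "HOL-Probability.Probability"
begin

definition generator_matrix :: "('e::finite \<Rightarrow> 'e \<Rightarrow> real) \<Rightarrow> bool" where
  "generator_matrix G \<longleftrightarrow> (\<forall>x y. x \<noteq> y \<longrightarrow> 0 \<le> G x y) \<and> (\<forall>x. (\<Sum>y\<in>UNIV. G x y) = 0)"

definition lifted_gen :: "nat \<Rightarrow> (nat \<Rightarrow> 'e \<Rightarrow> 'e \<Rightarrow> real) \<Rightarrow> (nat \<Rightarrow> real)
    \<Rightarrow> nat \<times> 'e \<Rightarrow> nat \<times> 'e \<Rightarrow> real" where
  "lifted_gen n G q = (\<lambda>(k, x) (l, y).
     if k \<le> n \<and> l \<le> n then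
       (if l = k then G (Suc k) x y - (if k < n \<and> x = y then q (Suc k) else 0)
        else if l = Suc k \<and> x = y then q (Suc k) else 0)
     else 0)"

fun matpow :: "'s set \<Rightarrow> ('s \<Rightarrow> 's \<Rightarrow> real) \<Rightarrow> nat \<Rightarrow> 's \<Rightarrow> 's \<Rightarrow> real" where
  "matpow St Q 0 = (\<lambda>x y. if x = y then 1 else 0)"
| "matpow St Q (Suc j) = (\<lambda>x y. \<Sum>z\<in>St. matpow St Q j x z * Q z y)"

definition mat_exp :: "'s set \<Rightarrow> ('s \<Rightarrow> 's \<Rightarrow> real) \<Rightarrow> real \<Rightarrow> 's \<Rightarrow> 's \<Rightarrow> real" where
  "mat_exp St Q t x y = (\<Sum>j. t ^ j / fact j * matpow St Q j x y)"

text \<open>Probability of visiting xs at the (increasing) times ts, starting from x at time t,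
  computed from the transition function P.\<close>
fun path_weight :: "(real \<Rightarrow> 's \<Rightarrow> 's \<Rightarrow> real) \<Rightarrow> real \<Rightarrow> 's \<Rightarrow> real list \<Rightarrow> 's list \<Rightarrow> real" where
  "path_weight P t x (t' # ts) (x' # xs) = P (t' - t) x x' * path_weight P t' x' ts xs"
| "path_weight P t x _ _ = 1"

definition ctmc :: "'w measure \<Rightarrow> 's set \<Rightarrow> ('s \<Rightarrow> 's \<Rightarrow> real) \<Rightarrow> (real \<Rightarrow> 'w \<Rightarrow> 's) \<Rightarrow> bool" where
  "ctmc M St Q Z \<longleftrightarrow>
     (\<forall>t\<ge>0. Z t \<in> measurable M (count_space UNIV)) \<and>
     (\<forall>\<omega>\<in>space M. \<forall>t\<ge>0. Z t \<omega> \<in> St) \<and>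
     (\<forall>\<omega>\<in>space M. \<forall>t\<ge>0. \<exists>\<epsilon>>0. \<forall>s. t \<le> s \<and> s < t + \<epsilon> \<longrightarrow> Z s \<omega> = Z t \<omega>) \<and>
     (\<forall>ts xs x0. sorted_wrt (<) ts \<and> (\<forall>t\<in>set ts. 0 < t) \<and> length xs = length ts \<longrightarrow>
        measure M {\<omega>\<in>space M. Z 0 \<omega> = x0 \<and> list_all2 (\<lambda>t x. Z t \<omega> = x) ts xs}
        = measure M {\<omega>\<in>space M. Z 0 \<omega> = x0} * path_weight (mat_exp St Q) 0 x0 ts xs)"

definition condP :: "'w measure \<Rightarrow> (real \<Rightarrow> 'w \<Rightarrow> nat \<times> 'e) \<Rightarrow> 'e \<Rightarrow> 'w set \<Rightarrow> real" where
  "condP M Z i A = measure M (A \<inter> {\<omega>\<in>space M. Z 0 \<omega> = (0, i)})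
                   / measure M {\<omega>\<in>space M. Z 0 \<omega> = (0, i)}"

text \<open>S_k = inf {t >= 0. N_t = k}, with inf {} = \<infinity>.\<close>
definition hit_time :: "(real \<Rightarrow> 'w \<Rightarrow> nat \<times> 'e) \<Rightarrow> nat \<Rightarrow> 'w \<Rightarrow> ereal" where
  "hit_time Z k \<omega> = Inf (ereal ` {t. 0 \<le> t \<and> fst (Z t \<omega>) = k})"

definition FY :: "'w measure \<Rightarrow> (real \<Rightarrow> 'w \<Rightarrow> nat \<times> 'e) \<Rightarrow> 'w set set" where
  "FY M Z = sigma_sets (space M) {{\<omega>\<in>space M. snd (Z t \<omega>) = e} | t e. 0 \<le> t}"

definition cyl :: "'w measure \<Rightarrow> (real \<Rightarrow> 'w \<Rightarrow> nat \<times> 'e) \<Rightarrow> real list \<Rightarrow> 'e list set \<Rightarrow> 'w set" where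
  "cyl M Z us B = {\<omega>\<in>space M. map (\<lambda>u. snd (Z u \<omega>)) us \<in> B}"

definition hit_window :: "'w measure \<Rightarrow> (real \<Rightarrow> 'w \<Rightarrow> nat \<times> 'e) \<Rightarrow> nat \<Rightarrow> (nat \<Rightarrow> real)
    \<Rightarrow> (nat \<Rightarrow> real) \<Rightarrow> 'w set" where
  "hit_window M Z n s \<Delta> = {\<omega>\<in>space M. \<forall>k\<in>{1..n}.
      ereal (s k) < hit_time Z k \<omega> \<and> hit_time Z k \<omega> \<le> ereal (s k + \<Delta> k)}"

definition prev_s :: "(nat \<Rightarrow> real) \<Rightarrow> nat \<Rightarrow> real" where
  "prev_s s k = (if k \<le> 1 then 0 else s (k - 1))"

text \<open>Open open_simplex {0 < s_1 < ... < s_n}, points represented as elements of PiE {1..n} UNIV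
  (the carrier of PiM {1..n} (\<lambda>_. lborel)).\<close>
definition open_simplex :: "nat \<Rightarrow> (nat \<Rightarrow> real) set" where
  "open_simplex n = {s \<in> PiE {1..n} (\<lambda>_. UNIV). \<forall>k\<in>{1..n}. prev_s s k < s k}"

text \<open>Iterated integral  \<integral>_{s_0}^\<infinity> \<integral>_{s_1}^\<infinity> ... \<integral>_{s_{n-1}}^\<infinity> f(s_1..s_n) ds_n ... ds_1;
  nested n k f s integrates over s_{k+1},...,s_n given s_1..s_k.\<close>
function nested :: "nat \<Rightarrow> nat \<Rightarrow> ((nat \<Rightarrow> real) \<Rightarrow> ennreal) \<Rightarrow> (nat \<Rightarrow> real) \<Rightarrow> ennreal" where
  "nested n k f s = (if n \<le> k then f s
     else \<integral>\<^sup>+ t. indicator {prev_s s (Suc k)<..} t * nested n (Suc k) f (s(Suc k := t)) \<partial>lborel)"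
  by auto
termination by (relation "Wellfounded.measure (\<lambda>(n, k, _, _). n - k)") auto

definition iterated_integral :: "nat \<Rightarrow> ((nat \<Rightarrow> real) \<Rightarrow> ennreal) \<Rightarrow> ennreal" where
  "iterated_integral n f = nested n 0 f (\<lambda>_. undefined)"

end

theory Submission
  imports Defs
begin

text \<open>For a deterministic vector \<open>s\<close> of switching times let \<open>p\<^sub>s\<close> be the finite-dimensional law of the
  inhomogeneous chain that uses the generator \<open>G (k + 1)\<close> between the \<open>k\<close>-th and the next switching time.
  Duhamel's formula, applied at the first switch and iterated, shows that the law of \<open>(N, Y)\<close> is the
  mixture of the \<open>p\<^sub>s\<close> with respect to the density in the statement, \<open>N\<close> being the number of
  coordinates of \<open>s\<close> that have passed. Up to null sets a hitting window is a finite-dimensional event for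
  \<open>N\<close>, so the conditional probability of a cylinder given the window is an average of \<open>p\<^sub>t\<close> over \<open>t\<close> in
  a small box at \<open>s\<close>. Since \<open>s \<mapsto> p\<^sub>s\<close> is Lipschitz in total variation, uniformly over all
  cylinders, this average converges to \<open>p\<^sub>s\<close>. The same uniformity gives
  \<open>p\<^sub>s(A) \<le> P(A) / P(window) + \<epsilon>\<close>, hence continuity at the empty set, and the extension theorem of
  Caratheodory applies although the sample space is arbitrary.\<close>

section \<open>Matrix exponentials\<close>

text \<open>Two obstacles shape the argument. The bound on the change of \<open>p\<^sub>s\<close>
  must not grow with the number of observation times of a cylinder, whereas perturbing the
  transitions one by one adds up their errors. The transition matrix over \<open>[a, b]\<close> is
  therefore a product over all phases in which \<open>s\<close> enters only through the time spent
  in each phase. Such a time is built from positive parts \<open>(t - s_k)^+\<close>. For two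
  vectors \<open>s\<close> and \<open>s'\<close> the difference of these parts is monotone in
  \<open>t\<close> and bounded by the shift, so the errors of consecutive intervals telescope to a
  bound in terms of the shift alone. The other obstacle is that \<open>ctmc\<close> supplies
  finite-dimensional laws and right-constant paths, while a window speaks of infima over whole
  paths. The mixture formula gives probability zero to a decrease of \<open>N\<close> between two
  given times, right-constancy carries this from rational times to all times, and for monotone
  \<open>N\<close> the windows become conditions at their end points.\<close>

lemma matpow_bound:
  assumes fin: "finite St" and y: "y \<in> St"
  shows "\<bar>matpow St Q j x y\<bar> \<le> (\<Sum>a\<in>St. \<Sum>b\<in>St. \<bar>Q a b\<bar>) ^ j"
  using y
proof (induction j arbitrary: y)
  case (Suc j)
  let ?c = "\<Sum>a\<in>St. \<Sum>b\<in>St. \<bar>Q a b\<bar>"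
  have c0: "0 \<le> ?c" by (intro sum_nonneg) auto
  have "\<bar>matpow St Q (Suc j) x y\<bar> \<le> (\<Sum>z\<in>St. \<bar>matpow St Q j x z\<bar> * \<bar>Q z y\<bar>)"
    by (simp add: abs_mult[symmetric] sum_abs)
  also have "\<dots> \<le> (\<Sum>z\<in>St. ?c ^ j * \<bar>Q z y\<bar>)"
    by (intro sum_mono mult_right_mono Suc.IH) auto
  also have "\<dots> = ?c ^ j * (\<Sum>z\<in>St. \<bar>Q z y\<bar>)" by (simp add: sum_distrib_left)
  also have "\<dots> \<le> ?c ^ j * ?c"
  proof (intro mult_left_mono sum_mono)
    fix z
    show "\<bar>Q z y\<bar> \<le> (\<Sum>b\<in>St. \<bar>Q z b\<bar>)"
      using fin Suc.prems by (intro member_le_sum) auto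
  qed (use c0 in auto)
  finally show ?case by (simp add: mult.commute)
qed auto

lemma matpow_Suc_left:
  assumes fin: "finite St" and x: "x \<in> St" and y: "y \<in> St"
  shows "matpow St Q (Suc j) x y = (\<Sum>z\<in>St. Q x z * matpow St Q j z y)"
  using y
proof (induction j arbitrary: y)
  case 0
  have "(\<Sum>z\<in>St. matpow St Q 0 x z * Q z y) = (\<Sum>z\<in>St. if x = z then Q z y else 0)"
    by (intro sum.cong) auto
  moreover have "(\<Sum>z\<in>St. Q x z * matpow St Q 0 z y) = (\<Sum>z\<in>St. if z = y then Q x z else 0)"
    by (intro sum.cong) auto
  ultimately show ?case using fin x 0 by simp
next
  case (Suc j)
  have "matpow St Q (Suc (Suc j)) x y = (\<Sum>z\<in>St. matpow St Q (Suc j) x z * Q z y)" by simp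
  also have "\<dots> = (\<Sum>z\<in>St. (\<Sum>w\<in>St. Q x w * matpow St Q j w z) * Q z y)"
    using Suc.IH by (intro sum.cong refl) (simp only:)
  also have "\<dots> = (\<Sum>w\<in>St. Q x w * (\<Sum>z\<in>St. matpow St Q j w z * Q z y))"
    by (simp add: sum_distrib_left sum_distrib_right mult.assoc) (rule sum.swap)
  finally show ?case by simp
qed

lemma mat_exp_eq_suminf: "mat_exp St Q t x y = (\<Sum>j. matpow St Q j x y / fact j * t ^ j)"
  by (simp add: mat_exp_def mult.commute)

lemma mat_exp_summable:
  assumes fin: "finite St" and y: "y \<in> St"
  shows "summable (\<lambda>j. matpow St Q j x y / fact j * (t::real) ^ j)"
proof (rule summable_comparison_test')
  let ?c = "\<Sum>a\<in>St. \<Sum>b\<in>St. \<bar>Q a b\<bar>"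
  show "summable (\<lambda>j. inverse (fact j) * (?c * \<bar>t\<bar>) ^ j)" by (rule summable_exp)
  fix j :: nat
  have "\<bar>matpow St Q j x y\<bar> * \<bar>t\<bar> ^ j / fact j \<le> ?c ^ j * \<bar>t\<bar> ^ j / fact j"
    using matpow_bound[OF fin y, of Q j x] by (intro divide_right_mono mult_right_mono) auto
  then show "norm (matpow St Q j x y / fact j * t ^ j) \<le> inverse (fact j) * (?c * \<bar>t\<bar>) ^ j"
    by (simp add: abs_mult power_abs power_mult_distrib field_simps)
qed

lemma mat_exp_deriv:
  assumes fin: "finite St" and y: "y \<in> St"
  shows "((\<lambda>t. mat_exp St Q t x y) has_real_derivative (\<Sum>z\<in>St. mat_exp St Q t x z * Q z y)) (at t)"
proof -
  let ?c = "\<lambda>j. matpow St Q j x y / fact j"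
  have "((\<lambda>t. \<Sum>j. ?c j * t ^ j) has_real_derivative (\<Sum>j. diffs ?c j * t ^ j)) (at t)"
    using mat_exp_summable[OF fin y] by (rule termdiffs_strong_converges_everywhere)
  moreover have "(\<lambda>t. \<Sum>j. ?c j * t ^ j) = (\<lambda>t. mat_exp St Q t x y)"
    by (simp add: mat_exp_eq_suminf)
  moreover have "(\<Sum>j. diffs ?c j * t ^ j) = (\<Sum>z\<in>St. mat_exp St Q t x z * Q z y)"
  proof -
    have "diffs ?c j * t ^ j = (\<Sum>z\<in>St. matpow St Q j x z / fact j * t ^ j * Q z y)" for j
    proof -
      have "diffs ?c j = matpow St Q (Suc j) x y / fact j"
        unfolding diffs_def by (simp del: matpow.simps of_nat_Suc add: field_simps)
      then show ?thesis by (simp add: sum_distrib_left sum_distrib_right sum_divide_distrib mult_ac)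
    qed
    then have "(\<Sum>j. diffs ?c j * t ^ j) = (\<Sum>j. \<Sum>z\<in>St. matpow St Q j x z / fact j * t ^ j * Q z y)"
      by simp
    also have "\<dots> = (\<Sum>z\<in>St. \<Sum>j. matpow St Q j x z / fact j * t ^ j * Q z y)"
      by (intro suminf_sum summable_mult2 mat_exp_summable fin)
    also have "\<dots> = (\<Sum>z\<in>St. (\<Sum>j. matpow St Q j x z / fact j * t ^ j) * Q z y)"
      by (intro sum.cong refl suminf_mult2[symmetric] mat_exp_summable fin)
    finally show ?thesis by (simp add: mat_exp_eq_suminf)
  qed
  ultimately show ?thesis by simp
qed

text \<open>\<open>Q\<close> commutes with its powers. This turns the forward equation of
  \<open>mat_exp_deriv\<close> into the backward equation, the form in which uniqueness is
  applied.\<close>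

lemma mat_exp_eq_left:
  assumes fin: "finite St" and x: "x \<in> St" and y: "y \<in> St"
  shows "(\<Sum>z\<in>St. mat_exp St Q t x z * Q z y) = (\<Sum>z\<in>St. Q x z * mat_exp St Q t z y)"
proof -
  have "(\<Sum>z\<in>St. mat_exp St Q t x z * Q z y)
      = (\<Sum>z\<in>St. (\<Sum>j. matpow St Q j x z / fact j * t ^ j * Q z y))"
    unfolding mat_exp_eq_suminf by (intro sum.cong refl suminf_mult2 mat_exp_summable fin)
  also have "\<dots> = (\<Sum>j. \<Sum>z\<in>St. matpow St Q j x z / fact j * t ^ j * Q z y)"
    by (intro suminf_sum[symmetric] summable_mult2 mat_exp_summable fin)
  also have "\<dots> = (\<Sum>j. matpow St Q (Suc j) x y / fact j * t ^ j)"
    by (simp add: sum_distrib_left sum_distrib_right sum_divide_distrib mult_ac)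
  also have "\<dots> = (\<Sum>j. \<Sum>z\<in>St. Q x z * (matpow St Q j z y / fact j * t ^ j))"
    unfolding matpow_Suc_left[OF fin x y]
    by (simp add: sum_distrib_left sum_distrib_right sum_divide_distrib mult_ac)
  also have "\<dots> = (\<Sum>z\<in>St. \<Sum>j. Q x z * (matpow St Q j z y / fact j * t ^ j))"
    by (intro suminf_sum summable_mult mat_exp_summable fin y)
  also have "\<dots> = (\<Sum>z\<in>St. Q x z * mat_exp St Q t z y)"
    unfolding mat_exp_eq_suminf by (intro sum.cong refl suminf_mult mat_exp_summable fin y)
  finally show ?thesis .
qed

lemma mat_exp_0: "mat_exp St Q 0 x y = (if x = y then 1 else 0)"
proof -
  have "mat_exp St Q 0 x y = (\<Sum>j. (if j = 0 then matpow St Q 0 x y else 0))"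
    unfolding mat_exp_def by (intro suminf_cong) (auto simp del: matpow.simps)
  also have "\<dots> = (if x = y then 1 else 0)"
    by (subst suminf_finite[of "{0}"]) auto
  finally show ?thesis .
qed

lemma continuous_on_mat_exp:
  assumes "finite St" "y \<in> St"
  shows "continuous_on A (\<lambda>t. mat_exp St Q t x y)"
  using mat_exp_deriv[OF assms, THEN DERIV_isCont] by (simp add: continuous_at_imp_continuous_on)

text \<open>The terms with \<open>Q\<close> cancel because the exponential is differentiated by the
  forward equation and \<open>v\<close> solves a backward one; the exponential factor absorbs the
  loss term \<open>c\<close>. With \<open>c = 0\<close> and \<open>w = 0\<close> this yields
  uniqueness; with \<open>c\<close> the switching rate and \<open>w\<close> the contribution of the
  next phase it is Duhamel's formula in differential form.\<close>

lemma mat_exp_duhamel_deriv: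
  assumes fin: "finite St"
    and v: "\<And>y r. y \<in> St \<Longrightarrow> ((\<lambda>r. v r y) has_real_derivative
             (\<Sum>z\<in>St. Q y z * v r z) - c * v r y + w r y) (at r)"
  shows "((\<lambda>r. exp (- c * (r - t)) * (\<Sum>y\<in>St. mat_exp St Q (r - t) x y * v (u - r) y))
           has_real_derivative
           - (exp (- c * (r - t)) * (\<Sum>y\<in>St. mat_exp St Q (r - t) x y * w (u - r) y))) (at r)"
proof -
  let ?e = "\<lambda>r y. mat_exp St Q (r - t) x y"
  have de: "((\<lambda>r. ?e r y) has_real_derivative (\<Sum>z\<in>St. ?e r z * Q z y)) (at r)" if "y \<in> St" for y
    by (rule DERIV_chain'[OF _ mat_exp_deriv[OF fin that], THEN DERIV_cong]) (auto intro!: derivative_eq_intros)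
  have dv: "((\<lambda>r. v (u - r) y) has_real_derivative
      - ((\<Sum>z\<in>St. Q y z * v (u - r) z) - c * v (u - r) y + w (u - r) y)) (at r)" if "y \<in> St" for y
    by (rule DERIV_chain'[OF _ v[OF that], THEN DERIV_cong]) (auto intro!: derivative_eq_intros)
  have "((\<lambda>r. exp (- c * (r - t)) * (\<Sum>y\<in>St. ?e r y * v (u - r) y)) has_real_derivative
     (- c * exp (- c * (r - t))) * (\<Sum>y\<in>St. ?e r y * v (u - r) y)
     + (\<Sum>y\<in>St. (\<Sum>z\<in>St. ?e r z * Q z y) * v (u - r) y +
         - ((\<Sum>z\<in>St. Q y z * v (u - r) z) - c * v (u - r) y + w (u - r) y) * ?e r y) * exp (- c * (r - t))) (at r)"
    by (intro DERIV_mult DERIV_sum de dv) (auto intro!: derivative_eq_intros)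
  moreover have "(\<Sum>y\<in>St. (\<Sum>z\<in>St. ?e r z * Q z y) * v (u - r) y)
      = (\<Sum>y\<in>St. (\<Sum>z\<in>St. Q y z * v (u - r) z) * ?e r y)"
    by (simp add: sum_distrib_right sum_distrib_left mult_ac) (rule sum.swap)
  then have "(\<Sum>y\<in>St. (\<Sum>z\<in>St. ?e r z * Q z y) * v (u - r) y +
         - ((\<Sum>z\<in>St. Q y z * v (u - r) z) - c * v (u - r) y + w (u - r) y) * ?e r y)
     = c * (\<Sum>y\<in>St. ?e r y * v (u - r) y) - (\<Sum>y\<in>St. ?e r y * w (u - r) y)"
    by (simp add: sum.distrib sum_subtractf algebra_simps sum_distrib_left)
  ultimately show ?thesis
    by (elim DERIV_cong) (simp only:, simp add: algebra_simps)
qed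

text \<open>The interpolation \<open>\<Sum>y\<in>St. mat_exp St Q r x y * v (t - r) y\<close> has
  derivative zero in \<open>r\<close>; its values at \<open>r = 0\<close> and \<open>r = t\<close>
  are the two sides.\<close>

lemma mat_exp_unique:
  assumes fin: "finite St" and x: "x \<in> St"
    and v: "\<And>y r. y \<in> St \<Longrightarrow> ((\<lambda>r. v r y) has_real_derivative (\<Sum>z\<in>St. Q y z * v r z)) (at r)"
  shows "v t x = (\<Sum>y\<in>St. mat_exp St Q t x y * v 0 y)"
proof -
  have "((\<lambda>r. exp (- 0 * (r - 0)) * (\<Sum>y\<in>St. mat_exp St Q (r - 0) x y * v (t - r) y))
           has_real_derivative
           - (exp (- 0 * (r - 0)) * (\<Sum>y\<in>St. mat_exp St Q (r - 0) x y * 0))) (at r)" for r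
    by (rule mat_exp_duhamel_deriv[OF fin]) (use v in simp)
  then have "((\<lambda>r. \<Sum>y\<in>St. mat_exp St Q r x y * v (t - r) y) has_real_derivative 0) (at r)" for r
    by simp
  then have "(\<Sum>y\<in>St. mat_exp St Q t x y * v (t - t) y) = (\<Sum>y\<in>St. mat_exp St Q 0 x y * v (t - 0) y)"
    by (intro DERIV_isconst_all allI)
  also have "\<dots> = (\<Sum>y\<in>St. if x = y then v t y else 0)"
    by (intro sum.cong) (auto simp: mat_exp_0)
  also have "\<dots> = v t x" using fin x by simp
  finally show ?thesis by simp
qed

section \<open>Semigroup law, row sums and nonnegativity, all by uniqueness\<close>

lemma mat_exp_add:
  assumes fin: "finite St" and x: "x \<in> St" and y: "y \<in> St"
  shows "mat_exp St Q (t + u) x y = (\<Sum>z\<in>St. mat_exp St Q t x z * mat_exp St Q u z y)"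
proof -
  have "((\<lambda>r. mat_exp St Q (r + u) a y) has_real_derivative (\<Sum>z\<in>St. Q a z * mat_exp St Q (r + u) z y)) (at r)"
    if "a \<in> St" for a r
    by (rule DERIV_chain'[OF _ mat_exp_deriv[OF fin y], THEN DERIV_cong])
       (auto intro!: derivative_eq_intros simp: mat_exp_eq_left[OF fin that y])
  from mat_exp_unique[where v = "\<lambda>r a. mat_exp St Q (r + u) a y", OF fin x this] show ?thesis by simp
qed

lemma mat_exp_sum_row:
  assumes fin: "finite St" and x: "x \<in> St" and "\<And>y. y \<in> St \<Longrightarrow> (\<Sum>z\<in>St. Q y z) = 0"
  shows "(\<Sum>y\<in>St. mat_exp St Q t x y) = 1"
  using mat_exp_unique[OF fin x, of "\<lambda>_ _. 1" Q t] assms(3) by simp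

text \<open>Adding a large multiple of the identity makes all entries nonnegative, and then the
  exponential series is nonnegative term by term. Uniqueness identifies the exponential of
  \<open>Q\<close> with \<open>exp (- c * t)\<close> times that of the shifted matrix.\<close>

lemma mat_exp_nonneg:
  assumes fin: "finite St" and x: "x \<in> St" and y: "y \<in> St"
    and off: "\<And>a b. a \<in> St \<Longrightarrow> b \<in> St \<Longrightarrow> a \<noteq> b \<Longrightarrow> 0 \<le> Q a b" and t: "0 \<le> t"
  shows "0 \<le> mat_exp St Q t x y"
proof -
  define c where "c = (\<Sum>a\<in>St. \<bar>Q a a\<bar>)"
  define Q' where "Q' a b = Q a b + (if a = b then c else 0)" for a b
  have Q'0: "0 \<le> Q' a b" if "a \<in> St" "b \<in> St" for a b
  proof (cases "a = b")
    case True
    have "\<bar>Q a a\<bar> \<le> c" unfolding c_def using fin that by (intro member_le_sum) auto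
    then show ?thesis using True by (auto simp: Q'_def)
  qed (use off that in \<open>auto simp: Q'_def\<close>)
  have pow0: "0 \<le> matpow St Q' j a b" if "a \<in> St" "b \<in> St" for j a b
    using that by (induction j arbitrary: b) (auto intro!: sum_nonneg mult_nonneg_nonneg Q'0)
  have exp0: "0 \<le> mat_exp St Q' t x y"
    unfolding mat_exp_eq_suminf using pow0[OF x y] t by (intro suminf_nonneg mat_exp_summable fin y) auto
  have sumQ': "(\<Sum>z\<in>St. Q' a z * f z) = (\<Sum>z\<in>St. Q a z * f z) + c * f a" if "a \<in> St" for a f
  proof -
    have "(\<Sum>z\<in>St. Q' a z * f z) = (\<Sum>z\<in>St. Q a z * f z) + (\<Sum>z\<in>St. if a = z then c * f z else 0)"
      unfolding sum.distrib[symmetric] by (intro sum.cong) (auto simp: Q'_def algebra_simps)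
    then show ?thesis using fin that by simp
  qed
  have "((\<lambda>r. exp (- c * r) * mat_exp St Q' r a y) has_real_derivative
      (\<Sum>z\<in>St. Q a z * (exp (- c * r) * mat_exp St Q' r z y))) (at r)" if a: "a \<in> St" for a r
  proof (rule DERIV_cong[OF DERIV_mult[OF _ mat_exp_deriv[OF fin y]]])
    show "((\<lambda>r. exp (- c * r)) has_real_derivative - c * exp (- c * r)) (at r)"
      by (auto intro!: derivative_eq_intros)
    show "- c * exp (- c * r) * mat_exp St Q' r a y + (\<Sum>z\<in>St. mat_exp St Q' r a z * Q' z y) * exp (- c * r)
      = (\<Sum>z\<in>St. Q a z * (exp (- c * r) * mat_exp St Q' r z y))"
      unfolding mat_exp_eq_left[OF fin a y] sumQ'[OF a]
      by (simp add: algebra_simps sum_distrib_left)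
  qed
  from mat_exp_unique[where v = "\<lambda>r a. exp (- c * r) * mat_exp St Q' r a y", OF fin x this]
  have "exp (- c * t) * mat_exp St Q' t x y = (\<Sum>z\<in>St. mat_exp St Q t x z * mat_exp St Q' 0 z y)" by simp
  also have "\<dots> = (\<Sum>z\<in>St. if z = y then mat_exp St Q t x z else 0)"
    by (intro sum.cong) (auto simp: mat_exp_0)
  also have "\<dots> = mat_exp St Q t x y" using fin y by simp
  finally show ?thesis using exp0 by (metis exp_ge_zero mult_nonneg_nonneg)
qed

section \<open>Conditioning on the first switch\<close>

lemma dropWhile_less_ge:
  fixes r :: "'a :: linorder"
  assumes "sorted us" "u \<in> set (dropWhile (\<lambda>u. u < r) us)"
  shows "r \<le> u"
  using assms by (induction us) (auto split: if_splits)

lemma sorted_dropWhile_less: "sorted us \<Longrightarrow> sorted (dropWhile P us)"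
  by (simp add: sorted_wrt_dropWhile)

lemma exp_density_integral:
  assumes "0 < (q::real)"
  shows "(\<integral>\<^sup>+ r. ennreal (q * exp (- q * (r - t))) * indicator {t..} r \<partial>lborel) = 1"
proof -
  have "((\<lambda>r. - exp (- q * (r - t))) \<longlongrightarrow> - 0) at_top"
  proof (intro tendsto_minus filterlim_compose[OF exp_at_bot])
    have "filterlim (\<lambda>r. q * (- t + r)) at_top at_top"
      by (rule filterlim_tendsto_pos_mult_at_top[OF tendsto_const assms],
          rule filterlim_tendsto_add_at_top[OF tendsto_const filterlim_ident])
    then show "filterlim (\<lambda>r. - q * (r - t)) at_bot at_top"
      by (simp add: filterlim_uminus_at_bot algebra_simps)
  qed
  then have "(\<integral>\<^sup>+ r. ennreal (q * exp (- q * (r - t))) * indicator {t..} r \<partial>lborel)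
      = - 0 - (- exp (- q * (t - t)))"
    using assms by (intro nn_integral_FTC_atLeast) (auto intro!: derivative_eq_intros)
  then show ?thesis by simp
qed

locale switching =
  fixes n :: nat and G :: "nat \<Rightarrow> 'e::finite \<Rightarrow> 'e \<Rightarrow> real" and q :: "nat \<Rightarrow> real"
  assumes gen: "\<And>k. k \<in> {1..Suc n} \<Longrightarrow> generator_matrix (G k)"
    and q_pos: "\<And>k. k \<in> {1..n} \<Longrightarrow> 0 < q k"
begin

abbreviation "states \<equiv> {..n} \<times> (UNIV :: 'e set)"
abbreviation "chain_trans \<equiv> mat_exp states (lifted_gen n G q)"
abbreviation "ptrans k \<equiv> mat_exp UNIV (G k)"

lemma ptrans_nonneg: "k \<in> {1..Suc n} \<Longrightarrow> 0 \<le> t \<Longrightarrow> 0 \<le> ptrans k t x y"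
  using gen[of k] by (intro mat_exp_nonneg) (auto simp: generator_matrix_def)

lemma ptrans_sum: "k \<in> {1..Suc n} \<Longrightarrow> (\<Sum>y\<in>UNIV. ptrans k t x y) = 1"
  using gen[of k] by (intro mat_exp_sum_row) (auto simp: generator_matrix_def)

lemma continuous_on_ptrans [continuous_intros]:
  "continuous_on A f \<Longrightarrow> continuous_on A (\<lambda>a. ptrans k (f a) x y)"
  by (rule continuous_on_compose2[OF continuous_on_mat_exp[of UNIV y UNIV]]) auto

lemma borel_measurable_ptrans [measurable]: "(\<lambda>t. ptrans k t x y) \<in> borel_measurable borel"
  by (intro borel_measurable_continuous_onI continuous_intros)

lemma trans_nonneg: "z \<in> states \<Longrightarrow> z' \<in> states \<Longrightarrow> 0 \<le> t \<Longrightarrow> 0 \<le> chain_trans t z z'"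
proof (rule mat_exp_nonneg)
  fix a b assume "a \<in> states" "b \<in> states" "a \<noteq> b"
  then show "0 \<le> lifted_gen n G q a b"
    using gen[of "Suc (fst a)"] q_pos[of "Suc (fst a)"]
    by (cases a; cases b) (auto simp: lifted_gen_def generator_matrix_def intro: less_imp_le)
qed auto

section \<open>The lifted generator acting on functions of phase and state\<close>

lemma lifted_gen_action:
  assumes k: "k \<le> n"
  shows "(\<Sum>z\<in>states. lifted_gen n G q (k, x) z * f z)
    = (\<Sum>y\<in>UNIV. G (Suc k) x y * f (k, y))
      + (if k < n then q (Suc k) * (f (Suc k, x) - f (k, x)) else 0)"
proof -
  let ?a = "\<lambda>y. G (Suc k) x y - (if k < n \<and> x = y then q (Suc k) else 0)"
  let ?b = "\<lambda>y. if x = y then q (Suc k) else 0"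
  have "(\<Sum>z\<in>states. lifted_gen n G q (k, x) z * f z)
      = (\<Sum>l\<in>{..n}. \<Sum>y\<in>UNIV. lifted_gen n G q (k, x) (l, y) * f (l, y))"
    by (simp add: sum.cartesian_product)
  also have "\<dots> = (\<Sum>l\<in>{..n}. (if l = k then \<Sum>y\<in>UNIV. ?a y * f (l, y) else 0)
      + (if l = Suc k then \<Sum>y\<in>UNIV. ?b y * f (l, y) else 0))"
    using k by (intro sum.cong refl) (auto simp: lifted_gen_def intro!: sum.cong)
  also have "\<dots> = (\<Sum>y\<in>UNIV. ?a y * f (k, y)) + (if k < n then \<Sum>y\<in>UNIV. ?b y * f (Suc k, y) else 0)"
    using k by (auto simp: sum.distrib)
  also have "(\<Sum>y\<in>UNIV. ?b y * f (Suc k, y)) = (\<Sum>y\<in>UNIV. if x = y then q (Suc k) * f (Suc k, y) else 0)"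
    by (intro sum.cong) auto
  also have "\<dots> = q (Suc k) * f (Suc k, x)" by simp
  also have "(\<Sum>y\<in>UNIV. ?a y * f (k, y)) = (\<Sum>y\<in>UNIV. G (Suc k) x y * f (k, y))
      - (\<Sum>y\<in>UNIV. if x = y then (if k < n then q (Suc k) * f (k, y) else 0) else 0)"
    unfolding sum_subtractf[symmetric] by (intro sum.cong) (auto simp: algebra_simps)
  finally show ?thesis by (cases "k < n") (simp_all add: algebra_simps)
qed

lemma trans_deriv:
  assumes k: "k \<le> n"
  shows "((\<lambda>r. \<Sum>z\<in>states. chain_trans r (k, x) z * h z) has_real_derivative
     (\<Sum>y\<in>UNIV. G (Suc k) x y * (\<Sum>z\<in>states. chain_trans r (k, y) z * h z))
      + (if k < n then q (Suc k) * ((\<Sum>z\<in>states. chain_trans r (Suc k, x) z * h z)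
            - (\<Sum>z\<in>states. chain_trans r (k, x) z * h z)) else 0)) (at r)"
proof -
  let ?L = "lifted_gen n G q"
  have "((\<lambda>r. chain_trans r (k, x) z) has_real_derivative (\<Sum>w\<in>states. ?L (k, x) w * chain_trans r w z)) (at r)"
    if "z \<in> states" for z
    using mat_exp_deriv[of states z ?L "(k, x)" r] mat_exp_eq_left[of states "(k, x)" z ?L r] k that by simp
  then have "((\<lambda>r. \<Sum>z\<in>states. chain_trans r (k, x) z * h z) has_real_derivative
      (\<Sum>z\<in>states. (\<Sum>w\<in>states. ?L (k, x) w * chain_trans r w z) * h z)) (at r)"
    by (intro DERIV_sum DERIV_cmult_right)
  also have "(\<Sum>z\<in>states. (\<Sum>w\<in>states. ?L (k, x) w * chain_trans r w z) * h z)
      = (\<Sum>w\<in>states. ?L (k, x) w * (\<Sum>z\<in>states. chain_trans r w z * h z))"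
    by (simp only: sum_distrib_left sum_distrib_right mult.assoc) (rule sum.swap)
  finally show ?thesis unfolding lifted_gen_action[OF k] .
qed

text \<open>No switch leaves phase \<open>n\<close>, so the equations of \<open>trans_deriv\<close>
  for this phase form a closed system with matrix \<open>G (Suc n)\<close>.\<close>

lemma trans_last:
  "(\<Sum>z\<in>states. chain_trans r (n, x) z * h z) = (\<Sum>y\<in>UNIV. ptrans (Suc n) r x y * h (n, y))"
proof -
  have init: "(\<Sum>z\<in>states. chain_trans 0 (n, y) z * h z) = h (n, y)" for y
  proof -
    have "(\<Sum>z\<in>states. chain_trans 0 (n, y) z * h z) = (\<Sum>z\<in>states. if (n, y) = z then h z else 0)"
      by (intro sum.cong) (auto simp: mat_exp_0)
    then show ?thesis by simp
  qed
  have "(\<Sum>z\<in>states. chain_trans r (n, x) z * h z)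
     = (\<Sum>y\<in>UNIV. ptrans (Suc n) r x y * (\<Sum>z\<in>states. chain_trans 0 (n, y) z * h z))"
    using trans_deriv[of n _ h] by (intro mat_exp_unique) auto
  then show ?thesis by (simp only: init)
qed

section \<open>Weights of constrained paths and the density of the first switch\<close>

fun chain_weight :: "(real \<Rightarrow> nat \<times> 'e \<Rightarrow> bool) \<Rightarrow> real \<Rightarrow> nat \<times> 'e \<Rightarrow> real list \<Rightarrow> real" where
  "chain_weight C t z [] = 1"
| "chain_weight C t z (u # us)
     = (\<Sum>z'\<in>states. chain_trans (u - t) z z' * (of_bool (C u z') * chain_weight C u z' us))"

text \<open>Paths from \<open>x\<close> at time \<open>t\<close> to \<open>y\<close> at time \<open>r\<close>; the constraints at times \<open>\<ge> r\<close> are left to the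
  next phase.\<close>
fun phase_weight :: "(real \<Rightarrow> nat \<times> 'e \<Rightarrow> bool) \<Rightarrow> nat \<Rightarrow> real \<Rightarrow> 'e \<Rightarrow> real \<Rightarrow> real list \<Rightarrow> 'e \<Rightarrow> real" where
  "phase_weight C k t x r [] y = ptrans (Suc k) (r - t) x y"
| "phase_weight C k t x r (u # us) y = (if u < r
     then \<Sum>z\<in>UNIV. ptrans (Suc k) (u - t) x z * (of_bool (C u (k, z)) * phase_weight C k u z r us y)
     else ptrans (Suc k) (r - t) x y)"

lemma chain_weight_nonneg:
  "sorted us \<Longrightarrow> (\<And>u. u \<in> set us \<Longrightarrow> t \<le> u) \<Longrightarrow> z \<in> states \<Longrightarrow> 0 \<le> chain_weight C t z us"
proof (induction us arbitrary: t z)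
  case (Cons u us)
  show ?case unfolding chain_weight.simps
    using Cons.prems by (intro sum_nonneg mult_nonneg_nonneg trans_nonneg Cons.IH) auto
qed simp

lemma phase_weight_nonneg:
  "sorted us \<Longrightarrow> (\<And>u. u \<in> set us \<Longrightarrow> t \<le> u) \<Longrightarrow> t \<le> r \<Longrightarrow> k \<le> n \<Longrightarrow> 0 \<le> phase_weight C k t x r us y"
proof (induction us arbitrary: t x)
  case (Cons u us)
  have "0 \<le> phase_weight C k u z r us y" if "u < r" for z
    using Cons.prems that by (intro Cons.IH) auto
  then show ?case
    using Cons.prems by (auto intro!: sum_nonneg mult_nonneg_nonneg ptrans_nonneg)
qed (auto intro: ptrans_nonneg)

lemma continuous_on_chain_weight: "continuous_on A (\<lambda>t. chain_weight C t z us)"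
proof (cases us)
  case (Cons u us')
  have "continuous_on A (\<lambda>t. chain_trans (u - t) z z')" if "z' \<in> states" for z'
    by (rule continuous_on_compose2[OF continuous_on_mat_exp[of states z' UNIV]])
       (use that in \<open>auto intro!: continuous_intros\<close>)
  then show ?thesis unfolding Cons chain_weight.simps by (intro continuous_intros)
qed simp

text \<open>The joint density at \<open>r\<close> of the first switch out of phase \<open>k\<close>
  and of all constraints: those before \<open>r\<close> are met in phase \<open>k\<close>, the
  others after the chain has entered phase \<open>Suc k\<close> at \<open>r\<close>.\<close>

definition switch_weight :: "(real \<Rightarrow> nat \<times> 'e \<Rightarrow> bool) \<Rightarrow> nat \<Rightarrow> real \<Rightarrow> 'e \<Rightarrow> real list \<Rightarrow> real \<Rightarrow> real" where
  "switch_weight C k t x us r = q (Suc k) * exp (- q (Suc k) * (r - t)) *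
     (\<Sum>y\<in>UNIV. phase_weight C k t x r us y * chain_weight C r (Suc k, y) (dropWhile (\<lambda>u. u < r) us))"

text \<open>If the first observation precedes the switch, the exponential factor splits at
  \<open>u\<close> by memorylessness. Otherwise the whole list is passed on to the next phase. The
  two cases are the two ranges of integration in \<open>chain_weight_first_switch\<close>.\<close>

lemma switch_weight_Cons:
  "switch_weight C k t x (u # us) r = (if u < r
     then exp (- q (Suc k) * (u - t)) *
       (\<Sum>z\<in>UNIV. ptrans (Suc k) (u - t) x z * (of_bool (C u (k, z)) * switch_weight C k u z us r))
     else exp (- q (Suc k) * (r - t)) * (\<Sum>y\<in>UNIV. ptrans (Suc k) (r - t) x y *
       (q (Suc k) * chain_weight C r (Suc k, y) (u # us))))"
proof (cases "u < r")
  case True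
  let ?Q = "q (Suc k)" and ?c = "\<lambda>y. chain_weight C r (Suc k, y) (dropWhile (\<lambda>u. u < r) us)"
  define p where "p z = ptrans (Suc k) (u - t) x z * of_bool (C u (k, z))" for z
  have e: "exp (- ?Q * (r - t)) = exp (- ?Q * (u - t)) * exp (- ?Q * (r - u))"
    by (simp add: exp_add[symmetric] algebra_simps)
  have "phase_weight C k t x r (u # us) y = (\<Sum>z\<in>UNIV. p z * phase_weight C k u z r us y)" for y
    using True by (simp add: p_def mult.assoc)
  then have "(\<Sum>y\<in>UNIV. phase_weight C k t x r (u # us) y * ?c y)
      = (\<Sum>y\<in>UNIV. \<Sum>z\<in>UNIV. p z * (phase_weight C k u z r us y * ?c y))"
    by (simp only: sum_distrib_right mult.assoc)
  also have "\<dots> = (\<Sum>z\<in>UNIV. p z * (\<Sum>y\<in>UNIV. phase_weight C k u z r us y * ?c y))"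
    unfolding sum_distrib_left by (rule sum.swap)
  finally have "switch_weight C k t x (u # us) r
      = ?Q * exp (- ?Q * (r - t)) * (\<Sum>z\<in>UNIV. p z * (\<Sum>y\<in>UNIV. phase_weight C k u z r us y * ?c y))"
    using True by (simp only: switch_weight_def dropWhile.simps if_True)
  also have "\<dots> = exp (- ?Q * (u - t)) * (\<Sum>z\<in>UNIV. p z * switch_weight C k u z us r)"
  proof -
    define S where "S z = (\<Sum>y\<in>UNIV. phase_weight C k u z r us y * ?c y)" for z
    have "switch_weight C k u z us r = ?Q * exp (- ?Q * (r - u)) * S z" for z
      by (simp only: switch_weight_def S_def)
    then show ?thesis unfolding e S_def[symmetric] sum_distrib_left
      by (intro sum.cong refl) (simp only: mult_ac)
  qed
  finally show ?thesis using True by (simp only: p_def mult.assoc if_True)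
qed (simp add: switch_weight_def sum_distrib_left mult_ac)

lemma borel_measurable_switch_weight [measurable]: "switch_weight C k t x us \<in> borel_measurable borel"
proof (induction us arbitrary: t x)
  case Nil
  show ?case unfolding switch_weight_def by simp
next
  case (Cons u us)
  note [measurable] = Cons.IH
  have [measurable]: "(\<lambda>r. chain_weight C r z (u # us)) \<in> borel_measurable borel" for z
    by (intro borel_measurable_continuous_onI continuous_on_chain_weight)
  show ?case unfolding switch_weight_Cons[abs_def] by (simp del: chain_weight.simps)
qed

lemma switch_weight_nonneg:
  assumes us: "sorted us" "\<And>u. u \<in> set us \<Longrightarrow> t \<le> u" and "t \<le> r" "k < n"
  shows "0 \<le> switch_weight C k t x us r"
  unfolding switch_weight_def
  using assms q_pos[of "Suc k"]
  by (intro mult_nonneg_nonneg sum_nonneg phase_weight_nonneg chain_weight_nonneg sorted_dropWhile_less)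
     (auto dest: dropWhile_less_ge)

text \<open>On the event that the first switch happens before the first observation time this is
  Duhamel's formula; otherwise the Markov property at that time reduces it to the remaining list.\<close>
lemma chain_weight_first_switch:
  assumes k: "k < n"
  shows "sorted us \<Longrightarrow> (\<And>u. u \<in> set us \<Longrightarrow> t \<le> u) \<Longrightarrow>
    (\<integral>\<^sup>+ r. indicator {t<..} r * ennreal (switch_weight C k t x us r) \<partial>lborel)
      = ennreal (chain_weight C t (k, x) us)"
proof (induction us arbitrary: t x)
  case Nil
  have Q: "0 < q (Suc k)" using q_pos[of "Suc k"] k by simp
  have "(\<integral>\<^sup>+ r. indicator {t<..} r * ennreal (switch_weight C k t x [] r) \<partial>lborel)
      = (\<integral>\<^sup>+ r. ennreal (q (Suc k) * exp (- q (Suc k) * (r - t))) * indicator {t..} r \<partial>lborel)"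
    by (intro nn_integral_cong_AE eventually_mono[OF AE_lborel_singleton[of t]])
       (use k in \<open>auto simp: switch_weight_def ptrans_sum split: split_indicator\<close>)
  then show ?case using exp_density_integral[OF Q] by simp
next
  case (Cons u us)
  let ?Q = "q (Suc k)"
  have Q: "0 < ?Q" using q_pos[of "Suc k"] k by simp
  have us: "sorted us" "\<And>v. v \<in> set us \<Longrightarrow> u \<le> v" "t \<le> u" using Cons.prems by auto
  define h where "h z = of_bool (C u z) * chain_weight C u z us" for z
  define v where "v r z = (\<Sum>z'\<in>states. chain_trans r z z' * h z')" for r z
  have cw: "chain_weight C r z (u # us) = v (u - r) z" for r z by (simp add: v_def h_def)
  \<comment> \<open>\<open>\<psi> r\<close> is the weight obtained by running
    \<open>G (Suc k)\<close> with killing at rate \<open>?Q\<close> up to \<open>r\<close> and the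
    full chain from \<open>r\<close> to \<open>u\<close>. So \<open>\<psi> t\<close> is the full
    weight, \<open>\<psi> u\<close> is the part without a switch before \<open>u\<close>, and the
    rate of loss \<open>a\<close> is the switch density on \<open>[t, u]\<close>.\<close>
  define \<psi> where "\<psi> r = exp (- ?Q * (r - t)) * (\<Sum>y\<in>UNIV. ptrans (Suc k) (r - t) x y * v (u - r) (k, y))" for r
  define a where "a r = exp (- ?Q * (r - t)) * (\<Sum>y\<in>UNIV. ptrans (Suc k) (r - t) x y * (?Q * v (u - r) (Suc k, y)))" for r
  have d: "(\<psi> has_real_derivative - a r) (at r)" for r
    unfolding \<psi>_def a_def
  proof (rule mat_exp_duhamel_deriv)
    fix y s
    show "((\<lambda>r. v r (k, y)) has_real_derivative
         (\<Sum>z\<in>UNIV. G (Suc k) y z * v s (k, z)) - ?Q * v s (k, y) + ?Q * v s (Suc k, y)) (at s)"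
      using trans_deriv[of k y h s] k unfolding v_def by (simp add: algebra_simps)
  qed simp
  have a0: "0 \<le> a r" if "t \<le> r" "r \<le> u" for r
    unfolding a_def v_def h_def using that k Q us
    by (intro mult_nonneg_nonneg sum_nonneg ptrans_nonneg trans_nonneg chain_weight_nonneg) auto
  have am[measurable]: "a \<in> borel_measurable borel"
  proof -
    have [measurable]: "(\<lambda>r. v (u - r) z) \<in> borel_measurable borel" for z
      unfolding cw[symmetric] by (intro borel_measurable_continuous_onI continuous_on_chain_weight)
    show ?thesis unfolding a_def[abs_def] by simp
  qed
  have D: "((\<lambda>r. - \<psi> r) has_real_derivative a r) (at r)" for r using DERIV_minus[OF d] by simp
  have IA: "(\<integral>\<^sup>+ r. ennreal (a r) * indicator {t..u} r \<partial>lborel) = ennreal (\<psi> t - \<psi> u)"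
  proof -
    have "(\<integral>\<^sup>+ r. ennreal (a r) * indicator {t..u} r \<partial>lborel) = ennreal (- \<psi> u - - \<psi> t)"
      by (rule nn_integral_FTC_Icc[OF am D a0 us(3)]) auto
    then show ?thesis by simp
  qed
  have le: "\<psi> u \<le> \<psi> t"
  proof (rule DERIV_nonpos_imp_nonincreasing[OF us(3)])
    fix r assume "t \<le> r" "r \<le> u"
    then show "\<exists>y. (\<psi> has_real_derivative y) (at r) \<and> y \<le> 0"
      using d[of r] a0[of r] by (intro exI[of _ "- a r"]) simp
  qed
  have \<psi>u: "\<psi> u = exp (- ?Q * (u - t)) * (\<Sum>y\<in>UNIV. ptrans (Suc k) (u - t) x y * h (k, y))"
  proof -
    have "v 0 (k, y) = (\<Sum>z\<in>states. if z = (k, y) then h z else 0)" for y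
      unfolding v_def by (intro sum.cong) (auto simp: mat_exp_0)
    then show ?thesis using k by (simp add: \<psi>_def)
  qed
  have h0: "0 \<le> h (k, y)" for y
    using us k by (auto simp: h_def intro!: mult_nonneg_nonneg chain_weight_nonneg)
  have \<psi>u0: "0 \<le> \<psi> u" unfolding \<psi>u using us k h0
    by (intro mult_nonneg_nonneg sum_nonneg ptrans_nonneg) auto
  have \<psi>t: "\<psi> t = v (u - t) (k, x)"
  proof -
    have "ptrans (Suc k) (t - t) x y * v (u - t) (k, y) = (if x = y then v (u - t) (k, y) else 0)" for y
      by (simp add: mat_exp_0)
    then show ?thesis by (simp add: \<psi>_def)
  qed
  define c where "c z = exp (- ?Q * (u - t)) * (ptrans (Suc k) (u - t) x z * of_bool (C u (k, z)))" for z
  define b where "b r = (\<Sum>z\<in>UNIV. c z * switch_weight C k u z us r)" for r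
  have sw_b: "switch_weight C k t x (u # us) r = b r" if "u < r" for r
    using that unfolding switch_weight_Cons b_def c_def by (simp only: sum_distrib_left mult.assoc if_True)
  have IB: "(\<integral>\<^sup>+ r. indicator {u<..} r * ennreal (b r) \<partial>lborel) = ennreal (\<psi> u)"
  proof -
    have c0: "0 \<le> c z" for z unfolding c_def using us k by (intro mult_nonneg_nonneg ptrans_nonneg) auto
    have "indicator {u<..} r * ennreal (b r)
      = (\<Sum>z\<in>UNIV. ennreal (c z) * (indicator {u<..} r * ennreal (switch_weight C k u z us r)))" for r
    proof (cases "u < r")
      case True
      have s0: "0 \<le> switch_weight C k u z us r" for z
        using True us k by (intro switch_weight_nonneg) auto
      have "ennreal (b r) = (\<Sum>z\<in>UNIV. ennreal (c z) * ennreal (switch_weight C k u z us r))"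
        unfolding b_def using c0 s0 by (simp add: ennreal_mult[symmetric])
      then show ?thesis using True by simp
    qed simp
    then have "(\<integral>\<^sup>+ r. indicator {u<..} r * ennreal (b r) \<partial>lborel)
      = (\<Sum>z\<in>UNIV. ennreal (c z) * (\<integral>\<^sup>+ r. indicator {u<..} r * ennreal (switch_weight C k u z us r) \<partial>lborel))"
      by (simp add: nn_integral_sum nn_integral_cmult)
    also have "\<dots> = (\<Sum>z\<in>UNIV. ennreal (c z) * ennreal (chain_weight C u (k, z) us))"
      using us by (intro sum.cong refl arg_cong2[where f = "(*)"] Cons.IH) auto
    also have "\<dots> = ennreal (\<Sum>z\<in>UNIV. c z * chain_weight C u (k, z) us)"
    proof -
      have "0 \<le> chain_weight C u (k, z) us" for z
        using us k by (intro chain_weight_nonneg) auto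
      then show ?thesis using c0 by (simp add: ennreal_mult[symmetric])
    qed
    also have "(\<Sum>z\<in>UNIV. c z * chain_weight C u (k, z) us) = \<psi> u"
      unfolding \<psi>u h_def c_def by (simp only: sum_distrib_left mult.assoc)
    finally show ?thesis .
  qed
  have [measurable]: "b \<in> borel_measurable borel" unfolding b_def[abs_def] by simp
  have "(\<integral>\<^sup>+ r. indicator {t<..} r * ennreal (switch_weight C k t x (u # us) r) \<partial>lborel)
    = (\<integral>\<^sup>+ r. ennreal (a r) * indicator {t..u} r + indicator {u<..} r * ennreal (b r) \<partial>lborel)"
  proof (intro nn_integral_cong_AE eventually_mono[OF AE_lborel_singleton[of t]])
    fix r assume "r \<noteq> t"
    then show "indicator {t<..} r * ennreal (switch_weight C k t x (u # us) r)
      = ennreal (a r) * indicator {t..u} r + indicator {u<..} r * ennreal (b r)"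
    proof (cases "u < r")
      case False
      then have "switch_weight C k t x (u # us) r = a r"
        unfolding switch_weight_Cons a_def cw by simp
      then show ?thesis using False \<open>r \<noteq> t\<close> us(3) by (auto split: split_indicator)
    qed (use us(3) in \<open>simp add: sw_b\<close>)
  qed
  also have "\<dots> = ennreal (\<psi> t - \<psi> u) + ennreal (\<psi> u)"
    unfolding IA[symmetric] IB[symmetric] by (intro nn_integral_add) measurable
  also have "\<dots> = ennreal (chain_weight C t (k, x) (u # us))"
    using le \<psi>u0 unfolding cw \<psi>t[symmetric] by (simp add: ennreal_plus[symmetric] del: ennreal_plus)
  finally show ?case .
qed

end

section \<open>The iterated integral\<close>

declare nested.simps [simp del]

abbreviation (input) PiR :: "nat \<Rightarrow> (nat \<Rightarrow> real) measure" where
  "PiR k \<equiv> PiM {1..k} (\<lambda>_. lborel)"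

lemma nested_end: "nested n n f = f"
  by (rule ext) (simp add: nested.simps)

lemma nested_step:
  "k < n \<Longrightarrow> nested n k f s
     = (\<integral>\<^sup>+ t. indicator {prev_s s (Suc k)<..} t * nested n (Suc k) f (s(Suc k := t)) \<partial>lborel)"
  by (subst nested.simps) simp

lemma open_simplex_upd_iff:
  assumes "s \<in> PiE {1..k} (\<lambda>_. UNIV)"
  shows "s(Suc k := r) \<in> open_simplex (Suc k) \<longleftrightarrow> s \<in> open_simplex k \<and> prev_s s (Suc k) < r"
proof -
  have p: "prev_s (s(Suc k := r)) j = prev_s s j" if "j \<le> Suc k" for j
    using that by (auto simp: prev_s_def)
  have e: "s(Suc k := r) \<in> PiE {1..Suc k} (\<lambda>_. UNIV)"
    using assms by (auto simp: PiE_iff extensional_def)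
  have "(\<forall>j\<in>{1..Suc k}. prev_s (s(Suc k := r)) j < (s(Suc k := r)) j)
      \<longleftrightarrow> (\<forall>j\<in>{1..k}. prev_s s j < s j) \<and> prev_s s (Suc k) < r"
  proof -
    have I: "{1..Suc k} = insert (Suc k) {1..k}" by auto
    show ?thesis unfolding I by (auto simp: p)
  qed
  then show ?thesis using assms e by (simp add: open_simplex_def)
qed

text \<open>The indicators in \<open>nested\<close> keep every point that is reached inside the
  simplex. Identities that hold for ordered switching times only may therefore be used under the
  iterated integral. The induction runs downwards from \<open>n\<close>, each step fixing one more
  coordinate.\<close>

lemma nested_cong:
  assumes "k \<le> n" "s \<in> open_simplex k"
    and "\<And>s'. s' \<in> open_simplex n \<Longrightarrow> (\<And>j. j \<in> {1..k} \<Longrightarrow> s' j = s j) \<Longrightarrow> f s' = g s'"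
  shows "nested n k f s = nested n k g s"
  using assms
proof (induction k arbitrary: s rule: inc_induct)
  case base
  then show ?case by (simp add: nested_end)
next
  case (step k)
  have s: "s \<in> PiE {1..k} (\<lambda>_. UNIV)" using step.prems by (simp add: open_simplex_def)
  have "nested n (Suc k) f (s(Suc k := t)) = nested n (Suc k) g (s(Suc k := t))"
    if "prev_s s (Suc k) < t" for t
  proof (rule step.IH)
    show "s(Suc k := t) \<in> open_simplex (Suc k)"
      using step.prems that by (simp add: open_simplex_upd_iff[OF s])
    fix s' assume s': "s' \<in> open_simplex n" and eq: "\<And>j. j \<in> {1..Suc k} \<Longrightarrow> s' j = (s(Suc k := t)) j"
    show "f s' = g s'"
    proof (rule step.prems(2)[OF s'])
      fix j assume "j \<in> {1..k}"
      then show "s' j = s j" using eq[of j] by simp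
    qed
  qed
  then have "indicator {prev_s s (Suc k)<..} t * nested n (Suc k) f (s(Suc k := t))
      = indicator {prev_s s (Suc k)<..} t * nested n (Suc k) g (s(Suc k := t))" for t
    by (auto split: split_indicator)
  then show ?case using step.hyps by (simp add: nested_step)
qed

lemma borel_measurable_PiR_component [measurable (raw)]:
  "j \<in> {1..m} \<Longrightarrow> (\<lambda>s. s j) \<in> borel_measurable (PiR m)"
  using measurable_component_singleton[of j "{1..m}" "\<lambda>_. lborel :: real measure"] by simp

lemma borel_measurable_prev_s [measurable (raw)]:
  assumes "k \<le> Suc m"
  shows "(\<lambda>s. prev_s s k) \<in> borel_measurable (PiR m)"
proof (cases "k \<le> 1")
  case False
  then have "(\<lambda>s. s (k - 1)) \<in> borel_measurable (PiR m)"
    using assms by (intro borel_measurable_PiR_component) auto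
  then show ?thesis using False by (simp add: prev_s_def)
qed (simp add: prev_s_def)

lemma measurable_PiR_upd:
  "(\<lambda>p. (fst p)(Suc k := snd p)) \<in> measurable (PiR k \<Otimes>\<^sub>M lborel) (PiR (Suc k))"
  using measurable_add_dim[where i = "Suc k" and I = "{1..k}" and M = "\<lambda>_. lborel :: real measure"]
  by (simp add: atLeastAtMostSuc_conv case_prod_unfold)

lemma measurable_PiR_upd_snd:
  "s \<in> space (PiR k) \<Longrightarrow> (\<lambda>t. s(Suc k := t)) \<in> measurable lborel (PiR (Suc k))"
  using measurable_compose[OF measurable_Pair1'[of s "PiR k" lborel] measurable_PiR_upd] by simp

lemma borel_measurable_nested:
  assumes "k \<le> n" and f: "f \<in> borel_measurable (PiR n)"
  shows "nested n k f \<in> borel_measurable (PiR k)"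
  using assms(1)
proof (induction k rule: inc_induct)
  case base
  then show ?case using f by (simp add: nested_end)
next
  case (step k)
  have [measurable]: "(\<lambda>p. nested n (Suc k) f ((fst p)(Suc k := snd p))) \<in> borel_measurable (PiR k \<Otimes>\<^sub>M lborel)"
    by (rule measurable_compose[OF measurable_PiR_upd step.IH])
  have [measurable]: "(\<lambda>p. prev_s (fst p) (Suc k)) \<in> borel_measurable (PiR k \<Otimes>\<^sub>M (lborel :: real measure))"
    by (rule measurable_compose[OF measurable_fst borel_measurable_prev_s]) simp
  have "(\<lambda>p. (if prev_s (fst p) (Suc k) < snd p then 1 else 0) * nested n (Suc k) f ((fst p)(Suc k := snd p)))
      \<in> borel_measurable (PiR k \<Otimes>\<^sub>M lborel)"
    by measurable
  then have "(\<lambda>s. \<integral>\<^sup>+ t. (if prev_s s (Suc k) < t then 1 else 0) * nested n (Suc k) f (s(Suc k := t)) \<partial>lborel)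
      \<in> borel_measurable (PiR k)"
    by (intro lborel.borel_measurable_nn_integral) (simp add: case_prod_unfold)
  also have "(\<lambda>s. \<integral>\<^sup>+ t. (if prev_s s (Suc k) < t then 1 else 0) * nested n (Suc k) f (s(Suc k := t)) \<partial>lborel)
      = nested n k f"
    using step.hyps by (intro ext) (simp add: nested_step indicator_def of_bool_def)
  finally show ?case .
qed

lemma nested_sum_cmult:
  assumes "k \<le> n" "finite Y" "s \<in> space (PiR k)"
    and f: "\<And>y. y \<in> Y \<Longrightarrow> f y \<in> borel_measurable (PiR n)"
  shows "nested n k (\<lambda>s. \<Sum>y\<in>Y. c y * f y s) s = (\<Sum>y\<in>Y. c y * nested n k (f y) s)"
  using assms(1,3)
proof (induction k arbitrary: s rule: inc_induct)
  case base
  then show ?case by (simp add: nested_end)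
next
  case (step k)
  note upd = measurable_PiR_upd_snd[OF step.prems]
  have m: "(\<lambda>t. nested n (Suc k) (f y) (s(Suc k := t))) \<in> borel_measurable lborel" if "y \<in> Y" for y
    using step.hyps f[OF that] by (intro measurable_compose[OF upd borel_measurable_nested]) auto
  have "nested n (Suc k) (\<lambda>s. \<Sum>y\<in>Y. c y * f y s) (s(Suc k := t))
      = (\<Sum>y\<in>Y. c y * nested n (Suc k) (f y) (s(Suc k := t)))" for t
    by (rule step.IH[OF measurable_space[OF upd]]) simp
  then have "nested n k (\<lambda>s. \<Sum>y\<in>Y. c y * f y s) s
    = (\<integral>\<^sup>+ t. (\<Sum>y\<in>Y. c y * (indicator {prev_s s (Suc k)<..} t * nested n (Suc k) (f y) (s(Suc k := t)))) \<partial>lborel)"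
    using step.hyps by (simp add: nested_step sum_distrib_left mult_ac)
  also have "\<dots> = (\<Sum>y\<in>Y. c y * nested n k (f y) s)"
    using m step.hyps by (subst nn_integral_sum) (auto simp: nested_step intro!: sum.cong nn_integral_cmult)
  finally show ?case .
qed

lemma sets_open_simplex [measurable]: "open_simplex k \<in> sets (PiR k)"
proof -
  have "open_simplex k = {s \<in> space (PiR k). \<forall>j\<in>{1..k}. prev_s s j < s j}"
    by (simp add: open_simplex_def space_PiM)
  also have "\<dots> \<in> sets (PiR k)"
  proof (intro sets.sets_Collect_finite_All borel_measurable_less)
    fix j assume j: "j \<in> {1..k}"
    then show "(\<lambda>s. prev_s s j) \<in> borel_measurable (PiR k)"
      by (intro borel_measurable_prev_s) simp
    show "(\<lambda>s. s j) \<in> borel_measurable (PiR k)" using j by (rule borel_measurable_PiR_component)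
  qed auto
  finally show ?thesis .
qed

text \<open>Tonelli, one coordinate at a time: the integral of \<open>nested n k f\<close> over
  \<open>open_simplex k\<close> is the same for all \<open>k \<le> n\<close>. At
  \<open>k = n\<close> it is the right-hand side; at \<open>k = 0\<close> the product space has the
  single point \<open>\<lambda>_. undefined\<close>, which is where \<open>iterated_integral\<close>
  starts.\<close>

lemma iterated_integral_eq_nn_integral:
  assumes f: "f \<in> borel_measurable (PiR n)"
  shows "iterated_integral n f = (\<integral>\<^sup>+ s. indicator (open_simplex n) s * f s \<partial>PiR n)"
proof -
  interpret product_sigma_finite "\<lambda>_. lborel :: real measure" ..
  have "(\<integral>\<^sup>+ s. indicator (open_simplex k) s * nested n k f s \<partial>PiR k) = nested n 0 f (\<lambda>_. undefined)"
    if "k \<le> n" for k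
    using that
  proof (induction k)
    case 0
    have "(\<lambda>_. undefined) \<in> open_simplex 0" by (simp add: open_simplex_def)
    then show ?case by (simp add: nn_integral_empty)
  next
    case (Suc k)
    have [measurable]: "nested n (Suc k) f \<in> borel_measurable (PiR (Suc k))"
      using Suc.prems f by (rule borel_measurable_nested)
    have "(\<integral>\<^sup>+ s. indicator (open_simplex (Suc k)) s * nested n (Suc k) f s \<partial>PiR (Suc k))
      = (\<integral>\<^sup>+ s. \<integral>\<^sup>+ t. indicator (open_simplex (Suc k)) (s(Suc k := t)) * nested n (Suc k) f (s(Suc k := t)) \<partial>lborel \<partial>PiR k)"
    proof -
      have m: "(\<lambda>s. indicator (open_simplex (Suc k)) s * nested n (Suc k) f s) \<in> borel_measurable (PiR (Suc k))"
        by measurable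
      have I: "{1..Suc k} = insert (Suc k) {1..k}" by auto
      show ?thesis using m unfolding I by (subst product_nn_integral_insert) auto
    qed
    also have "\<dots> = (\<integral>\<^sup>+ s. indicator (open_simplex k) s * nested n k f s \<partial>PiR k)"
    proof (rule nn_integral_cong)
      fix s assume "s \<in> space (PiR k)"
      then have s: "s \<in> PiE {1..k} (\<lambda>_. UNIV)" by (simp add: space_PiM)
      note upd = measurable_PiR_upd_snd[OF \<open>s \<in> space (PiR k)\<close>]
      have [measurable]: "(\<lambda>t. nested n (Suc k) f (s(Suc k := t))) \<in> borel_measurable lborel"
        by (rule measurable_compose[OF upd]) measurable
      have "(\<integral>\<^sup>+ t. indicator (open_simplex (Suc k)) (s(Suc k := t)) * nested n (Suc k) f (s(Suc k := t)) \<partial>lborel)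
        = (\<integral>\<^sup>+ t. indicator (open_simplex k) s * (indicator {prev_s s (Suc k)<..} t * nested n (Suc k) f (s(Suc k := t))) \<partial>lborel)"
        by (intro nn_integral_cong) (auto simp: open_simplex_upd_iff[OF s] split: split_indicator)
      also have "\<dots> = indicator (open_simplex k) s * nested n k f s"
        using Suc.prems by (subst nn_integral_cmult) (auto simp: nested_step)
      finally show "(\<integral>\<^sup>+ t. indicator (open_simplex (Suc k)) (s(Suc k := t)) * nested n (Suc k) f (s(Suc k := t)) \<partial>lborel)
        = indicator (open_simplex k) s * nested n k f s" .
    qed
    finally show ?case using Suc by simp
  qed
  from this[of n] show ?thesis by (simp add: iterated_integral_def nested_end)
qed

section \<open>The chain with prescribed switching times\<close>

text \<open>Builds in the convention \<open>s_0 = 0\<close>, so that phase \<open>k\<close> begins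
  at \<open>switch s k\<close> for \<open>k = 0\<close> as well.\<close>

definition switch :: "(nat \<Rightarrow> real) \<Rightarrow> nat \<Rightarrow> real" where
  "switch s k = (if k = 0 then 0 else s k)"

lemma switch_simps [simp]: "switch s 0 = 0" "switch s (Suc k) = s (Suc k)"
  by (auto simp: switch_def)

lemma prev_s_eq_switch: "prev_s s k = switch s (k - 1)"
  by (auto simp: prev_s_def switch_def)

lemma prev_s_Suc [simp]: "prev_s s (Suc k) = switch s k"
  by (simp add: prev_s_eq_switch)

lemma switch_less:
  assumes "s \<in> open_simplex n" "j < k" "k \<le> n"
  shows "switch s j < switch s k"
  using assms(2,3)
proof (induction k)
  case (Suc k)
  have "switch s k < s (Suc k)"
    using assms(1) Suc.prems by (auto simp: open_simplex_def dest: bspec[of _ _ "Suc k"])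
  then show ?case using Suc by (cases "j = k") auto
qed simp

lemma switch_le: "s \<in> open_simplex n \<Longrightarrow> j \<le> k \<Longrightarrow> k \<le> n \<Longrightarrow> switch s j \<le> switch s k"
  using switch_less[of s n j k] by (cases "j = k") auto

lemma measurable_switch [measurable (raw)]: "k \<le> m \<Longrightarrow> (\<lambda>s. switch s k) \<in> borel_measurable (PiR m)"
  using borel_measurable_prev_s[of "Suc k" m] by simp

context switching
begin

definition phase :: "(nat \<Rightarrow> real) \<Rightarrow> real \<Rightarrow> nat" where
  "phase s t = card {k \<in> {1..n}. s k \<le> t}"

text \<open>The time spent in phase \<open>k\<close> up to \<open>t\<close>, as a difference of
  positive parts. Phase \<open>n\<close> never ends and has no second term.\<close>

definition occ_time :: "(nat \<Rightarrow> real) \<Rightarrow> nat \<Rightarrow> real \<Rightarrow> real" where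
  "occ_time s k t = max 0 (t - switch s k) - (if k < n then max 0 (t - switch s (Suc k)) else 0)"

text \<open>A phase that is not visited during \<open>[a, b]\<close> contributes the exponential at
  time zero, the identity. Taken up to \<open>m = n\<close>, the product is thus the transition
  matrix for every position of \<open>a \<le> b\<close> relative to the switching times.\<close>

fun det_trans :: "nat \<Rightarrow> (nat \<Rightarrow> real) \<Rightarrow> real \<Rightarrow> real \<Rightarrow> 'e \<Rightarrow> 'e \<Rightarrow> real" where
  "det_trans 0 s a b x y = ptrans 1 (occ_time s 0 b - occ_time s 0 a) x y"
| "det_trans (Suc m) s a b x y = (\<Sum>z\<in>UNIV. det_trans m s a b x z
     * ptrans (Suc (Suc m)) (occ_time s (Suc m) b - occ_time s (Suc m) a) z y)"

fun det_weight :: "(real \<Rightarrow> nat \<times> 'e \<Rightarrow> bool) \<Rightarrow> (nat \<Rightarrow> real) \<Rightarrow> real \<Rightarrow> 'e \<Rightarrow> real list \<Rightarrow> real" where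
  "det_weight C s t x [] = 1"
| "det_weight C s t x (u # us)
     = (\<Sum>y\<in>UNIV. det_trans n s t u x y * (of_bool (C u (phase s u, y)) * det_weight C s u y us))"

lemma phase_eq:
  assumes s: "s \<in> open_simplex n" and k: "k \<le> n" "switch s k \<le> t" "k < n \<Longrightarrow> t < s (Suc k)"
  shows "phase s t = k"
proof -
  have "s j \<le> t \<longleftrightarrow> j \<le> k" if j: "j \<in> {1..n}" for j
  proof
    assume "j \<le> k"
    then have "switch s j \<le> t" using switch_le[OF s, of j k] k by simp
    then show "s j \<le> t" using j by (simp add: switch_def)
  next
    assume le: "s j \<le> t"
    show "j \<le> k"
    proof (rule ccontr)
      assume "\<not> j \<le> k"
      then have "switch s (Suc k) \<le> switch s j" "k < n" using switch_le[OF s, of "Suc k" j] j by auto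
      then show False using k(3) le j by (auto simp: switch_def split: if_splits)
    qed
  qed
  then have "{j \<in> {1..n}. s j \<le> t} = {1..k}" using k by auto
  then show ?thesis by (simp add: phase_def)
qed

lemma occ_time_mono:
  assumes "s \<in> open_simplex n" "a \<le> b" "k \<le> n"
  shows "occ_time s k a \<le> occ_time s k b"
  using assms switch_le[OF assms(1), of k "Suc k"]
  by (cases "k < n") (auto simp: occ_time_def max_def)

lemma det_trans_nonneg:
  assumes "s \<in> open_simplex n" "a \<le> b" "m \<le> n"
  shows "0 \<le> det_trans m s a b x y"
  using assms(3)
proof (induction m arbitrary: y)
  case 0
  then show ?case using occ_time_mono[OF assms(1,2), of 0] by (auto intro!: ptrans_nonneg)
next
  case (Suc m)
  then show ?case using occ_time_mono[OF assms(1,2), of "Suc m"]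
    by (auto intro!: sum_nonneg mult_nonneg_nonneg ptrans_nonneg)
qed

lemma det_trans_sum:
  assumes "m \<le> n"
  shows "(\<Sum>y\<in>UNIV. det_trans m s a b x y) = 1"
  using assms
proof (induction m)
  case (Suc m)
  have "(\<Sum>y\<in>UNIV. det_trans (Suc m) s a b x y)
    = (\<Sum>z\<in>UNIV. det_trans m s a b x z * (\<Sum>y\<in>UNIV. ptrans (Suc (Suc m)) (occ_time s (Suc m) b - occ_time s (Suc m) a) z y))"
    unfolding det_trans.simps sum_distrib_left by (rule sum.swap)
  then show ?case using Suc by (simp add: ptrans_sum)
qed (simp add: ptrans_sum)

lemma sum_identity_right: "(\<Sum>z\<in>UNIV. f z * (if z = y then 1 else 0)) = (f (y :: 'e) :: real)"
  by (subst sum.cong[OF refl, of _ _ "\<lambda>z. if z = y then f z else 0"]) auto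

lemma sum_identity_left: "(\<Sum>z\<in>UNIV. (if x = z then 1 else 0) * f z) = (f (x :: 'e) :: real)"
  by (subst sum.cong[OF refl, of _ _ "\<lambda>z. if x = z then f z else 0"]) auto

lemma det_trans_id:
  assumes "\<And>j. j \<le> m \<Longrightarrow> occ_time s j a = occ_time s j b"
  shows "det_trans m s a b x y = (if x = y then 1 else 0)"
  using assms
proof (induction m arbitrary: y)
  case (Suc m)
  then have "det_trans (Suc m) s a b x y = (\<Sum>z\<in>UNIV. (if x = z then 1 else 0) * (if z = y then 1 else 0))"
    by (simp add: mat_exp_0 del: mult_if_delta)
  then show ?case by (simp only: sum_identity_right)
qed (simp add: mat_exp_0)

lemma det_trans_cong:
  assumes "\<And>j. j \<le> m \<Longrightarrow> occ_time s j b - occ_time s j a = occ_time s j d - occ_time s j c"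
  shows "det_trans m s a b x y = det_trans m s c d x y"
  using assms by (induction m arbitrary: y) simp_all

text \<open>If \<open>b\<close> precedes the beginning of the last of the phases \<open>0..m+1\<close>, this phase is not occupied
  before \<open>b\<close>; otherwise only this phase is occupied after \<open>b\<close>.\<close>
lemma det_trans_chapman_kolmogorov:
  assumes s: "s \<in> open_simplex n" and abc: "a \<le> b" "b \<le> c" and "m \<le> n"
  shows "det_trans m s a c x y = (\<Sum>z\<in>UNIV. det_trans m s a b x z * det_trans m s b c z y)"
  using assms(4)
proof (induction m arbitrary: y)
  case 0
  show ?case
    using mat_exp_add[of UNIV x y "G 1" "occ_time s 0 b - occ_time s 0 a" "occ_time s 0 c - occ_time s 0 b"]
    by simp
next
  case (Suc m)
  let ?p = "ptrans (Suc (Suc m))" and ?o = "occ_time s (Suc m)"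
  show ?case
  proof (cases "b \<le> switch s (Suc m)")
    case True
    then have o: "?o a = 0" "?o b = 0"
      using abc Suc.prems switch_le[OF s, of "Suc m" "Suc (Suc m)"] by (auto simp: occ_time_def)
    have "det_trans (Suc m) s a b x z = det_trans m s a b x z" for z
      using o by (simp add: mat_exp_0 sum_identity_right del: mult_if_delta)
    then have "(\<Sum>z\<in>UNIV. det_trans (Suc m) s a b x z * det_trans (Suc m) s b c z y)
      = (\<Sum>z\<in>UNIV. \<Sum>w\<in>UNIV. det_trans m s a b x z * det_trans m s b c z w * ?p (?o c - ?o b) w y)"
      by (simp add: sum_distrib_left mult.assoc)
    also have "\<dots> = (\<Sum>w\<in>UNIV. (\<Sum>z\<in>UNIV. det_trans m s a b x z * det_trans m s b c z w) * ?p (?o c - ?o b) w y)"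
      unfolding sum_distrib_right by (rule sum.swap)
    also have "\<dots> = det_trans (Suc m) s a c x y"
      using Suc o by simp
    finally show ?thesis by simp
  next
    case False
    have o: "occ_time s j b = occ_time s j c" if "j \<le> m" for j
      using False abc that Suc.prems switch_le[OF s, of j "Suc m"] switch_le[OF s, of "Suc j" "Suc m"]
      by (auto simp: occ_time_def)
    have "det_trans m s b c z w = (if z = w then 1 else 0)" for z w
      using o by (intro det_trans_id) simp
    then have bc: "det_trans (Suc m) s b c z y = ?p (?o c - ?o b) z y" for z
      by (simp add: sum_identity_left del: mult_if_delta)
    have ab: "det_trans m s a b x z = det_trans m s a c x z" for z
      using o by (intro det_trans_cong) simp
    have "(\<Sum>z\<in>UNIV. det_trans (Suc m) s a b x z * det_trans (Suc m) s b c z y)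
      = (\<Sum>z\<in>UNIV. \<Sum>w\<in>UNIV. det_trans m s a c x w * (?p (?o b - ?o a) w z * ?p (?o c - ?o b) z y))"
      unfolding bc by (simp add: ab sum_distrib_right mult.assoc)
    also have "\<dots> = (\<Sum>w\<in>UNIV. det_trans m s a c x w * (\<Sum>z\<in>UNIV. ?p (?o b - ?o a) w z * ?p (?o c - ?o b) z y))"
      unfolding sum_distrib_left by (rule sum.swap)
    also have "\<dots> = det_trans (Suc m) s a c x y"
      using mat_exp_add[of UNIV _ y "G (Suc (Suc m))" "?o b - ?o a" "?o c - ?o b"] by simp
    finally show ?thesis by simp
  qed
qed

lemma det_trans_within_phase:
  assumes s: "s \<in> open_simplex n" and k: "k \<le> n" "switch s k \<le> a" "a \<le> b" "k < n \<Longrightarrow> b \<le> s (Suc k)"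
  shows "det_trans n s a b x y = ptrans (Suc k) (b - a) x y"
proof -
  have o_k: "occ_time s k b - occ_time s k a = b - a"
    using k by (auto simp: occ_time_def)
  have o_ne: "occ_time s j b - occ_time s j a = 0" if "j \<le> n" "j \<noteq> k" for j
  proof (cases "j < k")
    case True
    then show ?thesis using k switch_le[OF s, of j k] switch_le[OF s, of "Suc j" k]
      by (auto simp: occ_time_def)
  next
    case False
    then have "switch s (Suc k) \<le> switch s j" "b \<le> switch s (Suc k)"
      using k that switch_le[OF s, of "Suc k" j] by auto
    moreover have "switch s j \<le> switch s (Suc j)" if "j < n" using that switch_le[OF s, of j "Suc j"] by simp
    ultimately show ?thesis using k by (auto simp: occ_time_def)
  qed
  \<comment> \<open>The claim for all partial products makes the induction work: they are the
    identity until factor \<open>k\<close> enters, and do not change afterwards.\<close>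
  have "det_trans m s a b x y = (if m < k then if x = y then 1 else 0 else ptrans (Suc k) (b - a) x y)"
    if "m \<le> n" for m y
    using that
  proof (induction m arbitrary: y)
    case 0
    show ?case using o_k o_ne[of 0] by (cases "k = 0") (auto simp: mat_exp_0)
  next
    case (Suc m)
    have IH: "det_trans m s a b x z = (if m < k then if x = z then 1 else 0 else ptrans (Suc k) (b - a) x z)" for z
      using Suc by simp
    consider "Suc m < k" | "Suc m = k" | "k < Suc m" by linarith
    then show ?case
    proof cases
      case 1
      then show ?thesis using Suc.prems o_ne[of "Suc m"] IH
        by (simp add: mat_exp_0 sum_identity_left del: mult_if_delta)
    next
      case 2
      then have "occ_time s (Suc m) b - occ_time s (Suc m) a = b - a" using o_k by simp
      then show ?thesis unfolding det_trans.simps IH using 2 by (simp add: sum_identity_left del: mult_if_delta)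
    next
      case 3
      then show ?thesis using Suc.prems o_ne[of "Suc m"] IH
        by (simp add: mat_exp_0 sum_identity_right del: mult_if_delta)
    qed
  qed
  from this[of n] show ?thesis using k by simp
qed

lemma det_weight_nonneg:
  "s \<in> open_simplex n \<Longrightarrow> sorted us \<Longrightarrow> (\<And>u. u \<in> set us \<Longrightarrow> t \<le> u) \<Longrightarrow> 0 \<le> det_weight C s t x us"
proof (induction us arbitrary: t x)
  case (Cons u us)
  show ?case unfolding det_weight.simps
    using Cons.prems by (intro sum_nonneg mult_nonneg_nonneg det_trans_nonneg Cons.IH) auto
qed simp

lemma measurable_phase [measurable]: "(\<lambda>s. phase s t) \<in> measurable (PiR n) (count_space UNIV)"
  unfolding phase_def
proof (rule measurable_card)
  fix j
  show "{s \<in> space (PiR n). j \<in> {k \<in> {1..n}. s k \<le> t}} \<in> sets (PiR n)"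
  proof (cases "j \<in> {1..n}")
    case True
    then have "(\<lambda>s. s j) \<in> borel_measurable (PiR n)" by (rule borel_measurable_PiR_component)
    then show ?thesis using True by simp
  qed simp
qed

lemma borel_measurable_occ_time [measurable (raw)]:
  assumes [measurable]: "\<tau> \<in> borel_measurable (PiR n)" and "k \<le> n"
  shows "(\<lambda>s. occ_time s k (\<tau> s)) \<in> borel_measurable (PiR n)"
proof -
  have [measurable]: "(\<lambda>s. switch s k) \<in> borel_measurable (PiR n)" using assms by (intro measurable_switch)
  show ?thesis
  proof (cases "k < n")
    case True
    then have [measurable]: "(\<lambda>s. switch s (Suc k)) \<in> borel_measurable (PiR n)" by (intro measurable_switch) simp
    show ?thesis unfolding occ_time_def using True by measurable
  next
    case False
    have "(\<lambda>s. max 0 (\<tau> s - switch s k)) \<in> borel_measurable (PiR n)" by measurable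
    then show ?thesis using False by (simp add: occ_time_def)
  qed
qed

lemma borel_measurable_det_trans:
  assumes [measurable]: "\<tau> \<in> borel_measurable (PiR n)" and "m \<le> n"
  shows "(\<lambda>s. det_trans m s (\<tau> s) u x y) \<in> borel_measurable (PiR n)"
  using assms(2)
proof (induction m arbitrary: y)
  case 0
  note [measurable] = borel_measurable_occ_time[OF assms(1), of 0]
    borel_measurable_occ_time[OF borel_measurable_const[of u], of 0]
  show ?case unfolding det_trans.simps by measurable
next
  case (Suc m)
  note [measurable] = borel_measurable_occ_time[OF assms(1) Suc.prems]
    borel_measurable_occ_time[OF borel_measurable_const[of u] Suc.prems]
  have [measurable]: "(\<lambda>s. det_trans m s (\<tau> s) u x z) \<in> borel_measurable (PiR n)" for z
    using Suc by simp
  show ?case unfolding det_trans.simps by measurable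
qed

lemma borel_measurable_det_weight:
  "\<tau> \<in> borel_measurable (PiR n) \<Longrightarrow> (\<lambda>s. det_weight C s (\<tau> s) x us) \<in> borel_measurable (PiR n)"
proof (induction us arbitrary: \<tau> x)
  case (Cons u us)
  have [measurable]: "(\<lambda>s. det_weight C s u y us) \<in> borel_measurable (PiR n)" for y
    by (rule Cons.IH) simp
  have [measurable]: "(\<lambda>s. det_trans n s (\<tau> s) u x y) \<in> borel_measurable (PiR n)" for y
    using Cons.prems by (rule borel_measurable_det_trans) simp
  have [measurable]: "(\<lambda>s. of_bool (C u (phase s u, y)) :: real) \<in> borel_measurable (PiR n)" for y
    by (rule measurable_compose[OF measurable_phase]) simp
  show ?case unfolding det_weight.simps by measurable
qed simp

text \<open>Observations before \<open>r\<close> take place within phase \<open>k\<close>. The first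
  interval that reaches across \<open>r\<close> is cut there by Chapman-Kolmogorov, with
  \<open>y\<close> the state at the switch. An observation exactly at \<open>r\<close> belongs to
  the next phase, in agreement with \<open>phase\<close>.\<close>

lemma det_weight_split:
  assumes s: "s \<in> open_simplex n" and k: "k < n" and r: "r = s (Suc k)"
  shows "sorted us \<Longrightarrow> (\<And>u. u \<in> set us \<Longrightarrow> t \<le> u) \<Longrightarrow> switch s k \<le> t \<Longrightarrow> t \<le> r \<Longrightarrow>
    det_weight C s t x us = (\<Sum>y\<in>UNIV. phase_weight C k t x r us y * det_weight C s r y (dropWhile (\<lambda>u. u < r) us))"
proof (induction us arbitrary: t x)
  case Nil
  then show ?case using k by (simp add: ptrans_sum)
next
  case (Cons u us)
  show ?case
  proof (cases "u < r")
    case True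
    let ?w = "\<lambda>y. det_weight C s r y (dropWhile (\<lambda>u. u < r) us)"
    have "switch s k \<le> u" using Cons.prems(2)[of u] Cons.prems(3) by simp
    then have "phase s u = k" using True k r by (intro phase_eq[OF s]) auto
    moreover have "det_trans n s t u x z = ptrans (Suc k) (u - t) x z" for z
      using True Cons.prems k r by (intro det_trans_within_phase[OF s]) auto
    moreover have "det_weight C s u z us = (\<Sum>y\<in>UNIV. phase_weight C k u z r us y * ?w y)" for z
      using True Cons.prems \<open>switch s k \<le> u\<close> by (intro Cons.IH) auto
    ultimately have "det_weight C s t x (u # us)
      = (\<Sum>z\<in>UNIV. \<Sum>y\<in>UNIV. ptrans (Suc k) (u - t) x z * (of_bool (C u (k, z)) * phase_weight C k u z r us y) * ?w y)"
      by (simp only: det_weight.simps sum_distrib_left mult.assoc)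
    also have "\<dots> = (\<Sum>y\<in>UNIV. phase_weight C k t x r (u # us) y * ?w y)"
      using True by (simp only: phase_weight.simps if_True sum_distrib_right) (rule sum.swap)
    finally show ?thesis using True by simp
  next
    case False
    have "det_trans n s t r x z = ptrans (Suc k) (r - t) x z" for z
      using Cons.prems k r by (intro det_trans_within_phase[OF s]) auto
    moreover have "det_trans n s t u x y = (\<Sum>z\<in>UNIV. det_trans n s t r x z * det_trans n s r u z y)" for y
      using Cons.prems False by (intro det_trans_chapman_kolmogorov[OF s]) auto
    ultimately have "det_weight C s t x (u # us)
      = (\<Sum>y\<in>UNIV. \<Sum>z\<in>UNIV. ptrans (Suc k) (r - t) x z * (det_trans n s r u z y * (of_bool (C u (phase s u, y)) * det_weight C s u y us)))"
      by (simp only: det_weight.simps sum_distrib_right mult.assoc)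
    also have "\<dots> = (\<Sum>z\<in>UNIV. ptrans (Suc k) (r - t) x z * det_weight C s r z (u # us))"
      by (simp only: det_weight.simps sum_distrib_left) (rule sum.swap)
    finally show ?thesis using False by simp
  qed
qed

lemma det_weight_last:
  assumes s: "s \<in> open_simplex n"
  shows "sorted us \<Longrightarrow> (\<And>u. u \<in> set us \<Longrightarrow> t \<le> u) \<Longrightarrow> switch s n \<le> t \<Longrightarrow>
    det_weight C s t x us = chain_weight C t (n, x) us"
proof (induction us arbitrary: t x)
  case (Cons u us)
  have "switch s n \<le> u" using Cons.prems(2)[of u] Cons.prems(3) by simp
  then have "phase s u = n" by (intro phase_eq[OF s]) auto
  moreover have "det_trans n s t u x z = ptrans (Suc n) (u - t) x z" for z
    using Cons.prems by (intro det_trans_within_phase[OF s]) auto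
  moreover have "det_weight C s u z us = chain_weight C u (n, z) us" for z
    using Cons.prems \<open>switch s n \<le> u\<close> by (intro Cons.IH) auto
  ultimately show ?case by (simp only: det_weight.simps chain_weight.simps trans_last)
qed simp

section \<open>Integrating out the switching times\<close>

definition switch_density :: "nat \<Rightarrow> (nat \<Rightarrow> real) \<Rightarrow> real" where
  "switch_density k s = (\<Prod>j\<in>{Suc k..n}. q j * exp (- q j * (s j - prev_s s j)))"

lemma switch_density_pos: "0 < switch_density k s"
  unfolding switch_density_def using q_pos by (intro prod_pos) auto

lemma borel_measurable_switch_density [measurable]: "switch_density k \<in> borel_measurable (PiR n)"
proof -
  have "(\<lambda>s. q j * exp (- q j * (s j - prev_s s j))) \<in> borel_measurable (PiR n)" if "j \<in> {Suc k..n}" for j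
  proof -
    have [measurable]: "(\<lambda>s. s j) \<in> borel_measurable (PiR n)"
      using that by (intro borel_measurable_PiR_component) auto
    have [measurable]: "(\<lambda>s. prev_s s j) \<in> borel_measurable (PiR n)"
      using that by (intro borel_measurable_prev_s) auto
    show ?thesis by measurable
  qed
  then show ?thesis unfolding switch_density_def[abs_def] by (rule borel_measurable_prod)
qed

lemma switch_density_Suc:
  assumes "k < n"
  shows "switch_density k s
    = q (Suc k) * exp (- q (Suc k) * (s (Suc k) - switch s k)) * switch_density (Suc k) s"
proof -
  have "{Suc k..n} = insert (Suc k) {Suc (Suc k)..n}" using assms by auto
  then show ?thesis by (simp add: switch_density_def)
qed

text \<open>Averaging over the switches after the \<open>k\<close>-th turns the weight for fixed
  switching times into that of the lifted chain started in phase \<open>k\<close>. The downward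
  induction isolates the next switch at \<open>r\<close>: \<open>det_weight_split\<close> reduces
  the integrand to the observations from \<open>r\<close> on, to which the hypothesis applies with a
  new state and list, and \<open>chain_weight_first_switch\<close> evaluates the integral over
  \<open>r\<close> that remains.\<close>

lemma nested_det_weight:
  assumes "k \<le> n" "s \<in> open_simplex k" "sorted us" "\<And>u. u \<in> set us \<Longrightarrow> switch s k \<le> u"
  shows "nested n k (\<lambda>s'. ennreal (det_weight C s' (switch s k) x us * switch_density k s')) s
      = ennreal (chain_weight C (switch s k) (k, x) us)"
  using assms
proof (induction k arbitrary: s x us rule: inc_induct)
  case base
  then have "det_weight C s (switch s n) x us = chain_weight C (switch s n) (n, x) us"
    by (intro det_weight_last) auto
  then show ?case by (simp add: nested_end switch_density_def)
next
  case (step k)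
  let ?t = "switch s k" and ?Q = "q (Suc k)"
  have k: "k < n" using step.hyps by simp
  have sE: "s \<in> PiE {1..k} (\<lambda>_. UNIV)" using step.prems by (simp add: open_simplex_def)
  let ?F = "\<lambda>s'. ennreal (det_weight C s' ?t x us * switch_density k s')"
  have inner: "nested n (Suc k) ?F (s(Suc k := r)) = ennreal (switch_weight C k ?t x us r)" if r: "?t < r" for r
  proof -
    let ?s = "s(Suc k := r)" and ?us = "dropWhile (\<lambda>u. u < r) us"
    let ?f = "\<lambda>y s'. ennreal (det_weight C s' r y ?us * switch_density (Suc k) s')"
    define c where "c y = phase_weight C k ?t x r us y * (?Q * exp (- ?Q * (r - ?t)))" for y
    have c0: "0 \<le> c y" for y
      unfolding c_def using q_pos[of "Suc k"] k r step.prems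
      by (intro mult_nonneg_nonneg phase_weight_nonneg) auto
    have us: "sorted ?us" "\<And>u. u \<in> set ?us \<Longrightarrow> r \<le> u"
      using step.prems by (auto intro: sorted_dropWhile_less dest: dropWhile_less_ge)
    have sS: "?s \<in> open_simplex (Suc k)"
      using step.prems r by (simp add: open_simplex_upd_iff[OF sE])
    have "nested n (Suc k) ?F ?s = nested n (Suc k) (\<lambda>s'. \<Sum>y\<in>UNIV. ennreal (c y) * ?f y s') ?s"
    proof (rule nested_cong[OF _ sS])
      fix s' assume s': "s' \<in> open_simplex n" and eq: "\<And>j. j \<in> {1..Suc k} \<Longrightarrow> s' j = ?s j"
      have e: "s' (Suc k) = r" "switch s' k = ?t" using eq[of "Suc k"] eq[of k] by (auto simp: switch_def)
      have w: "det_weight C s' ?t x us = (\<Sum>y\<in>UNIV. phase_weight C k ?t x r us y * det_weight C s' r y ?us)"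
        using e r step.prems by (intro det_weight_split[OF s' k]) auto
      have "det_weight C s' ?t x us * switch_density k s'
         = (\<Sum>y\<in>UNIV. c y * (det_weight C s' r y ?us * switch_density (Suc k) s'))"
        unfolding w switch_density_Suc[OF k] e c_def sum_distrib_right
        by (intro sum.cong refl) (simp only: mult_ac)
      moreover have "0 \<le> det_weight C s' r y ?us * switch_density (Suc k) s'" for y
        using us switch_density_pos[of "Suc k" s'] by (intro mult_nonneg_nonneg det_weight_nonneg[OF s']) auto
      ultimately show "?F s' = (\<Sum>y\<in>UNIV. ennreal (c y) * ?f y s')"
        using c0 by (simp add: ennreal_mult[symmetric])
    qed (use k in simp)
    also have "\<dots> = (\<Sum>y\<in>UNIV. ennreal (c y) * nested n (Suc k) (?f y) ?s)"
    proof (rule nested_sum_cmult)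
      show "?s \<in> space (PiR (Suc k))" using sS by (simp add: open_simplex_def space_PiM)
      fix y
      have [measurable]: "(\<lambda>s'. det_weight C s' r y ?us) \<in> borel_measurable (PiR n)"
        by (rule borel_measurable_det_weight) simp
      show "?f y \<in> borel_measurable (PiR n)" by measurable
    qed (use k in auto)
    also have "\<dots> = (\<Sum>y\<in>UNIV. ennreal (c y) * ennreal (chain_weight C r (Suc k, y) ?us))"
    proof -
      have "switch ?s (Suc k) = r" by simp
      note IH = step.IH[OF sS us(1), unfolded this, OF us(2)]
      show ?thesis by (intro sum.cong refl arg_cong2[where f = "(*)"] IH)
    qed
    also have "\<dots> = ennreal (\<Sum>y\<in>UNIV. c y * chain_weight C r (Suc k, y) ?us)"
    proof -
      have "0 \<le> chain_weight C r (Suc k, y) ?us" for y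
        using us k by (intro chain_weight_nonneg) auto
      then show ?thesis using c0 by (simp add: ennreal_mult[symmetric])
    qed
    also have "(\<Sum>y\<in>UNIV. c y * chain_weight C r (Suc k, y) ?us) = switch_weight C k ?t x us r"
      unfolding switch_weight_def c_def sum_distrib_left by (intro sum.cong refl) (simp only: mult_ac)
    finally show ?thesis .
  qed
  have "nested n k ?F s = (\<integral>\<^sup>+ r. indicator {?t<..} r * nested n (Suc k) ?F (s(Suc k := r)) \<partial>lborel)"
    using k by (simp add: nested_step)
  also have "\<dots> = (\<integral>\<^sup>+ r. indicator {?t<..} r * ennreal (switch_weight C k ?t x us r) \<partial>lborel)"
    using inner by (intro nn_integral_cong) (auto split: split_indicator)
  also have "\<dots> = ennreal (chain_weight C ?t (k, x) us)"
    using k step.prems by (intro chain_weight_first_switch) auto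
  finally show ?case .
qed

end

section \<open>Total variation continuity in the switching times\<close>

lemma sum_lists_Suc:
  fixes f :: "'a list \<Rightarrow> real"
  shows "(\<Sum>zs | set zs \<subseteq> A \<and> length zs = Suc m. f zs) = (\<Sum>z\<in>A. \<Sum>zs | set zs \<subseteq> A \<and> length zs = m. f (z # zs))"
proof -
  have "{zs. set zs \<subseteq> A \<and> length zs = Suc m} = (\<lambda>(z, zs). z # zs) ` (A \<times> {zs. set zs \<subseteq> A \<and> length zs = m})"
    by (auto simp: length_Suc_conv)
  moreover have "inj_on (\<lambda>(z, zs). z # zs) (A \<times> {zs. set zs \<subseteq> A \<and> length zs = m})"
    by (auto simp: inj_on_def)
  ultimately have "(\<Sum>zs | set zs \<subseteq> A \<and> length zs = Suc m. f zs)
      = (\<Sum>(z, zs)\<in>A \<times> {zs. set zs \<subseteq> A \<and> length zs = m}. f (z # zs))"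
    by (simp add: sum.reindex case_prod_unfold)
  then show ?thesis by (simp add: sum.cartesian_product)
qed

lemma finite_lists_length: "finite {ys :: 'a::finite list. length ys = m}"
  using finite_lists_length_eq[of "UNIV :: 'a set" m] by simp

definition shift_gap :: "(nat \<Rightarrow> real) \<Rightarrow> (nat \<Rightarrow> real) \<Rightarrow> nat \<Rightarrow> real \<Rightarrow> real" where
  "shift_gap s s' j t = \<bar>max 0 (t - switch s j) - max 0 (t - switch s' j)\<bar>"

text \<open>The difference of the two positive parts is monotone in \<open>t\<close>, so its variation is an increment
  of \<open>shift_gap\<close>.\<close>
lemma shift_gap_increment:
  assumes "a \<le> b"
  shows "\<bar>(max 0 (b - switch s j) - max 0 (b - switch s' j)) - (max 0 (a - switch s j) - max 0 (a - switch s' j))\<bar>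
    = shift_gap s s' j b - shift_gap s s' j a"
  using assms by (auto simp: shift_gap_def max_def)

context switching
begin

section \<open>Perturbation of a single transition\<close>

definition gen_bound :: real where
  "gen_bound = (\<Sum>k\<in>{1..Suc n}. \<Sum>z\<in>UNIV. \<Sum>y\<in>UNIV. \<bar>G k z y\<bar>)"

lemma gen_bound_nonneg: "0 \<le> gen_bound"
  unfolding gen_bound_def by (intro sum_nonneg) auto

lemma ptrans_le_1:
  assumes "k \<in> {1..Suc n}" "0 \<le> t"
  shows "ptrans k t x y \<le> 1"
proof -
  have "ptrans k t x y \<le> (\<Sum>y\<in>UNIV. ptrans k t x y)"
    using assms by (intro member_le_sum ptrans_nonneg) auto
  then show ?thesis by (simp only: ptrans_sum[OF assms(1)])
qed

text \<open>Mean value estimate from the forward equation, in which the transition probabilities are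
  at most one. This holds for nonnegative times only, hence the restriction to
  \<open>{0..}\<close>.\<close>

lemma ptrans_lipschitz:
  assumes k: "k \<in> {1..Suc n}" and t: "0 \<le> t" and u: "0 \<le> u"
  shows "(\<Sum>y\<in>UNIV. \<bar>ptrans k t x y - ptrans k u x y\<bar>) \<le> gen_bound * \<bar>t - u\<bar>"
proof -
  have "\<bar>ptrans k t x y - ptrans k u x y\<bar> \<le> (\<Sum>z\<in>UNIV. \<bar>G k z y\<bar>) * \<bar>t - u\<bar>" for y
  proof -
    have "norm (ptrans k t x y - ptrans k u x y) \<le> (\<Sum>z\<in>UNIV. \<bar>G k z y\<bar>) * norm (t - u)"
    proof (rule field_differentiable_bound[where S = "{0..}"])
      fix r :: real assume r: "r \<in> {0..}"
      show "((\<lambda>r. ptrans k r x y) has_field_derivative (\<Sum>z\<in>UNIV. ptrans k r x z * G k z y)) (at r within {0..})"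
        by (rule has_field_derivative_at_within, rule mat_exp_deriv) auto
      have "\<bar>\<Sum>z\<in>UNIV. ptrans k r x z * G k z y\<bar> \<le> (\<Sum>z\<in>UNIV. ptrans k r x z * \<bar>G k z y\<bar>)"
        using r by (intro order_trans[OF sum_abs] sum_mono) (simp add: abs_mult ptrans_nonneg[OF k])
      also have "\<dots> \<le> (\<Sum>z\<in>UNIV. 1 * \<bar>G k z y\<bar>)"
        using r by (intro sum_mono mult_right_mono ptrans_le_1[OF k]) auto
      finally show "norm (\<Sum>z\<in>UNIV. ptrans k r x z * G k z y) \<le> (\<Sum>z\<in>UNIV. \<bar>G k z y\<bar>)" by simp
    qed (use t u in auto)
    then show ?thesis by simp
  qed
  then have "(\<Sum>y\<in>UNIV. \<bar>ptrans k t x y - ptrans k u x y\<bar>) \<le> (\<Sum>y\<in>UNIV. (\<Sum>z\<in>UNIV. \<bar>G k z y\<bar>) * \<bar>t - u\<bar>)"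
    by (intro sum_mono)
  also have "\<dots> = (\<Sum>z\<in>UNIV. \<Sum>y\<in>UNIV. \<bar>G k z y\<bar>) * \<bar>t - u\<bar>"
    unfolding sum_distrib_right[symmetric] by (subst sum.swap) simp
  also have "\<dots> \<le> gen_bound * \<bar>t - u\<bar>"
    unfolding gen_bound_def using k
    by (intro mult_right_mono member_le_sum[of k _ "\<lambda>k. \<Sum>z\<in>UNIV. \<Sum>y\<in>UNIV. \<bar>G k z y\<bar>"]) (auto intro!: sum_nonneg)
  finally show ?thesis .
qed

text \<open>The factors are exchanged phase by phase, using
  \<open>d * e - d' * e' = (d - d') * e + d' * (e - e')\<close>. The rows of \<open>e\<close> and
  \<open>d'\<close> are probability vectors, so previous errors are not amplified and each exchange
  costs its own error only.\<close>

lemma det_trans_perturb: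
  assumes s: "s \<in> open_simplex n" and s': "s' \<in> open_simplex n" and ab: "a \<le> b" and m: "m \<le> n"
  shows "(\<Sum>y\<in>UNIV. \<bar>det_trans m s a b x y - det_trans m s' a b x y\<bar>)
    \<le> (\<Sum>j\<le>m. gen_bound * \<bar>(occ_time s j b - occ_time s j a) - (occ_time s' j b - occ_time s' j a)\<bar>)"
  using m
proof (induction m)
  case 0
  show ?case
    using ptrans_lipschitz[of 1 "occ_time s 0 b - occ_time s 0 a" "occ_time s' 0 b - occ_time s' 0 a" x]
      occ_time_mono[OF s ab, of 0] occ_time_mono[OF s' ab, of 0] by simp
next
  case (Suc m)
  define e where "e = ptrans (Suc (Suc m)) (occ_time s (Suc m) b - occ_time s (Suc m) a)"
  define e' where "e' = ptrans (Suc (Suc m)) (occ_time s' (Suc m) b - occ_time s' (Suc m) a)"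
  let ?d = "det_trans m s a b" and ?d' = "det_trans m s' a b"
  have e0: "0 \<le> e z y" "(\<Sum>y\<in>UNIV. e z y) = 1" for z y
    using occ_time_mono[OF s ab, of "Suc m"] Suc.prems
    by (auto simp: e_def intro!: ptrans_nonneg ptrans_sum)
  have d'0: "0 \<le> ?d' x z" "(\<Sum>z\<in>UNIV. ?d' x z) = 1" for z
    using Suc.prems by (auto intro!: det_trans_nonneg[OF s' ab] det_trans_sum)
  have ee: "(\<Sum>y\<in>UNIV. \<bar>e z y - e' z y\<bar>)
      \<le> gen_bound * \<bar>(occ_time s (Suc m) b - occ_time s (Suc m) a) - (occ_time s' (Suc m) b - occ_time s' (Suc m) a)\<bar>" (is "_ \<le> ?g") for z
    unfolding e_def e'_def using Suc.prems occ_time_mono[OF s ab, of "Suc m"] occ_time_mono[OF s' ab, of "Suc m"]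
    by (intro ptrans_lipschitz) auto
  have "\<bar>det_trans (Suc m) s a b x y - det_trans (Suc m) s' a b x y\<bar>
      \<le> (\<Sum>z\<in>UNIV. \<bar>?d x z - ?d' x z\<bar> * e z y + ?d' x z * \<bar>e z y - e' z y\<bar>)" for y
  proof -
    have "det_trans (Suc m) s a b x y - det_trans (Suc m) s' a b x y
        = (\<Sum>z\<in>UNIV. (?d x z - ?d' x z) * e z y + ?d' x z * (e z y - e' z y))"
      unfolding det_trans.simps e_def[symmetric] e'_def[symmetric] sum_subtractf[symmetric]
      by (intro sum.cong refl) (simp add: algebra_simps)
    then have "\<bar>det_trans (Suc m) s a b x y - det_trans (Suc m) s' a b x y\<bar>
        \<le> (\<Sum>z\<in>UNIV. \<bar>(?d x z - ?d' x z) * e z y + ?d' x z * (e z y - e' z y)\<bar>)"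
      by (simp only: sum_abs)
    also have "\<dots> \<le> (\<Sum>z\<in>UNIV. \<bar>?d x z - ?d' x z\<bar> * e z y + ?d' x z * \<bar>e z y - e' z y\<bar>)"
    proof (rule sum_mono)
      fix z
      show "\<bar>(?d x z - ?d' x z) * e z y + ?d' x z * (e z y - e' z y)\<bar>
          \<le> \<bar>?d x z - ?d' x z\<bar> * e z y + ?d' x z * \<bar>e z y - e' z y\<bar>"
        using abs_triangle_ineq[of "(?d x z - ?d' x z) * e z y" "?d' x z * (e z y - e' z y)"]
        by (simp only: abs_mult abs_of_nonneg[OF e0(1)] abs_of_nonneg[OF d'0(1)])
    qed
    finally show ?thesis .
  qed
  then have "(\<Sum>y\<in>UNIV. \<bar>det_trans (Suc m) s a b x y - det_trans (Suc m) s' a b x y\<bar>)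
      \<le> (\<Sum>y\<in>UNIV. \<Sum>z\<in>UNIV. \<bar>?d x z - ?d' x z\<bar> * e z y + ?d' x z * \<bar>e z y - e' z y\<bar>)"
    by (intro sum_mono)
  also have "\<dots> = (\<Sum>z\<in>UNIV. \<Sum>y\<in>UNIV. \<bar>?d x z - ?d' x z\<bar> * e z y + ?d' x z * \<bar>e z y - e' z y\<bar>)"
    by (rule sum.swap)
  also have "\<dots> = (\<Sum>z\<in>UNIV. \<bar>?d x z - ?d' x z\<bar>) + (\<Sum>z\<in>UNIV. ?d' x z * (\<Sum>y\<in>UNIV. \<bar>e z y - e' z y\<bar>))"
    by (simp add: sum.distrib sum_distrib_left[symmetric] e0)
  also have "\<dots> \<le> (\<Sum>z\<in>UNIV. \<bar>?d x z - ?d' x z\<bar>) + (\<Sum>z\<in>UNIV. ?d' x z * ?g)"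
    using d'0 ee by (intro add_left_mono sum_mono mult_left_mono)
  also have "(\<Sum>z\<in>UNIV. ?d' x z * ?g) = ?g" by (simp add: sum_distrib_right[symmetric] d'0)
  finally show ?case using Suc by simp
qed

text \<open>An occupation time is affected at both of its ends, which gives two gaps per phase
  before the last. Since this is a function of a single time, the bounds for consecutive intervals,
  being its increments, telescope.\<close>

definition gap_potential :: "(nat \<Rightarrow> real) \<Rightarrow> (nat \<Rightarrow> real) \<Rightarrow> real \<Rightarrow> real" where
  "gap_potential s s' t = (\<Sum>j\<le>n. gen_bound * (shift_gap s s' j t + (if j < n then shift_gap s s' (Suc j) t else 0)))"

lemma det_trans_perturb':
  assumes s: "s \<in> open_simplex n" and s': "s' \<in> open_simplex n" and ab: "a \<le> b"
  shows "(\<Sum>y\<in>UNIV. \<bar>det_trans n s a b x y - det_trans n s' a b x y\<bar>)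
    \<le> gap_potential s s' b - gap_potential s s' a"
proof -
  have "\<bar>(occ_time s j b - occ_time s j a) - (occ_time s' j b - occ_time s' j a)\<bar>
     \<le> (shift_gap s s' j b + (if j < n then shift_gap s s' (Suc j) b else 0))
       - (shift_gap s s' j a + (if j < n then shift_gap s s' (Suc j) a else 0))" for j
  proof -
    define X where "X i = (max 0 (b - switch s i) - max 0 (b - switch s' i))
      - (max 0 (a - switch s i) - max 0 (a - switch s' i))" for i
    have X: "\<bar>X i\<bar> = shift_gap s s' i b - shift_gap s s' i a" for i
      unfolding X_def by (rule shift_gap_increment[OF ab])
    have "(occ_time s j b - occ_time s j a) - (occ_time s' j b - occ_time s' j a)
        = X j - (if j < n then X (Suc j) else 0)"
      unfolding occ_time_def X_def by simp
    then show ?thesis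
      using X[of j] X[of "Suc j"] abs_triangle_ineq4[of "X j" "X (Suc j)"] by (cases "j < n") simp_all
  qed
  then have "(\<Sum>j\<le>n. gen_bound * \<bar>(occ_time s j b - occ_time s j a) - (occ_time s' j b - occ_time s' j a)\<bar>)
    \<le> (\<Sum>j\<le>n. gen_bound * ((shift_gap s s' j b + (if j < n then shift_gap s s' (Suc j) b else 0))
       - (shift_gap s s' j a + (if j < n then shift_gap s s' (Suc j) a else 0))))"
    using gen_bound_nonneg by (intro sum_mono mult_left_mono)
  also have "\<dots> = gap_potential s s' b - gap_potential s s' a"
    unfolding gap_potential_def sum_subtractf[symmetric] right_diff_distrib ..
  finally show ?thesis using det_trans_perturb[OF s s' ab order_refl, of x] by linarith
qed

section \<open>Perturbation of path laws\<close>

fun path_prob :: "(nat \<Rightarrow> real) \<Rightarrow> real \<Rightarrow> 'e \<Rightarrow> real list \<Rightarrow> 'e list \<Rightarrow> real" where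
  "path_prob s t x (u # us) (y # ys) = det_trans n s t u x y * path_prob s u y us ys"
| "path_prob s t x _ _ = 1"

lemma path_prob_nonneg:
  "s \<in> open_simplex n \<Longrightarrow> sorted us \<Longrightarrow> (\<And>u. u \<in> set us \<Longrightarrow> t \<le> u) \<Longrightarrow> 0 \<le> path_prob s t x us ys"
  by (induction s t x us ys rule: path_prob.induct) (auto intro!: mult_nonneg_nonneg det_trans_nonneg)

lemma path_prob_sum: "(\<Sum>ys | length ys = length us. path_prob s t x us ys) = 1"
proof (induction us arbitrary: t x)
  case (Cons u us)
  then show ?case by (simp add: sum_lists_Suc[where A = UNIV, simplified] sum_distrib_left[symmetric] det_trans_sum)
qed simp

text \<open>The same exchange, now along the observation times. The probabilities of the remaining
  path sum to one, so each interval costs the increment of \<open>gap_potential\<close> over it; in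
  the telescoped sum the number of observation times has disappeared.\<close>

lemma path_prob_perturb:
  assumes s: "s \<in> open_simplex n" and s': "s' \<in> open_simplex n"
  shows "sorted us \<Longrightarrow> (\<And>u. u \<in> set us \<Longrightarrow> t \<le> u) \<Longrightarrow>
    (\<Sum>ys | length ys = length us. \<bar>path_prob s t x us ys - path_prob s' t x us ys\<bar>)
      \<le> gap_potential s s' (last (t # us)) - gap_potential s s' t"
proof (induction us arbitrary: t x)
  case (Cons u us)
  let ?d = "det_trans n s t u x" and ?d' = "det_trans n s' t u x"
  let ?L = "{ys :: 'e list. length ys = length us}"
  let ?g = "gap_potential s s'"
  have d0: "0 \<le> ?d y" "(\<Sum>y\<in>UNIV. ?d y) = 1" for y
    using Cons.prems by (auto intro!: det_trans_nonneg[OF s] det_trans_sum)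
  have IH: "(\<Sum>ys\<in>?L. \<bar>path_prob s u y us ys - path_prob s' u y us ys\<bar>) \<le> ?g (last (u # us)) - ?g u" for y
    using Cons.prems by (intro Cons.IH) auto
  have "(\<Sum>ys | length ys = length (u # us). \<bar>path_prob s t x (u # us) ys - path_prob s' t x (u # us) ys\<bar>)
    = (\<Sum>y\<in>UNIV. \<Sum>ys\<in>?L. \<bar>?d y * path_prob s u y us ys - ?d' y * path_prob s' u y us ys\<bar>)"
    by (simp add: sum_lists_Suc[where A = UNIV, simplified])
  also have "\<dots> \<le> (\<Sum>y\<in>UNIV. \<Sum>ys\<in>?L. \<bar>?d y - ?d' y\<bar> * path_prob s' u y us ys
      + ?d y * \<bar>path_prob s u y us ys - path_prob s' u y us ys\<bar>)"
  proof (intro sum_mono)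
    fix y ys
    have p: "0 \<le> path_prob s' u y us ys" using Cons.prems by (intro path_prob_nonneg[OF s']) auto
    have "?d y * path_prob s u y us ys - ?d' y * path_prob s' u y us ys
       = (?d y - ?d' y) * path_prob s' u y us ys + ?d y * (path_prob s u y us ys - path_prob s' u y us ys)"
      by (simp add: algebra_simps)
    then have "\<bar>?d y * path_prob s u y us ys - ?d' y * path_prob s' u y us ys\<bar>
       \<le> \<bar>(?d y - ?d' y) * path_prob s' u y us ys\<bar> + \<bar>?d y * (path_prob s u y us ys - path_prob s' u y us ys)\<bar>"
      by (simp only: abs_triangle_ineq)
    also have "\<dots> = \<bar>?d y - ?d' y\<bar> * path_prob s' u y us ys
        + ?d y * \<bar>path_prob s u y us ys - path_prob s' u y us ys\<bar>"
      using p d0 by (simp add: abs_mult)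
    finally show "\<bar>?d y * path_prob s u y us ys - ?d' y * path_prob s' u y us ys\<bar>
      \<le> \<bar>?d y - ?d' y\<bar> * path_prob s' u y us ys + ?d y * \<bar>path_prob s u y us ys - path_prob s' u y us ys\<bar>" .
  qed
  also have "\<dots> = (\<Sum>y\<in>UNIV. \<bar>?d y - ?d' y\<bar>)
      + (\<Sum>y\<in>UNIV. ?d y * (\<Sum>ys\<in>?L. \<bar>path_prob s u y us ys - path_prob s' u y us ys\<bar>))"
    by (simp add: sum.distrib sum_distrib_left[symmetric] path_prob_sum)
  also have "\<dots> \<le> (?g u - ?g t) + (\<Sum>y\<in>UNIV. ?d y * (?g (last (u # us)) - ?g u))"
    using d0 IH Cons.prems
    by (intro add_mono sum_mono mult_left_mono det_trans_perturb'[OF s s']) auto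
  also have "(\<Sum>y\<in>UNIV. ?d y * (?g (last (u # us)) - ?g u)) = ?g (last (u # us)) - ?g u"
    by (simp add: sum_distrib_right[symmetric] d0)
  finally show ?case by simp
qed simp

text \<open>Only lists as long as \<open>us\<close> can occur as observations, so the sum is finite
  for every \<open>B\<close>.\<close>

definition path_law :: "'e \<Rightarrow> (nat \<Rightarrow> real) \<Rightarrow> real list \<Rightarrow> 'e list set \<Rightarrow> real" where
  "path_law i s us B = (\<Sum>ys | ys \<in> B \<and> length ys = length us. path_prob s 0 i us ys)"

lemma finite_path_law: "finite {ys :: 'e list. ys \<in> B \<and> length ys = m}"
  by (rule finite_subset[OF _ finite_lists_length[of m]]) auto

lemma path_law_nonneg:
  "s \<in> open_simplex n \<Longrightarrow> sorted us \<Longrightarrow> (\<And>u. u \<in> set us \<Longrightarrow> 0 \<le> u) \<Longrightarrow> 0 \<le> path_law i s us B"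
  unfolding path_law_def by (intro sum_nonneg path_prob_nonneg) auto

text \<open>Every gap is at most \<open>\<delta>\<close>, and at most two of them occur in each of
  the \<open>n + 1\<close> phases; this is the origin of the constant. Enlarging the sum from
  \<open>B\<close> to all lists makes the bound uniform in \<open>B\<close>.\<close>

lemma path_law_lipschitz:
  assumes s: "s \<in> open_simplex n" and s': "s' \<in> open_simplex n"
    and \<delta>: "\<And>k. k \<in> {1..n} \<Longrightarrow> \<bar>s k - s' k\<bar> \<le> \<delta>" "0 \<le> \<delta>"
    and us: "sorted us" "\<And>u. u \<in> set us \<Longrightarrow> 0 \<le> u"
  shows "\<bar>path_law i s us B - path_law i s' us B\<bar> \<le> 2 * Suc n * gen_bound * \<delta>"
proof -
  have gap: "shift_gap s s' j t \<le> \<delta>" if "j \<le> n" for j t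
  proof -
    have "\<bar>switch s j - switch s' j\<bar> \<le> \<delta>" using \<delta> that by (cases j) auto
    then show ?thesis by (auto simp: shift_gap_def max_def)
  qed
  have nonneg: "0 \<le> gap_potential s s' t" for t
    unfolding gap_potential_def using gen_bound_nonneg
    by (intro sum_nonneg mult_nonneg_nonneg) (auto simp: shift_gap_def)
  have le: "gap_potential s s' t \<le> 2 * Suc n * gen_bound * \<delta>" for t
  proof -
    have "gap_potential s s' t \<le> (\<Sum>j\<le>n. gen_bound * (\<delta> + \<delta>))"
      unfolding gap_potential_def using gen_bound_nonneg gap \<delta>(2)
      by (intro sum_mono mult_left_mono add_mono) auto
    then show ?thesis by (simp add: algebra_simps)
  qed
  have "\<bar>path_law i s us B - path_law i s' us B\<bar>
      \<le> (\<Sum>ys | ys \<in> B \<and> length ys = length us. \<bar>path_prob s 0 i us ys - path_prob s' 0 i us ys\<bar>)"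
    unfolding path_law_def sum_subtractf[symmetric] by (rule sum_abs)
  also have "\<dots> \<le> (\<Sum>ys | length ys = length us. \<bar>path_prob s 0 i us ys - path_prob s' 0 i us ys\<bar>)"
    by (intro sum_mono2 finite_lists_length) auto
  also have "\<dots> \<le> gap_potential s s' (last (0 # us)) - gap_potential s s' 0"
    using us by (intro path_prob_perturb[OF s s']) auto
  finally show ?thesis using nonneg[of 0] le[of "last (0 # us)"] by linarith
qed

text \<open>For fixed \<open>s\<close> the phase is a deterministic function of time, so conditions
  on it leave the sums as one indicator.\<close>

lemma det_weight_phase_constraint:
  "det_weight (\<lambda>u z. \<alpha> u (fst z) \<and> \<beta> u (snd z)) s t x us
    = of_bool (\<forall>u\<in>set us. \<alpha> u (phase s u)) * det_weight (\<lambda>u z. \<beta> u (snd z)) s t x us"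
proof (induction us arbitrary: t x)
  case (Cons u us)
  show ?case unfolding det_weight.simps Cons sum_distrib_left
    by (intro sum.cong refl) (auto simp: of_bool_def)
qed simp

text \<open>Unconstrained times are removed by Chapman-Kolmogorov, or by the row sums when no later
  time is left. This eliminates the times at which \<open>N\<close> alone is observed.\<close>

lemma det_weight_filter:
  assumes s: "s \<in> open_simplex n" and P: "\<And>u y. \<not> P u \<Longrightarrow> \<beta> u y"
  shows "sorted us \<Longrightarrow> (\<And>u. u \<in> set us \<Longrightarrow> t \<le> u) \<Longrightarrow>
    det_weight (\<lambda>u z. \<beta> u (snd z)) s t x us = det_weight (\<lambda>u z. \<beta> u (snd z)) s t x (filter P us)"
proof (induction us arbitrary: t x)
  case (Cons u us)
  let ?W = "det_weight (\<lambda>u z. \<beta> u (snd z)) s"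
  have IH: "?W u y us = ?W u y (filter P us)" for y
    using Cons.prems by (intro Cons.IH) auto
  show ?case
  proof (cases "P u")
    case False
    have "(\<Sum>y\<in>UNIV. det_trans n s t u x y * ?W u y vs) = ?W t x vs" if vs: "\<And>v. v \<in> set vs \<Longrightarrow> u \<le> v" for vs
    proof (cases vs)
      case (Cons v vs')
      have "(\<Sum>y\<in>UNIV. det_trans n s t u x y * ?W u y vs)
        = (\<Sum>y\<in>UNIV. \<Sum>w\<in>UNIV. det_trans n s t u x y * det_trans n s u v y w * (of_bool (\<beta> v w) * ?W v w vs'))"
        by (simp only: Cons det_weight.simps sum_distrib_left mult.assoc snd_conv)
      also have "\<dots> = (\<Sum>w\<in>UNIV. (\<Sum>y\<in>UNIV. det_trans n s t u x y * det_trans n s u v y w) * (of_bool (\<beta> v w) * ?W v w vs'))"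
        unfolding sum_distrib_right by (rule sum.swap)
      also have "\<dots> = ?W t x vs"
        using Cons.prems vs[of v] Cons
        by (simp add: det_trans_chapman_kolmogorov[OF s, of t u v n x])
      finally show ?thesis .
    qed (simp add: det_trans_sum)
    from this[of "filter P us"] show ?thesis using False Cons.prems P[OF False] by (simp add: IH)
  qed (simp add: IH)
qed simp

lemma det_weight_eq_path_prob:
  "det_weight (\<lambda>u z. u \<in> U \<longrightarrow> snd z = f u) s t x us = path_prob s t x us (map f us)" if "set us \<subseteq> U"
  using that
proof (induction us arbitrary: t x)
  case (Cons u us)
  have "det_weight (\<lambda>u z. u \<in> U \<longrightarrow> snd z = f u) s u y us = path_prob s u y us (map f us)" for y
    using Cons by simp
  then have "det_weight (\<lambda>u z. u \<in> U \<longrightarrow> snd z = f u) s t x (u # us)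
    = (\<Sum>y\<in>UNIV. if y = f u then det_trans n s t u x y * path_prob s u y us (map f us) else 0)"
    unfolding det_weight.simps using Cons.prems by (intro sum.cong refl) simp
  then show ?case by simp
qed simp

end

section \<open>The law of the chain as a mixture over the switching times\<close>

declare One_nat_def [simp del]

lemma mat_exp_0_action:
  fixes f :: "'s \<Rightarrow> real"
  assumes "finite St" "z \<in> St"
  shows "(\<Sum>z'\<in>St. mat_exp St Q 0 z z' * f z') = f z"
proof -
  have "(\<Sum>z'\<in>St. mat_exp St Q 0 z z' * f z') = (\<Sum>z'\<in>St. if z = z' then f z' else 0)"
    by (intro sum.cong) (auto simp: mat_exp_0)
  then show ?thesis using assms by simp
qed

context switching
begin

text \<open>Multiplies out the nested sums, because \<open>ctmc\<close> prescribes the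
  finite-dimensional laws path by path.\<close>

lemma chain_weight_eq_path_weight:
  "chain_weight C t z us = (\<Sum>zs | set zs \<subseteq> states \<and> length zs = length us.
     of_bool (list_all2 C us zs) * path_weight chain_trans t z us zs)"
proof (induction us arbitrary: t z)
  case (Cons u us)
  have "chain_weight C t z (u # us) = (\<Sum>z'\<in>states. \<Sum>zs | set zs \<subseteq> states \<and> length zs = length us.
     of_bool (list_all2 C (u # us) (z' # zs)) * path_weight chain_trans t z (u # us) (z' # zs))"
    unfolding chain_weight.simps Cons sum_distrib_left by (intro sum.cong refl) auto
  then show ?case by (simp only: sum_lists_Suc list.size add_Suc_right add_0_right)
qed (simp add: conj_commute cong: conj_cong)

section \<open>The law of the switching times\<close>

definition switch_law :: "(nat \<Rightarrow> real) measure" where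
  "switch_law = density (PiR n) (\<lambda>s. indicator (open_simplex n) s * ennreal (switch_density 0 s))"

lemma sets_switch_law [measurable_cong, simp]: "sets switch_law = sets (PiR n)"
  by (simp add: switch_law_def)

lemma nn_integral_switch_law:
  assumes [measurable]: "f \<in> borel_measurable (PiR n)"
  shows "(\<integral>\<^sup>+ s. f s \<partial>switch_law) = (\<integral>\<^sup>+ s. indicator (open_simplex n) s * (ennreal (switch_density 0 s) * f s) \<partial>PiR n)"
  unfolding switch_law_def by (subst nn_integral_density) (auto simp: mult.assoc)

lemma nn_integral_switch_law_eq_iterated:
  assumes [measurable]: "f \<in> borel_measurable (PiR n)"
  shows "(\<integral>\<^sup>+ s. f s \<partial>switch_law) = iterated_integral n (\<lambda>s. f s * ennreal (switch_density 0 s))"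
  unfolding nn_integral_switch_law[OF assms]
  by (subst iterated_integral_eq_nn_integral) (auto simp: mult_ac)

lemma AE_switch_law: "AE s in switch_law. s \<in> open_simplex n"
  unfolding switch_law_def by (subst AE_density) (auto split: split_indicator)

lemma chain_weight_eq_mixture:
  assumes "sorted us" "\<And>u. u \<in> set us \<Longrightarrow> 0 \<le> u"
  shows "ennreal (chain_weight C 0 (0, x) us) = (\<integral>\<^sup>+ s. ennreal (det_weight C s 0 x us) \<partial>switch_law)"
proof -
  have m[measurable]: "(\<lambda>s. det_weight C s 0 x us) \<in> borel_measurable (PiR n)"
    by (rule borel_measurable_det_weight) simp
  have u: "(\<lambda>_. undefined) \<in> open_simplex 0" by (simp add: open_simplex_def)
  have "ennreal (chain_weight C 0 (0, x) us)
      = nested n 0 (\<lambda>s. ennreal (det_weight C s 0 x us * switch_density 0 s)) (\<lambda>_. undefined)"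
    using nested_det_weight[OF _ u assms(1), of C x] assms(2) by simp
  also have "\<dots> = iterated_integral n (\<lambda>s. ennreal (det_weight C s 0 x us) * ennreal (switch_density 0 s))"
    unfolding iterated_integral_def
    by (rule nested_cong[OF _ u])
       (use assms in \<open>auto intro!: ennreal_mult det_weight_nonneg less_imp_le[OF switch_density_pos]\<close>)
  also have "\<dots> = (\<integral>\<^sup>+ s. ennreal (det_weight C s 0 x us) \<partial>switch_law)"
    by (rule nn_integral_switch_law_eq_iterated[symmetric]) measurable
  finally show ?thesis .
qed

text \<open>For an empty list of observation times the mixture formula compares the number one with
  the total mass.\<close>

lemma emeasure_switch_law: "emeasure switch_law (space switch_law) = 1"
  using chain_weight_eq_mixture[of "[]" "\<lambda>_ _. True" undefined] by simp

end

section \<open>The chain conditioned to start in \<open>(0, i)\<close> and its joint laws\<close>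

locale switching_chain = switching n G q + prob_space M
  for n :: nat and G :: "nat \<Rightarrow> 'e::finite \<Rightarrow> 'e \<Rightarrow> real" and q :: "nat \<Rightarrow> real" and M :: "'w measure" +
  fixes Z :: "real \<Rightarrow> 'w \<Rightarrow> nat \<times> 'e" and i :: 'e
  assumes chain: "ctmc M ({..n} \<times> UNIV) (lifted_gen n G q) Z"
    and start_pos: "0 < measure M {\<omega> \<in> space M. Z 0 \<omega> = (0, i)}"
begin

lemma measurable_Z: "0 \<le> t \<Longrightarrow> Z t \<in> measurable M (count_space UNIV)"
  using chain by (simp add: ctmc_def)

lemma Z_state: "\<omega> \<in> space M \<Longrightarrow> 0 \<le> t \<Longrightarrow> fst (Z t \<omega>) \<le> n"
  using chain by (auto simp: ctmc_def mem_Times_iff)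

lemma Z_right_const:
  assumes "\<omega> \<in> space M" "0 \<le> t"
  obtains \<epsilon> where "0 < \<epsilon>" "\<And>s. t \<le> s \<Longrightarrow> s < t + \<epsilon> \<Longrightarrow> Z s \<omega> = Z t \<omega>"
proof -
  have "\<exists>\<epsilon>>0. \<forall>s. t \<le> s \<and> s < t + \<epsilon> \<longrightarrow> Z s \<omega> = Z t \<omega>"
    using chain assms unfolding ctmc_def by blast
  then show thesis using that by blast
qed

lemma sets_Z [measurable (raw)]: "0 \<le> t \<Longrightarrow> {\<omega> \<in> space M. P (Z t \<omega>)} \<in> sets M"
  using measurable_sets[OF measurable_Z, of t "{z. P z}"] by (simp add: vimage_def Int_def conj_commute)

definition Start :: "'w set" where "Start = {\<omega> \<in> space M. Z 0 \<omega> = (0, i)}"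

lemma sets_Start [measurable, simp]: "Start \<in> sets M"
  unfolding Start_def by (rule sets_Z) simp

definition P0 :: "'w measure" where "P0 = uniform_measure M Start"

lemma Start_pos: "0 < measure M Start" using start_pos by (simp add: Start_def)

lemma Start_ne: "emeasure M Start \<noteq> 0" "emeasure M Start \<noteq> \<infinity>"
  using Start_pos by (auto simp: emeasure_eq_measure)

lemma sets_P0 [measurable_cong, simp]: "sets P0 = sets M" by (simp add: P0_def)
lemma space_P0 [simp]: "space P0 = space M" by (simp add: P0_def)

sublocale P0: prob_space P0
  unfolding P0_def using Start_ne by (rule prob_space_uniform_measure)

lemma measure_P0: "A \<in> sets M \<Longrightarrow> measure P0 A = measure M (Start \<inter> A) / measure M Start"
  unfolding P0_def using Start_ne by (subst measure_uniform_measure) auto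

lemma condP_eq: "A \<in> sets M \<Longrightarrow> condP M Z i A = measure P0 A"
  by (simp add: condP_def measure_P0 Start_def[symmetric] Int_commute)

lemma AE_Start: "AE \<omega> in P0. \<omega> \<in> Start"
  unfolding P0_def using Start_ne by (intro AE_uniform_measureI) auto

text \<open>The event is the finite disjoint union of the events \<open>E zs\<close> that prescribe
  all states at the times \<open>us\<close>, and \<open>ctmc\<close> gives the probability of each
  of them.\<close>

lemma prob_path:
  assumes "sorted_wrt (<) us" "\<And>u. u \<in> set us \<Longrightarrow> 0 < u"
  shows "measure P0 {\<omega> \<in> space M. \<forall>u\<in>set us. C u (Z u \<omega>)} = chain_weight C 0 (0, i) us"
proof -
  define E where "E zs = {\<omega> \<in> space M. Z 0 \<omega> = (0, i) \<and> list_all2 (\<lambda>t x. Z t \<omega> = x) us zs}" for zs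
  define ZS where "ZS = {zs. set zs \<subseteq> states \<and> length zs = length us}"
  have fin: "finite ZS" unfolding ZS_def by (rule finite_lists_length_eq) simp
  have E_sets: "E zs \<in> sets M" if "length zs = length us" for zs
  proof -
    have "E zs = Start \<inter> {\<omega> \<in> space M. \<forall>j\<in>{..<length us}. Z (us ! j) \<omega> = zs ! j}"
      using that by (auto simp: E_def Start_def list_all2_conv_all_nth)
    moreover have "{\<omega> \<in> space M. \<forall>j\<in>{..<length us}. Z (us ! j) \<omega> = zs ! j} \<in> sets M"
      using assms(2) by (intro sets.sets_Collect_finite_All sets_Z) (auto intro: less_imp_le)
    ultimately show ?thesis by simp
  qed
  have E_prob: "measure M (E zs) = measure M Start * path_weight chain_trans 0 (0, i) us zs"
    if zs: "length zs = length us" for zs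
  proof -
    have "\<forall>ts xs x0. sorted_wrt (<) ts \<and> (\<forall>t\<in>set ts. 0 < t) \<and> length xs = length ts \<longrightarrow>
        measure M {\<omega>\<in>space M. Z 0 \<omega> = x0 \<and> list_all2 (\<lambda>t x. Z t \<omega> = x) ts xs}
        = measure M {\<omega>\<in>space M. Z 0 \<omega> = x0} * path_weight chain_trans 0 x0 ts xs"
      using chain unfolding ctmc_def by (elim conjE)
    note this[rule_format, of us zs "(0, i)"]
    then show ?thesis using assms zs by (simp add: E_def Start_def)
  qed
  have E_val: "zs = map (\<lambda>u. Z u \<omega>) us" if "\<omega> \<in> E zs" for zs \<omega>
    using that by (auto simp: E_def list_all2_conv_all_nth intro: nth_equalityI)
  have meas: "{\<omega> \<in> space M. \<forall>u\<in>set us. C u (Z u \<omega>)} \<in> sets M"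
    using assms(2) by (intro sets.sets_Collect_finite_All sets_Z) (auto intro: less_imp_le)
  have "Start \<inter> {\<omega> \<in> space M. \<forall>u\<in>set us. C u (Z u \<omega>)} = (\<Union>zs\<in>{zs \<in> ZS. list_all2 C us zs}. E zs)"
  proof safe
    fix \<omega> assume \<omega>: "\<omega> \<in> Start" "\<omega> \<in> space M" "\<forall>u\<in>set us. C u (Z u \<omega>)"
    let ?zs = "map (\<lambda>u. Z u \<omega>) us"
    have "Z u \<omega> \<in> states" if "u \<in> set us" for u
      using Z_state[OF \<omega>(2)] less_imp_le[OF assms(2)[OF that]] by (simp add: mem_Times_iff)
    then have "?zs \<in> ZS" by (simp add: ZS_def image_subset_iff)
    moreover have "list_all2 C us ?zs" using \<omega> by (simp add: list_all2_conv_all_nth)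
    moreover have "\<omega> \<in> E ?zs" using \<omega> by (simp add: E_def Start_def list_all2_conv_all_nth)
    ultimately show "\<omega> \<in> (\<Union>zs\<in>{zs \<in> ZS. list_all2 C us zs}. E zs)" by blast
  next
    fix \<omega> zs assume zs: "zs \<in> ZS" "list_all2 C us zs" "\<omega> \<in> E zs"
    then show "\<omega> \<in> Start" by (simp add: E_def Start_def)
    show "\<omega> \<in> space M" using zs by (simp add: E_def)
    fix u assume "u \<in> set us"
    then show "C u (Z u \<omega>)" using zs(2) E_val[OF zs(3)] by (auto simp: list_all2_conv_all_nth in_set_conv_nth)
  qed
  then have "measure M (Start \<inter> {\<omega> \<in> space M. \<forall>u\<in>set us. C u (Z u \<omega>)})
      = (\<Sum>zs\<in>{zs \<in> ZS. list_all2 C us zs}. measure M (E zs))"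
  proof (simp only:, intro finite_measure_finite_Union)
    show "finite {zs \<in> ZS. list_all2 C us zs}" using fin by simp
    show "E ` {zs \<in> ZS. list_all2 C us zs} \<subseteq> sets M" using E_sets by (auto simp: ZS_def)
    show "disjoint_family_on E {zs \<in> ZS. list_all2 C us zs}"
      unfolding disjoint_family_on_def
    proof (intro ballI impI equals0I)
      fix zs zs' \<omega> assume "zs \<noteq> zs'" "\<omega> \<in> E zs \<inter> E zs'"
      then show False using E_val[of \<omega> zs] E_val[of \<omega> zs'] by simp
    qed
  qed
  also have "\<dots> = (\<Sum>zs\<in>ZS. of_bool (list_all2 C us zs) * measure M (E zs))"
    using fin by (intro sum.mono_neutral_cong_left) auto
  also have "\<dots> = measure M Start * chain_weight C 0 (0, i) us"
    unfolding chain_weight_eq_path_weight sum_distrib_left ZS_def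
    by (intro sum.cong refl) (auto simp: E_prob)
  finally show ?thesis using Start_pos by (simp add: measure_P0[OF meas])
qed

text \<open>In \<open>ctmc\<close> the time \<open>0\<close> enters through the initial state and
  not through the list. Almost surely under \<open>P0\<close> this state is \<open>(0, i)\<close>;
  on the side of the weights the transition over time zero is the identity.\<close>

lemma prob_path_0:
  assumes us: "sorted_wrt (<) us" "\<And>u. u \<in> set us \<Longrightarrow> 0 \<le> u"
  shows "measure P0 {\<omega> \<in> space M. \<forall>u\<in>set us. C u (Z u \<omega>)} = chain_weight C 0 (0, i) us"
proof (cases "0 \<in> set us")
  case False
  then show ?thesis using us by (intro prob_path) (auto simp: less_le)
next
  case True
  then obtain v vs where v: "us = v # vs" by (cases us) auto
  have "v = 0" using us(1) us(2)[of v] True by (auto simp: v)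
  then have vs: "us = 0 # vs" by (simp add: v)
  have vs': "sorted_wrt (<) vs" "\<And>v. v \<in> set vs \<Longrightarrow> 0 < v" using us vs by auto
  have meas: "{\<omega> \<in> space M. \<forall>u\<in>set ws. C u (Z u \<omega>)} \<in> sets P0" if "set ws \<subseteq> set us" for ws
    using us(2) that by (auto intro!: sets.sets_Collect_finite_All sets_Z)
  have "measure P0 {\<omega> \<in> space M. \<forall>u\<in>set us. C u (Z u \<omega>)}
      = measure P0 (if C 0 (0, i) then {\<omega> \<in> space M. \<forall>u\<in>set vs. C u (Z u \<omega>)} else {})"
  proof (rule P0.finite_measure_eq_AE[OF eventually_mono[OF AE_Start]])
    fix \<omega> assume "\<omega> \<in> Start"
    then show "\<omega> \<in> {\<omega> \<in> space M. \<forall>u\<in>set us. C u (Z u \<omega>)}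
      \<longleftrightarrow> \<omega> \<in> (if C 0 (0, i) then {\<omega> \<in> space M. \<forall>u\<in>set vs. C u (Z u \<omega>)} else {})"
      by (auto simp: vs Start_def)
  qed (use meas[of us] meas[of vs] in \<open>auto simp: vs\<close>)
  also have "\<dots> = chain_weight C 0 (0, i) us"
    using prob_path[OF vs', of C] mat_exp_0_action[of states "(0, i)" "lifted_gen n G q"] by (simp add: vs)
  finally show ?thesis .
qed

text \<open>Finiteness of the state space makes a cylinder a finite union of path events. The
  measure \<open>N\<close> is arbitrary because the lemma serves both for \<open>M\<close> and for
  the sigma-algebra generated by \<open>Y\<close>.\<close>

lemma sets_cyl_general:
  assumes us: "\<And>u e. u \<in> set us \<Longrightarrow> {\<omega> \<in> space M. snd (Z u \<omega>) = e} \<in> sets N" and N: "space N = space M"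
  shows "cyl M Z us B \<in> sets N"
proof -
  have fin: "finite {ys. ys \<in> B \<and> length ys = length us}" by (rule finite_path_law)
  have "cyl M Z us B = (\<Union>ys\<in>{ys. ys \<in> B \<and> length ys = length us}.
      {\<omega> \<in> space M. \<forall>j\<in>{..<length us}. snd (Z (us ! j) \<omega>) = ys ! j})"
  proof (intro equalityI subsetI)
    fix \<omega> assume "\<omega> \<in> cyl M Z us B"
    then show "\<omega> \<in> (\<Union>ys\<in>{ys. ys \<in> B \<and> length ys = length us}.
        {\<omega> \<in> space M. \<forall>j\<in>{..<length us}. snd (Z (us ! j) \<omega>) = ys ! j})"
      by (intro UN_I[of "map (\<lambda>u. snd (Z u \<omega>)) us"]) (auto simp: cyl_def)
  next
    fix \<omega> assume "\<omega> \<in> (\<Union>ys\<in>{ys. ys \<in> B \<and> length ys = length us}.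
        {\<omega> \<in> space M. \<forall>j\<in>{..<length us}. snd (Z (us ! j) \<omega>) = ys ! j})"
    then obtain ys where ys: "ys \<in> B" "length ys = length us" "\<omega> \<in> space M"
      "\<forall>j\<in>{..<length us}. snd (Z (us ! j) \<omega>) = ys ! j" by auto
    then have "map (\<lambda>u. snd (Z u \<omega>)) us = ys" by (intro nth_equalityI) auto
    then show "\<omega> \<in> cyl M Z us B" using ys by (simp add: cyl_def)
  qed
  also have "\<dots> \<in> sets N"
    using us unfolding N[symmetric] by (intro sets.finite_UN fin sets.sets_Collect_finite_All) (auto simp: N)
  finally show ?thesis .
qed

lemma sets_cyl: "(\<And>u. u \<in> set us \<Longrightarrow> 0 \<le> u) \<Longrightarrow> cyl M Z us B \<in> sets M"
  by (intro sets_cyl_general sets_Z) auto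

text \<open>Both kinds of conditions are merged into one constraint on the chain at the union of the
  times. Inside the mixture the conditions on \<open>N\<close> become an indicator in
  \<open>s\<close>, and the times outside \<open>us\<close> drop out.\<close>

lemma joint_law_single:
  assumes us: "sorted_wrt (<) us" "\<And>u. u \<in> set us \<Longrightarrow> 0 \<le> u"
    and T: "finite T" "\<And>u. u \<in> T \<Longrightarrow> 0 \<le> u" and ys: "length ys = length us"
  shows "ennreal (measure P0 (cyl M Z us {ys} \<inter> {\<omega> \<in> space M. \<forall>u\<in>T. \<alpha> u (fst (Z u \<omega>))}))
    = (\<integral>\<^sup>+ s. indicator {s. \<forall>u\<in>T. \<alpha> u (phase s u)} s * ennreal (path_prob s 0 i us ys) \<partial>switch_law)"
proof -
  \<comment> \<open>Conditions on the path must be indexed by time once the two sets of times are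
    merged; as \<open>us\<close> is distinct, looking up the value of a time is unambiguous.\<close>
  define f where "f u = the (map_of (zip us ys) u)" for u
  have dist: "distinct us" using us(1) by (simp add: strict_sorted_iff)
  have map_f: "map f us = ys"
    using ys dist by (auto simp: f_def list_eq_iff_nth_eq map_of_zip_nth)
  define vs where "vs = sorted_list_of_set (set us \<union> T)"
  have vs: "sorted_wrt (<) vs" "sorted vs" "set vs = set us \<union> T"
    using T by (auto simp: vs_def)
  have vs0: "0 \<le> u" if "u \<in> set vs" for u using that us(2) T(2) vs(3) by auto
  have filter_vs: "filter (\<lambda>u. u \<in> set us) vs = us"
    using us(1) vs by (intro sorted_distinct_set_unique) (auto simp: strict_sorted_iff sorted_filter[of id, simplified])
  define C :: "real \<Rightarrow> nat \<times> 'e \<Rightarrow> bool"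
    where "C = (\<lambda>u z. (u \<in> T \<longrightarrow> \<alpha> u (fst z)) \<and> (u \<in> set us \<longrightarrow> snd z = f u))"
  have "cyl M Z us {ys} \<inter> {\<omega> \<in> space M. \<forall>u\<in>T. \<alpha> u (fst (Z u \<omega>))} = {\<omega> \<in> space M. \<forall>u\<in>set vs. C u (Z u \<omega>)}"
    unfolding cyl_def C_def vs map_f[symmetric] by auto
  then have "ennreal (measure P0 (cyl M Z us {ys} \<inter> {\<omega> \<in> space M. \<forall>u\<in>T. \<alpha> u (fst (Z u \<omega>))}))
      = ennreal (chain_weight C 0 (0, i) vs)"
    by (simp only: prob_path_0[OF vs(1) vs0])
  also have "\<dots> = (\<integral>\<^sup>+ s. ennreal (det_weight C s 0 i vs) \<partial>switch_law)"
    by (rule chain_weight_eq_mixture[OF vs(2) vs0])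
  also have "\<dots> = (\<integral>\<^sup>+ s. indicator {s. \<forall>u\<in>T. \<alpha> u (phase s u)} s * ennreal (path_prob s 0 i us ys) \<partial>switch_law)"
  proof (intro nn_integral_cong_AE eventually_mono[OF AE_switch_law])
    fix s assume s: "s \<in> open_simplex n"
    have "det_weight C s 0 i vs = of_bool (\<forall>u\<in>set vs. u \<in> T \<longrightarrow> \<alpha> u (phase s u))
        * det_weight (\<lambda>u z. u \<in> set us \<longrightarrow> snd z = f u) s 0 i vs"
      unfolding C_def by (rule det_weight_phase_constraint)
    also have "det_weight (\<lambda>u z. u \<in> set us \<longrightarrow> snd z = f u) s 0 i vs
        = det_weight (\<lambda>u z. u \<in> set us \<longrightarrow> snd z = f u) s 0 i us"
      using det_weight_filter[OF s, of "\<lambda>u. u \<in> set us" "\<lambda>u y. u \<in> set us \<longrightarrow> y = f u" vs 0 i] vs(2) vs0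
      by (simp add: filter_vs)
    also have "\<dots> = path_prob s 0 i us ys"
      by (simp add: det_weight_eq_path_prob map_f)
    finally show "ennreal (det_weight C s 0 i vs)
        = indicator {s. \<forall>u\<in>T. \<alpha> u (phase s u)} s * ennreal (path_prob s 0 i us ys)"
      using vs by (auto split: split_indicator)
  qed
  finally show ?thesis .
qed

lemma borel_measurable_path_prob: "(\<lambda>s. path_prob s t x us ys) \<in> borel_measurable (PiR n)"
proof (induction us arbitrary: t x ys)
  case (Cons u us)
  have [measurable]: "(\<lambda>s. det_trans n s t u x y) \<in> borel_measurable (PiR n)" for y
    by (rule borel_measurable_det_trans) auto
  note [measurable] = Cons
  show ?case by (cases ys) auto
qed simp

lemma borel_measurable_path_law [measurable]: "(\<lambda>s. path_law x s us B) \<in> borel_measurable (PiR n)"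
  unfolding path_law_def by (intro borel_measurable_sum borel_measurable_path_prob)

lemma sets_phase_constraint:
  assumes "finite T"
  shows "{s \<in> space (PiR n). \<forall>u\<in>T. \<alpha> u (phase s u)} \<in> sets (PiR n)"
proof (intro sets.sets_Collect_finite_All assms)
  fix u show "{s \<in> space (PiR n). \<alpha> u (phase s u)} \<in> sets (PiR n)"
    using measurable_sets[OF measurable_phase, of "{p. \<alpha> u p}" u] by (simp add: vimage_def Int_def conj_commute)
qed

lemma joint_law:
  assumes us: "sorted_wrt (<) us" "\<And>u. u \<in> set us \<Longrightarrow> 0 \<le> u"
    and T: "finite T" "\<And>u. u \<in> T \<Longrightarrow> 0 \<le> u"
  shows "ennreal (measure P0 (cyl M Z us B \<inter> {\<omega> \<in> space M. \<forall>u\<in>T. \<alpha> u (fst (Z u \<omega>))}))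
    = (\<integral>\<^sup>+ s. indicator {s. \<forall>u\<in>T. \<alpha> u (phase s u)} s * ennreal (path_law i s us B) \<partial>switch_law)"
proof -
  let ?W = "{\<omega> \<in> space M. \<forall>u\<in>T. \<alpha> u (fst (Z u \<omega>))}" and ?A = "{s. \<forall>u\<in>T. \<alpha> u (phase s u)}"
  let ?Y = "{ys. ys \<in> B \<and> length ys = length us}"
  have W: "?W \<in> sets M" using T by (intro sets.sets_Collect_finite_All sets_Z) auto
  have "?A \<inter> space (PiR n) = {s \<in> space (PiR n). \<forall>u\<in>T. \<alpha> u (phase s u)}" by auto
  then have ind: "(indicator ?A :: _ \<Rightarrow> ennreal) \<in> borel_measurable (PiR n)"
    using sets_phase_constraint[OF T(1), of \<alpha>] by (simp add: borel_measurable_indicator_iff)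
  have "cyl M Z us B \<inter> ?W = (\<Union>ys\<in>?Y. cyl M Z us {ys} \<inter> ?W)" by (auto simp: cyl_def)
  then have "measure P0 (cyl M Z us B \<inter> ?W) = (\<Sum>ys\<in>?Y. measure P0 (cyl M Z us {ys} \<inter> ?W))"
  proof (simp only:, intro P0.finite_measure_finite_Union)
    show "disjoint_family_on (\<lambda>ys. cyl M Z us {ys} \<inter> ?W) ?Y"
      by (auto simp: disjoint_family_on_def cyl_def)
  qed (use W sets_cyl[OF us(2)] finite_path_law in auto)
  then have "ennreal (measure P0 (cyl M Z us B \<inter> ?W)) = (\<Sum>ys\<in>?Y. ennreal (measure P0 (cyl M Z us {ys} \<inter> ?W)))"
    by simp
  also have "\<dots> = (\<Sum>ys\<in>?Y. \<integral>\<^sup>+ s. indicator ?A s * ennreal (path_prob s 0 i us ys) \<partial>switch_law)"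
    using us T by (intro sum.cong refl joint_law_single) auto
  also have "\<dots> = (\<integral>\<^sup>+ s. (\<Sum>ys\<in>?Y. indicator ?A s * ennreal (path_prob s 0 i us ys)) \<partial>switch_law)"
  proof (intro nn_integral_sum[symmetric])
    fix ys
    note [measurable] = borel_measurable_path_prob
    have "(\<lambda>s. ennreal (path_prob s 0 i us ys)) \<in> borel_measurable (PiR n)" by measurable
    from borel_measurable_times_ennreal[OF ind this]
    show "(\<lambda>s. indicator ?A s * ennreal (path_prob s 0 i us ys)) \<in> borel_measurable switch_law"
      by (simp only: measurable_cong_sets[OF sets_switch_law refl])
  qed
  also have "\<dots> = (\<integral>\<^sup>+ s. indicator ?A s * ennreal (path_law i s us B) \<partial>switch_law)"
  proof (intro nn_integral_cong_AE eventually_mono[OF AE_switch_law])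
    fix s assume s: "s \<in> open_simplex n"
    have "(\<Sum>ys\<in>?Y. ennreal (path_prob s 0 i us ys)) = ennreal (path_law i s us B)"
      unfolding path_law_def using us by (intro sum_ennreal path_prob_nonneg[OF s]) (auto simp: strict_sorted_iff)
    then show "(\<Sum>ys\<in>?Y. indicator ?A s * ennreal (path_prob s 0 i us ys)) = indicator ?A s * ennreal (path_law i s us B)"
      by (simp add: sum_distrib_left[symmetric])
  qed
  finally show ?thesis .
qed

end

section \<open>Hitting windows\<close>

context switching_chain
begin

section \<open>Monotonicity of the phase and measurability of the hitting times\<close>

lemma phase_mono: "a \<le> b \<Longrightarrow> phase s a \<le> phase s b"
  unfolding phase_def by (intro card_mono) auto

text \<open>In \<open>joint_law\<close> a decrease of \<open>N\<close> from \<open>a\<close> to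
  \<open>b\<close> corresponds to an empty set of switching times, because \<open>phase s\<close> is
  monotone for every \<open>s\<close>.\<close>

lemma AE_phase_le:
  assumes "0 \<le> a" "a < b"
  shows "AE \<omega> in P0. fst (Z a \<omega>) \<le> fst (Z b \<omega>)"
proof -
  have "AE \<omega> in P0. \<not> (fst (Z a \<omega>) = k \<and> fst (Z b \<omega>) < k)" for k
  proof -
    let ?\<alpha> = "\<lambda>u p. (u = a \<longrightarrow> p = k) \<and> (u = b \<longrightarrow> p < k)"
    let ?N = "{\<omega> \<in> space M. \<forall>u\<in>{a, b}. ?\<alpha> u (fst (Z u \<omega>))}"
    have "ennreal (measure P0 (cyl M Z [] UNIV \<inter> ?N))
        = (\<integral>\<^sup>+ s. indicator {s. \<forall>u\<in>{a, b}. ?\<alpha> u (phase s u)} s * ennreal (path_law i s [] UNIV) \<partial>switch_law)"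
      using assms by (intro joint_law) auto
    also have "{s. \<forall>u\<in>{a, b}. ?\<alpha> u (phase s u)} = {}"
      using phase_mono[of a b] assms by (auto simp: not_less[symmetric])
    finally have "measure P0 (cyl M Z [] UNIV \<inter> ?N) = 0" by simp
    moreover have "cyl M Z [] UNIV \<inter> ?N = ?N" by (auto simp: cyl_def)
    moreover have "?N \<in> sets P0"
      unfolding sets_P0 using assms by (intro sets.sets_Collect_finite_All sets_Z) auto
    ultimately have "?N \<in> null_sets P0" by (auto simp: P0.emeasure_eq_measure null_sets_def)
    from AE_not_in[OF this] AE_space show ?thesis
      by eventually_elim (use assms in auto)
  qed
  then have "AE \<omega> in P0. \<forall>k. \<not> (fst (Z a \<omega>) = k \<and> fst (Z b \<omega>) < k)"
    by (subst AE_all_countable) (rule allI)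
  then show ?thesis by eventually_elim (metis not_less)
qed

definition monotone_phase :: "'w \<Rightarrow> bool" where
  "monotone_phase \<omega> \<longleftrightarrow> (\<forall>a b. 0 \<le> a \<longrightarrow> a \<le> b \<longrightarrow> fst (Z a \<omega>) \<le> fst (Z b \<omega>))"

text \<open>Countably many rational pairs suffice: the states at \<open>a < b\<close> are seen again
  at rational times shortly after \<open>a\<close> and \<open>b\<close>, and choosing
  \<open>a' < b < b'\<close> keeps these in order.\<close>

lemma AE_monotone_phase: "AE \<omega> in P0. monotone_phase \<omega>"
proof -
  define X :: "(real \<times> real) set" where "X = {(a, b). a \<in> \<rat> \<and> b \<in> \<rat> \<and> 0 \<le> a \<and> a < b}"
  have "countable X"
    by (rule countable_subset[of _ "\<rat> \<times> \<rat>"]) (auto simp: X_def countable_rat)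
  then have "AE \<omega> in P0. \<forall>p\<in>X. fst (Z (fst p) \<omega>) \<le> fst (Z (snd p) \<omega>)"
    by (subst AE_ball_countable) (auto simp: X_def intro!: AE_phase_le)
  with AE_space show ?thesis
  proof eventually_elim
    fix \<omega> assume "\<omega> \<in> space P0" and X: "\<forall>p\<in>X. fst (Z (fst p) \<omega>) \<le> fst (Z (snd p) \<omega>)"
    then have \<omega>: "\<omega> \<in> space M" by simp
    show "monotone_phase \<omega>"
      unfolding monotone_phase_def
    proof (intro allI impI)
      fix a b :: real assume ab: "0 \<le> a" "a \<le> b"
      show "fst (Z a \<omega>) \<le> fst (Z b \<omega>)"
      proof (cases "a = b")
        case False
        obtain \<epsilon> where \<epsilon>: "0 < \<epsilon>" "\<And>s. a \<le> s \<Longrightarrow> s < a + \<epsilon> \<Longrightarrow> Z s \<omega> = Z a \<omega>"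
          using Z_right_const[OF \<omega> ab(1)] by blast
        obtain \<epsilon>' where \<epsilon>': "0 < \<epsilon>'" "\<And>s. b \<le> s \<Longrightarrow> s < b + \<epsilon>' \<Longrightarrow> Z s \<omega> = Z b \<omega>"
          using Z_right_const[OF \<omega>, of b] ab by auto
        obtain a' where a': "a' \<in> \<rat>" "a < a'" "a' < min (a + \<epsilon>) b"
          using Rats_dense_in_real[of a "min (a + \<epsilon>) b"] \<epsilon> ab False by auto
        obtain b' where b': "b' \<in> \<rat>" "b < b'" "b' < b + \<epsilon>'"
          using Rats_dense_in_real[of b "b + \<epsilon>'"] \<epsilon>' by auto
        have "(a', b') \<in> X" using a' b' ab by (simp add: X_def)
        then have "fst (Z a' \<omega>) \<le> fst (Z b' \<omega>)" using X by force
        then show ?thesis using \<epsilon>(2)[of a'] \<epsilon>'(2)[of b'] a' b' by simp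
      qed simp
    qed
  qed
qed

text \<open>By right-constancy a visit to phase \<open>k\<close> before \<open>y\<close> is also
  seen at a rational time before \<open>y\<close>.\<close>

lemma borel_measurable_hit_time [measurable]: "hit_time Z k \<in> borel_measurable M"
proof (rule borel_measurableI_less)
  fix y :: ereal
  have "{\<omega> \<in> space M. hit_time Z k \<omega> < y}
      = (\<Union>r\<in>{r \<in> \<rat>. 0 \<le> r \<and> ereal r < y}. {\<omega> \<in> space M. fst (Z r \<omega>) = k})"
  proof (intro equalityI subsetI)
    fix \<omega> assume "\<omega> \<in> {\<omega> \<in> space M. hit_time Z k \<omega> < y}"
    then obtain t where \<omega>: "\<omega> \<in> space M" and t: "0 \<le> t" "fst (Z t \<omega>) = k" "ereal t < y"
      by (auto simp: hit_time_def Inf_less_iff)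
    obtain \<epsilon> where \<epsilon>: "0 < \<epsilon>" "\<And>s. t \<le> s \<Longrightarrow> s < t + \<epsilon> \<Longrightarrow> Z s \<omega> = Z t \<omega>"
      using Z_right_const[OF \<omega> t(1)] by blast
    obtain z where z: "ereal t < ereal z" "ereal z < y" using ereal_dense2[OF t(3)] by blast
    obtain r where r: "r \<in> \<rat>" "t < r" "r < min z (t + \<epsilon>)"
      using Rats_dense_in_real[of t "min z (t + \<epsilon>)"] z \<epsilon> by auto
    have "ereal r < y" using r z by (meson ereal_less_eq(3) less_imp_le min_less_iff_conj order_le_less_trans)
    then show "\<omega> \<in> (\<Union>r\<in>{r \<in> \<rat>. 0 \<le> r \<and> ereal r < y}. {\<omega> \<in> space M. fst (Z r \<omega>) = k})"
      using r t \<omega> \<epsilon>(2)[of r] by (intro UN_I[of r]) auto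
  next
    fix \<omega> assume "\<omega> \<in> (\<Union>r\<in>{r \<in> \<rat>. 0 \<le> r \<and> ereal r < y}. {\<omega> \<in> space M. fst (Z r \<omega>) = k})"
    then show "\<omega> \<in> {\<omega> \<in> space M. hit_time Z k \<omega> < y}"
      by (auto simp: hit_time_def Inf_less_iff)
  qed
  also have "\<dots> \<in> sets M"
    by (intro sets.countable_UN' sets_Z countable_subset[OF _ countable_rat]) (auto intro!: sets_Z)
  finally show "{\<omega> \<in> space M. hit_time Z k \<omega> < y} \<in> sets M" .
qed

lemma sets_hit_window: "hit_window M Z n s \<Delta> \<in> sets M"
  unfolding hit_window_def by measurable

section \<open>Windows as boxes of switching times\<close>

definition separated :: "(nat \<Rightarrow> real) \<Rightarrow> (nat \<Rightarrow> real) \<Rightarrow> bool" where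
  "separated s \<Delta> \<longleftrightarrow> (\<forall>k\<in>{1..n}. 0 < \<Delta> k) \<and> (\<forall>k\<in>{1..<n}. s k + \<Delta> k < s (Suc k))"

lemma simplex_pos: "s \<in> open_simplex n \<Longrightarrow> k \<in> {1..n} \<Longrightarrow> 0 < s k"
  using switch_less[of s n 0 k] by (auto simp: switch_def split: if_splits)

text \<open>Hitting \<open>k\<close> in its window forces \<open>N \<le> k - 1\<close> at the left
  end and \<open>N \<ge> k\<close> at the right end. The reverse inequalities come from the
  neighbouring windows, which is where separation enters, and from \<open>0 \<le> N \<le> n\<close>
  for the first and the last one. In the other direction, right-constancy at \<open>s k\<close>
  makes the infimum strictly larger than \<open>s k\<close>.\<close>

lemma hit_window_iff:
  assumes s: "s \<in> open_simplex n" and \<Delta>: "separated s \<Delta>" and \<omega>: "\<omega> \<in> space M" and mono: "monotone_phase \<omega>"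
  shows "\<omega> \<in> hit_window M Z n s \<Delta>
    \<longleftrightarrow> (\<forall>k\<in>{1..n}. fst (Z (s k) \<omega>) = k - 1 \<and> fst (Z (s k + \<Delta> k) \<omega>) = k)"
proof -
  let ?N = "\<lambda>t. fst (Z t \<omega>)"
  have N_mono: "?N a \<le> ?N b" if "0 \<le> a" "a \<le> b" for a b
    using mono that by (simp add: monotone_phase_def)
  have pos: "0 < s k" "0 < \<Delta> k" if "k \<in> {1..n}" for k
    using simplex_pos[OF s that] \<Delta> that by (auto simp: separated_def)
  have sep: "s k + \<Delta> k < s (Suc k)" if "k \<in> {1..<n}" for k using \<Delta> that by (simp add: separated_def)
  show ?thesis
  proof
    assume N: "\<forall>k\<in>{1..n}. ?N (s k) = k - 1 \<and> ?N (s k + \<Delta> k) = k"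
    have "ereal (s k) < hit_time Z k \<omega> \<and> hit_time Z k \<omega> \<le> ereal (s k + \<Delta> k)" if k: "k \<in> {1..n}" for k
    proof
      have "0 \<le> s k" using pos[OF k] by simp
      then obtain \<epsilon> where \<epsilon>: "0 < \<epsilon>" "\<And>t. s k \<le> t \<Longrightarrow> t < s k + \<epsilon> \<Longrightarrow> Z t \<omega> = Z (s k) \<omega>"
        using Z_right_const[OF \<omega>] by blast
      have "s k + \<epsilon> \<le> t" if t: "0 \<le> t" "?N t = k" for t
      proof (rule ccontr)
        assume "\<not> s k + \<epsilon> \<le> t"
        then have "?N t \<le> ?N (s k)" using \<epsilon>(2)[of t] N_mono[of t "s k"] t by (cases "s k \<le> t") auto
        then show False using N k t by auto
      qed
      then have "ereal (s k + \<epsilon>) \<le> hit_time Z k \<omega>"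
        unfolding hit_time_def by (intro Inf_greatest) auto
      then show "ereal (s k) < hit_time Z k \<omega>" using \<epsilon>(1)
        by (meson ereal_less_eq(3) less_add_same_cancel1 less_ereal.simps(1) order_less_le_trans)
      show "hit_time Z k \<omega> \<le> ereal (s k + \<Delta> k)"
        unfolding hit_time_def using N k pos[OF k] by (intro Inf_lower) auto
    qed
    then show "\<omega> \<in> hit_window M Z n s \<Delta>" using \<omega> by (simp add: hit_window_def)
  next
    assume "\<omega> \<in> hit_window M Z n s \<Delta>"
    then have W: "ereal (s k) < hit_time Z k \<omega>" "hit_time Z k \<omega> \<le> ereal (s k + \<Delta> k)" if "k \<in> {1..n}" for k
      using that by (auto simp: hit_window_def)
    have le: "?N (s k) \<le> k - 1" and ge: "k \<le> ?N (s k + \<Delta> k)" if k: "k \<in> {1..n}" for k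
    proof -
      obtain h where h: "hit_time Z k \<omega> = ereal h" "s k < h" "h \<le> s k + \<Delta> k"
        using W[OF k] by (cases "hit_time Z k \<omega>") auto
      have h0: "0 \<le> h" using pos[OF k] h by simp
      obtain \<epsilon> where \<epsilon>: "0 < \<epsilon>" "\<And>t. h \<le> t \<Longrightarrow> t < h + \<epsilon> \<Longrightarrow> Z t \<omega> = Z h \<omega>"
        using Z_right_const[OF \<omega> h0] by blast
      \<comment> \<open>The infimum \<open>h\<close> is attained: some visit to \<open>k\<close>
        lies in \<open>[h, h + \<epsilon>)\<close>, where the state is that at
        \<open>h\<close>.\<close>
      have "hit_time Z k \<omega> < ereal (h + \<epsilon>)" using h \<epsilon> by simp
      then obtain t where t: "0 \<le> t" "?N t = k" "t < h + \<epsilon>"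
        by (auto simp: hit_time_def Inf_less_iff)
      have hit_le: "hit_time Z k \<omega> \<le> ereal t" if "0 \<le> t" "?N t = k" for t
        unfolding hit_time_def using that by (intro Inf_lower) auto
      have "h \<le> t" using hit_le[OF t(1,2)] h by simp
      then have Nh: "?N h = k" using \<epsilon>(2)[of t] t by simp
      have "?N (s k) \<noteq> k"
      proof
        assume "?N (s k) = k"
        then show False using hit_le[of "s k"] pos[OF k] W(1)[OF k] by simp
      qed
      moreover have "?N (s k) \<le> k" using N_mono[of "s k" h] Nh h pos[OF k] by simp
      ultimately show "?N (s k) \<le> k - 1" by simp
      show "k \<le> ?N (s k + \<Delta> k)" using N_mono[of h "s k + \<Delta> k"] Nh h h0 by simp
    qed
    show "\<forall>k\<in>{1..n}. ?N (s k) = k - 1 \<and> ?N (s k + \<Delta> k) = k"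
    proof (intro ballI conjI)
      fix k assume k: "k \<in> {1..n}"
      have "k - 1 \<le> ?N (s k)"
      proof (cases "k = 1")
        case False
        then have k': "k - 1 \<in> {1..n}" "k - 1 \<in> {1..<n}" "Suc (k - 1) = k" using k by auto
        then have "k - 1 \<le> ?N (s (k - 1) + \<Delta> (k - 1))" using ge by blast
        also have "\<dots> \<le> ?N (s k)" using sep[OF k'(2)] pos[OF k'(1)] k'(3) by (intro N_mono) auto
        finally show ?thesis .
      qed simp
      with le[OF k] show "?N (s k) = k - 1" by simp
      have "?N (s k + \<Delta> k) \<le> k"
      proof (cases "k = n")
        case True
        then show ?thesis using Z_state[OF \<omega>, of "s k + \<Delta> k"] pos[OF k] by simp
      next
        case False
        then have k': "Suc k \<in> {1..n}" "k \<in> {1..<n}" using k by auto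
        have "?N (s k + \<Delta> k) \<le> ?N (s (Suc k))" using sep[OF k'(2)] pos[OF k] by (intro N_mono) auto
        then show ?thesis using le[OF k'(1)] by simp
      qed
      with ge[OF k] show "?N (s k + \<Delta> k) = k" by simp
    qed
  qed
qed

definition window_box :: "(nat \<Rightarrow> real) \<Rightarrow> (nat \<Rightarrow> real) \<Rightarrow> (nat \<Rightarrow> real) set" where
  "window_box s \<Delta> = PiE {1..n} (\<lambda>k. {s k<..s k + \<Delta> k})"

lemma sets_window_box [measurable, simp]: "window_box s \<Delta> \<in> sets (PiR n)"
  unfolding window_box_def by (intro sets_PiM_I_finite) auto

lemma window_box_subset_simplex:
  assumes s: "s \<in> open_simplex n" and \<Delta>: "separated s \<Delta>"
  shows "window_box s \<Delta> \<subseteq> open_simplex n"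
proof
  fix s' assume s': "s' \<in> window_box s \<Delta>"
  then have b: "s k < s' k" "s' k \<le> s k + \<Delta> k" if "k \<in> {1..n}" for k
    using that by (auto simp: window_box_def PiE_iff)
  have "prev_s s' k < s' k" if k: "k \<in> {1..n}" for k
  proof (cases "k = 1")
    case True
    then show ?thesis using simplex_pos[OF s k] b[OF k] by (simp add: prev_s_def)
  next
    case False
    then have k': "k - 1 \<in> {1..n}" "k - 1 \<in> {1..<n}" "Suc (k - 1) = k" using k by auto
    have "s (k - 1) + \<Delta> (k - 1) < s k" using \<Delta> k'(2,3) unfolding separated_def by metis
    then show ?thesis using b(2)[OF k'(1)] b(1)[OF k] False k by (simp add: prev_s_def)
  qed
  moreover have "s' \<in> PiE {1..n} (\<lambda>_. UNIV)" using s' by (auto simp: window_box_def PiE_iff)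
  ultimately show "s' \<in> open_simplex n" by (simp add: open_simplex_def)
qed

text \<open>The counterpart of \<open>hit_window_iff\<close> for \<open>phase s'\<close>: the same
  conditions at the end points cut out a box of switching times.\<close>

lemma phase_window_iff:
  assumes s: "s \<in> open_simplex n" and \<Delta>: "separated s \<Delta>" and s': "s' \<in> open_simplex n"
  shows "(\<forall>k\<in>{1..n}. phase s' (s k) = k - 1 \<and> phase s' (s k + \<Delta> k) = k) \<longleftrightarrow> s' \<in> window_box s \<Delta>"
proof
  assume "s' \<in> window_box s \<Delta>"
  then have b: "s k < s' k" "s' k \<le> s k + \<Delta> k" if "k \<in> {1..n}" for k
    using that by (auto simp: window_box_def PiE_iff)
  have sep: "s k + \<Delta> k < s (Suc k)" if "k \<in> {1..<n}" for k using \<Delta> that by (simp add: separated_def)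
  show "\<forall>k\<in>{1..n}. phase s' (s k) = k - 1 \<and> phase s' (s k + \<Delta> k) = k"
  proof (intro ballI conjI)
    fix k assume k: "k \<in> {1..n}"
    show "phase s' (s k + \<Delta> k) = k"
    proof (rule phase_eq[OF s'])
      show "switch s' k \<le> s k + \<Delta> k" using b[OF k] k by (auto simp: switch_def)
      assume "k < n"
      then show "s k + \<Delta> k < s' (Suc k)" using sep[of k] b(1)[of "Suc k"] k by auto
    qed (use k in simp)
    show "phase s' (s k) = k - 1"
    proof (rule phase_eq[OF s'])
      show "switch s' (k - 1) \<le> s k"
      proof (cases "k = 1")
        case True then show ?thesis using simplex_pos[OF s k] by simp
      next
        case False
        then have k': "k - 1 \<in> {1..n}" "k - 1 \<in> {1..<n}" "Suc (k - 1) = k" using k by auto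
        then show ?thesis using b(2)[OF k'(1)] sep[OF k'(2)] by (simp add: switch_def)
      qed
      show "s k < s' (Suc (k - 1))" using b(1)[OF k] k by simp
    qed (use k in auto)
  qed
next
  assume P: "\<forall>k\<in>{1..n}. phase s' (s k) = k - 1 \<and> phase s' (s k + \<Delta> k) = k"
  have "s k < s' k \<and> s' k \<le> s k + \<Delta> k" if k: "k \<in> {1..n}" for k
  proof
    have le: "s' j \<le> s' k" if "j \<in> {1..n}" "j \<le> k" for j
      using switch_le[OF s', of j k] that k by (auto simp: switch_def split: if_splits)
    show "s k < s' k"
    proof (rule ccontr)
      assume "\<not> s k < s' k"
      then have "{1..k} \<subseteq> {j \<in> {1..n}. s' j \<le> s k}" using k le by force
      then have "card {1..k} \<le> phase s' (s k)" unfolding phase_def by (intro card_mono) auto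
      then show False using P k by auto
    qed
    show "s' k \<le> s k + \<Delta> k"
    proof (rule ccontr)
      assume nle: "\<not> s' k \<le> s k + \<Delta> k"
      have "{j \<in> {1..n}. s' j \<le> s k + \<Delta> k} \<subseteq> {1..k - 1}"
      proof
        fix j assume j: "j \<in> {j \<in> {1..n}. s' j \<le> s k + \<Delta> k}"
        have "\<not> k \<le> j"
        proof
          assume "k \<le> j"
          then have "s' k \<le> s' j" using switch_le[OF s', of k j] j k by (auto simp: switch_def split: if_splits)
          then show False using nle j by simp
        qed
        then show "j \<in> {1..k - 1}" using j by auto
      qed
      then have "phase s' (s k + \<Delta> k) \<le> card {1..k - 1}" unfolding phase_def by (intro card_mono) auto
      then show False using P k by auto
    qed
  qed
  then show "s' \<in> window_box s \<Delta>" using s' by (auto simp: window_box_def open_simplex_def PiE_iff)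
qed

text \<open>\<open>joint_law\<close> with \<open>N\<close> observed at both ends of every window:
  its left side is the window event up to a null set, and its indicator is that of the box for
  almost every vector of switching times.\<close>

lemma window_law:
  assumes s: "s \<in> open_simplex n" and \<Delta>: "separated s \<Delta>"
    and us: "sorted_wrt (<) us" "\<And>u. u \<in> set us \<Longrightarrow> 0 \<le> u"
  shows "ennreal (measure P0 (cyl M Z us B \<inter> hit_window M Z n s \<Delta>))
    = (\<integral>\<^sup>+ s'. indicator (window_box s \<Delta>) s' * ennreal (path_law i s' us B) \<partial>switch_law)"
proof -
  define T where "T = s ` {1..n} \<union> (\<lambda>k. s k + \<Delta> k) ` {1..n}"
  \<comment> \<open>\<open>joint_law\<close> attaches conditions to times and not to indices.
    Quantifying the implications over all \<open>k\<close> avoids choosing the index to which a time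
    belongs.\<close>
  define \<alpha> where "\<alpha> u p \<longleftrightarrow> (\<forall>k\<in>{1..n}. (u = s k \<longrightarrow> p = k - 1) \<and> (u = s k + \<Delta> k \<longrightarrow> p = k))" for u p
  have \<alpha>: "(\<forall>u\<in>T. \<alpha> u (f u)) \<longleftrightarrow> (\<forall>k\<in>{1..n}. f (s k) = k - 1 \<and> f (s k + \<Delta> k) = k)" for f
    unfolding T_def \<alpha>_def by auto
  have T: "finite T" "\<And>u. u \<in> T \<Longrightarrow> 0 \<le> u"
    using simplex_pos[OF s] \<Delta> by (auto simp: T_def separated_def intro!: add_pos_pos less_imp_le)
  let ?W = "{\<omega> \<in> space M. \<forall>u\<in>T. \<alpha> u (fst (Z u \<omega>))}"
  have W: "?W \<in> sets M" using T by (intro sets.sets_Collect_finite_All sets_Z) auto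
  have "measure P0 (cyl M Z us B \<inter> hit_window M Z n s \<Delta>) = measure P0 (cyl M Z us B \<inter> ?W)"
  proof (rule P0.finite_measure_eq_AE)
    show "AE \<omega> in P0. (\<omega> \<in> cyl M Z us B \<inter> hit_window M Z n s \<Delta>) = (\<omega> \<in> cyl M Z us B \<inter> ?W)"
      using AE_monotone_phase AE_space
    proof eventually_elim
      fix \<omega> assume \<omega>: "monotone_phase \<omega>" "\<omega> \<in> space P0"
      then show "(\<omega> \<in> cyl M Z us B \<inter> hit_window M Z n s \<Delta>) = (\<omega> \<in> cyl M Z us B \<inter> ?W)"
        using hit_window_iff[OF s \<Delta> _ \<omega>(1)] \<alpha>[of "\<lambda>u. fst (Z u \<omega>)"] by simp
    qed
  qed (use W sets_cyl[OF us(2)] sets_hit_window in auto)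
  then have "ennreal (measure P0 (cyl M Z us B \<inter> hit_window M Z n s \<Delta>))
      = (\<integral>\<^sup>+ s'. indicator {s. \<forall>u\<in>T. \<alpha> u (phase s u)} s' * ennreal (path_law i s' us B) \<partial>switch_law)"
    using joint_law[OF us T, of B \<alpha>] by simp
  also have "\<dots> = (\<integral>\<^sup>+ s'. indicator (window_box s \<Delta>) s' * ennreal (path_law i s' us B) \<partial>switch_law)"
  proof (intro nn_integral_cong_AE eventually_mono[OF AE_switch_law])
    fix s' assume s': "s' \<in> open_simplex n"
    show "indicator {s. \<forall>u\<in>T. \<alpha> u (phase s u)} s' * ennreal (path_law i s' us B)
      = indicator (window_box s \<Delta>) s' * ennreal (path_law i s' us B)"
      using phase_window_iff[OF s \<Delta> s'] \<alpha>[of "phase s'"] by (simp add: indicator_def)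
  qed
  finally show ?thesis .
qed

lemma path_law_Nil: "[] \<in> B \<Longrightarrow> path_law x s [] B = 1"
proof -
  assume "[] \<in> B"
  then have "{ys. ys \<in> B \<and> length ys = length []} = {[]}" by auto
  then show ?thesis by (simp add: path_law_def)
qed

lemma window_prob:
  assumes "s \<in> open_simplex n" "separated s \<Delta>"
  shows "ennreal (measure P0 (hit_window M Z n s \<Delta>)) = emeasure switch_law (window_box s \<Delta>)"
proof -
  have "cyl M Z [] UNIV \<inter> hit_window M Z n s \<Delta> = hit_window M Z n s \<Delta>"
    by (auto simp: cyl_def hit_window_def)
  then have "ennreal (measure P0 (hit_window M Z n s \<Delta>))
      = (\<integral>\<^sup>+ s'. indicator (window_box s \<Delta>) s' \<partial>switch_law)"
    using window_law[OF assms, of "[]" UNIV] by (simp add: path_law_Nil)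
  then show ?thesis by simp
qed

text \<open>The box lies in the simplex, where the density of \<open>switch_law\<close> is positive,
  and its volume is the product of the side lengths \<open>\<Delta> k\<close>.\<close>

lemma window_prob_pos:
  assumes s: "s \<in> open_simplex n" and \<Delta>: "separated s \<Delta>"
  shows "0 < measure P0 (hit_window M Z n s \<Delta>)"
proof -
  interpret product_sigma_finite "\<lambda>_. lborel :: real measure" ..
  have "emeasure switch_law (window_box s \<Delta>) \<noteq> 0"
  proof
    assume "emeasure switch_law (window_box s \<Delta>) = 0"
    moreover have "ennreal (switch_density 0 s') \<noteq> 0" for s'
      using switch_density_pos[of 0 s'] by (simp add: ennreal_eq_0_iff not_le)
    ultimately have "AE s' in PiR n. s' \<notin> window_box s \<Delta>"
      unfolding switch_law_def using window_box_subset_simplex[OF s \<Delta>]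
      by (auto simp: emeasure_density nn_integral_0_iff_AE indicator_def elim!: eventually_mono split: if_splits)
    then have "emeasure (PiR n) (window_box s \<Delta>) = 0"
      using sets.sets_into_space[OF sets_window_box, of s \<Delta>]
      by (subst (asm) AE_iff_measurable[OF sets_window_box]) auto
    moreover have "emeasure (PiR n) (window_box s \<Delta>) = (\<Prod>k\<in>{1..n}. ennreal (\<Delta> k))"
      unfolding window_box_def using \<Delta> by (subst emeasure_PiM) (auto simp: separated_def intro!: prod.cong)
    ultimately show False using \<Delta> by (auto simp: separated_def prod_zero_iff)
  qed
  then show ?thesis using window_prob[OF assms] by (simp add: zero_less_measure_iff) (metis ennreal_0 measure_nonneg order_less_le)
qed

text \<open>The quotient is the average of \<open>path_law i s' us B\<close> over \<open>s'\<close>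
  in the box with respect to \<open>switch_law\<close>. Each of these values is within the Lipschitz
  bound of the value at \<open>s\<close>, hence so is their average.\<close>

lemma window_estimate:
  assumes s: "s \<in> open_simplex n" and \<Delta>: "separated s \<Delta>" and \<delta>: "\<And>k. k \<in> {1..n} \<Longrightarrow> \<Delta> k \<le> \<delta>" "0 \<le> \<delta>"
    and us: "sorted_wrt (<) us" "\<And>u. u \<in> set us \<Longrightarrow> 0 \<le> u"
  shows "\<bar>measure P0 (cyl M Z us B \<inter> hit_window M Z n s \<Delta>) / measure P0 (hit_window M Z n s \<Delta>)
    - path_law i s us B\<bar> \<le> 2 * Suc n * gen_bound * \<delta>"
proof -
  define a where "a = 2 * Suc n * gen_bound * \<delta>"
  define w where "w = measure P0 (hit_window M Z n s \<Delta>)"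
  define m where "m = measure P0 (cyl M Z us B \<inter> hit_window M Z n s \<Delta>)"
  define r where "r = path_law i s us B"
  have a0: "0 \<le> a" using gen_bound_nonneg \<delta> by (simp add: a_def)
  have sus: "sorted us" using us by (simp add: strict_sorted_iff)
  have r0: "0 \<le> r" unfolding r_def by (rule path_law_nonneg[OF s sus us(2)])
  have w0: "0 < w" unfolding w_def by (rule window_prob_pos[OF s \<Delta>])
  have close: "\<bar>r - path_law i s' us B\<bar> \<le> a" "0 \<le> path_law i s' us B" if s': "s' \<in> window_box s \<Delta>" for s'
  proof -
    have "s' \<in> open_simplex n" using s' window_box_subset_simplex[OF s \<Delta>] by auto
    moreover have "\<bar>s k - s' k\<bar> \<le> \<delta>" if "k \<in> {1..n}" for k
    proof -
      have "s k < s' k \<and> s' k \<le> s k + \<Delta> k" using s' that by (auto simp: window_box_def PiE_iff)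
      then show ?thesis using \<delta>(1)[OF that] by auto
    qed
    ultimately show "\<bar>r - path_law i s' us B\<bar> \<le> a" "0 \<le> path_law i s' us B"
      unfolding r_def a_def using path_law_lipschitz[OF s _ _ \<delta>(2) sus us(2)] path_law_nonneg[OF _ sus us(2)] by auto
  qed
  have wl: "ennreal m = (\<integral>\<^sup>+ s'. indicator (window_box s \<Delta>) s' * ennreal (path_law i s' us B) \<partial>switch_law)"
    unfolding m_def by (rule window_law[OF s \<Delta> us])
  note wp = window_prob[OF s \<Delta>, folded w_def]
  have "ennreal m \<le> (\<integral>\<^sup>+ s'. ennreal (r + a) * indicator (window_box s \<Delta>) s' \<partial>switch_law)"
    unfolding wl
  proof (intro nn_integral_mono)
    fix s'
    show "indicator (window_box s \<Delta>) s' * ennreal (path_law i s' us B) \<le> ennreal (r + a) * indicator (window_box s \<Delta>) s'"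
      using close[of s'] by (auto simp: indicator_def intro!: ennreal_leI)
  qed
  also have "\<dots> = ennreal ((r + a) * w)"
    using wp w0 r0 a0 by (simp add: nn_integral_cmult_indicator ennreal_mult)
  finally have up: "m \<le> (r + a) * w" using r0 a0 w0 by (subst (asm) ennreal_le_iff) auto
  have [measurable]: "(\<lambda>s'. path_law i s' us B) \<in> borel_measurable switch_law"
    by (simp add: measurable_cong_sets[OF sets_switch_law refl])
  \<comment> \<open>For the lower estimate the error \<open>a\<close> is added on the larger side,
    since subtraction in \<open>ennreal\<close> is truncated.\<close>
  have "ennreal (r * w) = (\<integral>\<^sup>+ s'. ennreal r * indicator (window_box s \<Delta>) s' \<partial>switch_law)"
    using wp w0 r0 by (simp add: nn_integral_cmult_indicator ennreal_mult)
  also have "\<dots> \<le> (\<integral>\<^sup>+ s'. indicator (window_box s \<Delta>) s' * ennreal (path_law i s' us B) + ennreal a * indicator (window_box s \<Delta>) s' \<partial>switch_law)"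
  proof (intro nn_integral_mono)
    fix s'
    show "ennreal r * indicator (window_box s \<Delta>) s'
      \<le> indicator (window_box s \<Delta>) s' * ennreal (path_law i s' us B) + ennreal a * indicator (window_box s \<Delta>) s'"
      using close[of s'] a0 by (auto simp: indicator_def ennreal_plus[symmetric] simp del: ennreal_plus intro!: ennreal_leI)
  qed
  also have "\<dots> = ennreal m + ennreal a * ennreal w"
    unfolding wl wp by (subst nn_integral_add) (auto simp: nn_integral_cmult_indicator)
  also have "\<dots> = ennreal (m + a * w)"
    using a0 w0 by (simp add: m_def ennreal_mult)
  finally have low: "r * w \<le> m + a * w"
    using a0 w0 by (subst (asm) ennreal_le_iff) (auto simp: m_def)
  have "\<bar>m / w - r\<bar> \<le> a"
    using up low w0 by (simp add: abs_le_iff field_simps)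
  then show ?thesis unfolding m_def w_def r_def a_def .
qed

end

section \<open>The conditional measures\<close>

context switching_chain
begin

section \<open>The algebra of cylinders\<close>

definition valid_times :: "real list \<Rightarrow> bool" where
  "valid_times us \<longleftrightarrow> sorted_wrt (<) us \<and> (\<forall>u\<in>set us. 0 \<le> u)"

definition cylinders :: "'w set set" where
  "cylinders = {cyl M Z us B | us B. valid_times us}"

text \<open>The base is pulled back along the lookup of values by time. Two cylinders can thus be
  compared over the union of their times.\<close>

lemma cyl_extend:
  assumes "set us \<subseteq> set vs"
  obtains B' where "cyl M Z us B = cyl M Z vs B'"
proof
  have eq: "map (\<lambda>u. the (map_of (zip vs (map (\<lambda>u. snd (Z u \<omega>)) vs)) u)) us = map (\<lambda>u. snd (Z u \<omega>)) us" for \<omega>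
    using assms by (auto simp: map_of_zip_map)
  then show "cyl M Z us B = cyl M Z vs {xs. map (\<lambda>u. the (map_of (zip vs xs) u)) us \<in> B}"
    by (simp only: cyl_def mem_Collect_eq eq)
qed

lemma cylinders_common:
  assumes "A \<in> cylinders" "A' \<in> cylinders"
  obtains us B B' where "valid_times us" "A = cyl M Z us B" "A' = cyl M Z us B'"
proof -
  obtain vs D vs' D' where v: "valid_times vs" "A = cyl M Z vs D" "valid_times vs'" "A' = cyl M Z vs' D'"
    using assms by (auto simp: cylinders_def)
  define us where "us = sorted_list_of_set (set vs \<union> set vs')"
  have us: "valid_times us" "set us = set vs \<union> set vs'" using v by (auto simp: us_def valid_times_def)
  obtain B where "A = cyl M Z us B" using cyl_extend[of vs us D] us v by auto
  moreover obtain B' where "A' = cyl M Z us B'" using cyl_extend[of vs' us D'] us v by auto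
  ultimately show thesis using that us by blast
qed

lemma cylinders_subset_sets: "cylinders \<subseteq> sets M"
  by (auto simp: cylinders_def valid_times_def intro!: sets_cyl)

lemma cylinders_subset_Pow: "cylinders \<subseteq> Pow (space M)"
  using cylinders_subset_sets sets.sets_into_space by blast

lemma space_in_cylinders: "space M \<in> cylinders" "cyl M Z [] UNIV = space M"
  by (auto simp: cylinders_def cyl_def valid_times_def intro!: exI[of _ "[]"] exI[of _ UNIV])

lemma algebra_cylinders: "algebra (space M) cylinders"
  unfolding algebra_iff_Int
proof (intro conjI ballI)
  show "{} \<in> cylinders"
    by (auto simp: cylinders_def cyl_def valid_times_def intro!: exI[of _ "[]"] exI[of _ "{}"])
next
  fix A assume "A \<in> cylinders"
  then obtain us B where "valid_times us" "A = cyl M Z us B" by (auto simp: cylinders_def)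
  moreover have "space M - cyl M Z us B = cyl M Z us (- B)" by (auto simp: cyl_def)
  ultimately show "space M - A \<in> cylinders" by (auto simp: cylinders_def)
next
  fix A A' assume "A \<in> cylinders" "A' \<in> cylinders"
  then obtain us B B' where "valid_times us" "A = cyl M Z us B" "A' = cyl M Z us B'"
    by (rule cylinders_common)
  moreover have "cyl M Z us B \<inter> cyl M Z us B' = cyl M Z us (B \<inter> B')" by (auto simp: cyl_def)
  ultimately show "A \<inter> A' \<in> cylinders" by (auto simp: cylinders_def)
qed (rule cylinders_subset_Pow)

lemma FY_eq: "FY M Z = sigma_sets (space M) cylinders"
proof
  let ?gen = "{{\<omega> \<in> space M. snd (Z t \<omega>) = e} | t e. 0 \<le> t}"
  have "A \<in> cylinders" if gen: "A \<in> ?gen" for A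
  proof -
    obtain t e where "0 \<le> t" "A = {\<omega> \<in> space M. snd (Z t \<omega>) = e}" using gen by blast
    then have "A = cyl M Z [t] {[e]}" "valid_times [t]" by (auto simp: cyl_def valid_times_def)
    then show ?thesis by (auto simp: cylinders_def)
  qed
  then show "FY M Z \<subseteq> sigma_sets (space M) cylinders"
    unfolding FY_def by (intro sigma_sets_mono) auto
  let ?S = "sigma (space M) ?gen"
  have gen_sub: "?gen \<subseteq> Pow (space M)" by auto
  then have "sets ?S = FY M Z" "space ?S = space M" by (simp_all add: FY_def)
  moreover have "cyl M Z us B \<in> sets ?S" if "valid_times us" for us B
    using that gen_sub
    by (intro sets_cyl_general) (auto simp: valid_times_def intro!: sigma_sets.Basic)
  ultimately have "cylinders \<subseteq> sigma_sets (space M) ?gen"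
    by (auto simp: cylinders_def FY_def)
  then show "sigma_sets (space M) cylinders \<subseteq> FY M Z"
    unfolding FY_def by (rule sigma_sets_mono)
qed

lemma FY_subset_sets: "FY M Z \<subseteq> sets M"
  unfolding FY_eq using cylinders_subset_sets by (rule sets.sigma_sets_subset)

lemma exists_separation:
  assumes s: "s \<in> open_simplex n"
  obtains \<delta>0 where "0 < \<delta>0" "\<And>\<Delta>. (\<And>k. k \<in> {1..n} \<Longrightarrow> 0 < \<Delta> k \<and> \<Delta> k < \<delta>0) \<Longrightarrow> separated s \<Delta>"
proof
  \<comment> \<open>The element \<open>1\<close> keeps the set nonempty for
    \<open>n \<le> 1\<close>, when there are no gaps between consecutive switching times.\<close>
  let ?\<delta> = "Min (insert 1 ((\<lambda>k. s (Suc k) - s k) ` {1..<n}))"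
  have "s k < s (Suc k)" if "k \<in> {1..<n}" for k
    using switch_less[OF s, of k "Suc k"] that by (auto simp: switch_def split: if_splits)
  then show "0 < ?\<delta>" by (subst Min_gr_iff) auto
  fix \<Delta> assume \<Delta>: "\<And>k. k \<in> {1..n} \<Longrightarrow> 0 < \<Delta> k \<and> \<Delta> k < ?\<delta>"
  have "s k + \<Delta> k < s (Suc k)" if "k \<in> {1..<n}" for k
  proof -
    have "?\<delta> \<le> s (Suc k) - s k" using that by (intro Min_le) auto
    moreover have "k \<in> {1..n}" using that by auto
    then have "\<Delta> k < ?\<delta>" using \<Delta> by blast
    ultimately have "\<Delta> k < s (Suc k) - s k" by (rule order_less_le_trans[rotated])
    then show ?thesis by simp
  qed
  then show "separated s \<Delta>" using \<Delta> by (simp add: separated_def)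
qed

section \<open>Extension from cylinders to a probability measure\<close>

abbreviation window_cond :: "(nat \<Rightarrow> real) \<Rightarrow> (nat \<Rightarrow> real) \<Rightarrow> 'w set \<Rightarrow> real" where
  "window_cond s \<Delta> A \<equiv> measure P0 (A \<inter> hit_window M Z n s \<Delta>) / measure P0 (hit_window M Z n s \<Delta>)"

definition law_measure :: "(nat \<Rightarrow> real) \<Rightarrow> 'w measure \<Rightarrow> bool" where
  "law_measure s N \<longleftrightarrow> space N = space M \<and> sets N = FY M Z
     \<and> (\<forall>us B. valid_times us \<longrightarrow> emeasure N (cyl M Z us B) = ennreal (path_law i s us B))"

text \<open>Cylinder probabilities are uniformly close to probabilities conditioned on a fixed small window,
  and the latter are dominated by a multiple of the original measure; this yields continuity at the
  empty set on the arbitrary space \<open>M\<close>.\<close>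
lemma exists_law_measure:
  assumes s: "s \<in> open_simplex n"
  shows "\<exists>N. law_measure s N"
proof -
  obtain \<delta>0 where \<delta>0: "0 < \<delta>0"
    "\<And>\<Delta>. (\<And>k. k \<in> {1..n} \<Longrightarrow> 0 < \<Delta> k \<and> \<Delta> k < \<delta>0) \<Longrightarrow> separated s \<Delta>"
    using exists_separation[OF s] by metis
  \<comment> \<open>Dividing by \<open>m + 2\<close> keeps \<open>\<delta> m\<close> strictly below
    \<open>\<delta>0\<close> also for \<open>m = 0\<close>.\<close>
  define \<delta> where "\<delta> m = \<delta>0 / real (m + 2)" for m :: nat
  define D where "D m = (\<lambda>k::nat. \<delta> m)" for m
  have \<delta>: "0 < \<delta> m" "\<delta> m < \<delta>0" for m using \<delta>0(1) by (auto simp: \<delta>_def field_simps add_pos_nonneg)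
  have sep: "separated s (D m)" for m using \<delta> by (intro \<delta>0(2)) (auto simp: D_def)
  define w where "w m = measure P0 (hit_window M Z n s (D m))" for m
  have w0: "0 < w m" for m unfolding w_def by (rule window_prob_pos[OF s sep])
  define K where "K = 2 * Suc n * gen_bound"
  define Q where "Q m A = window_cond s (D m) A" for m A
  have \<delta>_lim: "(\<lambda>m. K * \<delta> m) \<longlonglongrightarrow> 0"
  proof -
    have "(\<lambda>m. K * (\<delta>0 * inverse (real (Suc (m + 1))))) \<longlonglongrightarrow> K * (\<delta>0 * 0)"
      by (intro tendsto_intros LIMSEQ_ignore_initial_segment[OF LIMSEQ_inverse_real_of_nat])
    then show ?thesis by (simp add: \<delta>_def field_simps)
  qed
  have est: "\<bar>Q m (cyl M Z us B) - path_law i s us B\<bar> \<le> K * \<delta> m" if "valid_times us" for m us B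
    unfolding Q_def K_def using that \<delta>[of m] less_imp_le[OF \<delta>(1)[of m]]
    by (intro window_estimate[OF s sep]) (auto simp: D_def valid_times_def)
  have lim_cyl: "(\<lambda>m. Q m (cyl M Z us B)) \<longlonglongrightarrow> path_law i s us B" if "valid_times us" for us B
  proof (rule LIM_zero_cancel)
    show "(\<lambda>m. Q m (cyl M Z us B) - path_law i s us B) \<longlonglongrightarrow> 0"
      using est[OF that] by (intro tendsto_rabs_zero_cancel[OF tendsto_sandwich[OF _ _ tendsto_const \<delta>_lim]]) auto
  qed
  \<comment> \<open>As a limit, \<open>F\<close> depends on the set and not on its representation as
    a cylinder, and additivity is inherited from the \<open>Q m\<close>.\<close>
  define F where "F A = lim (\<lambda>m. Q m A)" for A
  have F_cyl: "F (cyl M Z us B) = path_law i s us B" if "valid_times us" for us B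
    unfolding F_def using lim_cyl[OF that] by (rule limI)
  have F_lim: "(\<lambda>m. Q m A) \<longlonglongrightarrow> F A" "\<bar>Q m A - F A\<bar> \<le> K * \<delta> m" "0 \<le> F A" if A: "A \<in> cylinders" for A m
  proof -
    obtain us B where us: "valid_times us" "A = cyl M Z us B" using A by (auto simp: cylinders_def)
    show "(\<lambda>m. Q m A) \<longlonglongrightarrow> F A" "\<bar>Q m A - F A\<bar> \<le> K * \<delta> m"
      using lim_cyl[OF us(1), of B] est[OF us(1), of m B] us F_cyl[OF us(1), of B] by auto
    show "0 \<le> F A" using us path_law_nonneg[OF s, of us] by (auto simp: F_cyl valid_times_def strict_sorted_iff)
  qed
  interpret cyl: algebra "space M" cylinders by (rule algebra_cylinders)
  have "\<exists>\<mu>. (\<forall>A\<in>cylinders. \<mu> A = ennreal (F A)) \<and> measure_space (space M) (sigma_sets (space M) cylinders) \<mu>"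
  proof (rule cyl.caratheodory_empty_continuous)
    have "F {} = 0"
    proof -
      have "F (cyl M Z [] {}) = 0" by (subst F_cyl) (auto simp: valid_times_def path_law_def)
      then show ?thesis by (simp add: cyl_def)
    qed
    then show "positive cylinders (\<lambda>A. ennreal (F A))" by (simp add: positive_def)
    show "additive cylinders (\<lambda>A. ennreal (F A))"
      unfolding additive_def
    proof (intro ballI impI)
      fix A A' assume A: "A \<in> cylinders" "A' \<in> cylinders" "A \<inter> A' = {}"
      have "Q m (A \<union> A') = Q m A + Q m A'" for m
      proof -
        have "(A \<union> A') \<inter> hit_window M Z n s (D m) = (A \<inter> hit_window M Z n s (D m)) \<union> (A' \<inter> hit_window M Z n s (D m))"
          by auto
        moreover have "measure P0 \<dots> = measure P0 (A \<inter> hit_window M Z n s (D m)) + measure P0 (A' \<inter> hit_window M Z n s (D m))"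
          using A cylinders_subset_sets sets_hit_window by (intro P0.finite_measure_Union) auto
        ultimately show ?thesis by (simp add: Q_def add_divide_distrib)
      qed
      then have "(\<lambda>m. Q m A + Q m A') \<longlonglongrightarrow> F (A \<union> A')" using F_lim(1)[OF cyl.Un[OF A(1,2)]] by simp
      then have "F (A \<union> A') = F A + F A'"
        using tendsto_add[OF F_lim(1)[OF A(1)] F_lim(1)[OF A(2)]] by (rule LIMSEQ_unique)
      then show "ennreal (F (A \<union> A')) = ennreal (F A) + ennreal (F A')"
        using F_lim(3) A by simp
    qed
    fix A :: "nat \<Rightarrow> 'w set"
    assume A: "range A \<subseteq> cylinders" "decseq A" "(\<Inter>j. A j) = {}"
    have A_sets: "A j \<in> sets P0" for j using A(1) cylinders_subset_sets by auto
    have P0_lim: "(\<lambda>j. measure P0 (A j)) \<longlonglongrightarrow> 0"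
      using P0.finite_Lim_measure_decseq[of A] A A_sets by auto
    have "(\<lambda>j. F (A j)) \<longlonglongrightarrow> 0"
    proof (rule LIMSEQ_I)
      fix e :: real assume e: "0 < e"
      \<comment> \<open>The order of choices matters: \<open>m\<close> is fixed first, by an error
        bound uniform over cylinders. Only then does \<open>j\<close> grow, and
        \<open>1 / w m\<close> is a constant factor.\<close>
      obtain m where m: "K * \<delta> m < e / 2"
        using order_tendstoD(2)[OF \<delta>_lim, of "e / 2"] e by (auto simp: eventually_sequentially)
      have "eventually (\<lambda>j. measure P0 (A j) < e / 2 * w m) sequentially"
        using e w0[of m] by (intro order_tendstoD(2)[OF P0_lim]) simp
      then obtain J where J: "\<And>j. J \<le> j \<Longrightarrow> measure P0 (A j) < e / 2 * w m"
        by (auto simp: eventually_sequentially)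
      have "norm (F (A j) - 0) < e" if "J \<le> j" for j
      proof -
        have Aj: "A j \<in> cylinders" using A(1) by auto
        have "measure P0 (A j \<inter> hit_window M Z n s (D m)) \<le> measure P0 (A j)"
          using A_sets by (intro P0.finite_measure_mono) auto
        then have "Q m (A j) \<le> measure P0 (A j) / w m"
          unfolding Q_def w_def using measure_nonneg by (intro divide_right_mono) auto
        also have "\<dots> < e / 2" using J[OF that] w0[of m] by (simp add: field_simps)
        finally show ?thesis using F_lim(2)[OF Aj, of m] F_lim(3)[OF Aj] m by simp
      qed
      then show "\<exists>J. \<forall>j\<ge>J. norm (F (A j) - 0) < e" by blast
    qed
    then show "(\<lambda>j. ennreal (F (A j))) \<longlonglongrightarrow> 0"
      using tendsto_ennrealI by fastforce
  qed simp
  then obtain \<mu> where \<mu>: "\<And>A. A \<in> cylinders \<Longrightarrow> \<mu> A = ennreal (F A)"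
    "measure_space (space M) (sigma_sets (space M) cylinders) \<mu>" by blast
  define N where "N = measure_of (space M) cylinders \<mu>"
  have "emeasure N (cyl M Z us B) = ennreal (path_law i s us B)" if "valid_times us" for us B
  proof -
    have c: "cyl M Z us B \<in> cylinders" using that by (auto simp: cylinders_def)
    have "emeasure N (cyl M Z us B) = \<mu> (cyl M Z us B)"
      using \<mu>(2) cylinders_subset_Pow c unfolding measure_space_def
      by (intro emeasure_measure_of[OF N_def]) (auto simp: N_def)
    then show ?thesis using \<mu>(1)[OF c] F_cyl[OF that] by simp
  qed
  then have "law_measure s N"
    using cylinders_subset_Pow by (simp add: law_measure_def N_def FY_eq)
  then show ?thesis by blast
qed

text \<open>The choice carries information on the simplex only; elsewhere \<open>cond_law s\<close>
  is arbitrary, which is why later integrands carry an indicator.\<close>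

definition cond_law :: "(nat \<Rightarrow> real) \<Rightarrow> 'w measure" where
  "cond_law s = (SOME N. law_measure s N)"

context
  fixes s assumes s: "s \<in> open_simplex n"
begin

lemma law_measure_cond_law: "law_measure s (cond_law s)"
  unfolding cond_law_def using exists_law_measure[OF s] by (rule someI_ex)

lemma space_cond_law: "space (cond_law s) = space M"
  and sets_cond_law: "sets (cond_law s) = FY M Z"
  using law_measure_cond_law by (auto simp: law_measure_def)

lemma emeasure_cond_law_cyl:
  "valid_times us \<Longrightarrow> emeasure (cond_law s) (cyl M Z us B) = ennreal (path_law i s us B)"
  using law_measure_cond_law by (auto simp: law_measure_def)

lemma measure_cond_law_cyl:
  "valid_times us \<Longrightarrow> measure (cond_law s) (cyl M Z us B) = path_law i s us B"
  using path_law_nonneg[OF s, of us]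
  by (simp add: measure_def emeasure_cond_law_cyl valid_times_def strict_sorted_iff)

lemma prob_space_cond_law: "prob_space (cond_law s)"
proof
  show "emeasure (cond_law s) (space (cond_law s)) = 1"
    using emeasure_cond_law_cyl[of "[]" UNIV]
    by (simp add: space_cond_law space_in_cylinders valid_times_def path_law_Nil)
qed

text \<open>Increments close to zero are small in the coordinates \<open>1..n\<close>, so the
  windows separate and \<open>window_estimate\<close> applies with its explicit error.\<close>

lemma window_cond_tendsto:
  assumes us: "valid_times us"
  shows "((\<lambda>\<Delta>. window_cond s \<Delta> (cyl M Z us B)) \<longlongrightarrow> measure (cond_law s) (cyl M Z us B))
    (at (\<lambda>_. 0) within {\<Delta>. \<forall>k\<in>{1..n}. 0 < \<Delta> k})"
    (is "(_ \<longlongrightarrow> _) ?F")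
proof (rule tendstoI)
  fix e :: real assume e: "0 < e"
  obtain \<delta>0 where \<delta>0: "0 < \<delta>0"
    "\<And>\<Delta>. (\<And>k. k \<in> {1..n} \<Longrightarrow> 0 < \<Delta> k \<and> \<Delta> k < \<delta>0) \<Longrightarrow> separated s \<Delta>"
    using exists_separation[OF s] by metis
  define K where "K = 2 * Suc n * gen_bound"
  have K0: "0 \<le> K" using gen_bound_nonneg by (simp add: K_def)
  \<comment> \<open>\<open>K\<close> vanishes if all generators do; \<open>K + 1\<close> keeps the
    denominator positive.\<close>
  define \<delta> where "\<delta> = min (\<delta>0 / 2) (e / (2 * (K + 1)))"
  have \<delta>: "0 < \<delta>" "\<delta> < \<delta>0" using \<delta>0(1) e K0 by (auto simp: \<delta>_def)
  have K\<delta>: "K * \<delta> < e"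
  proof -
    have "K * \<delta> \<le> K * (e / (2 * (K + 1)))" unfolding \<delta>_def using K0 by (intro mult_left_mono) auto
    also have "\<dots> < e" using K0 e by (simp add: field_simps add_nonneg_pos)
    finally show ?thesis .
  qed
  have small: "eventually (\<lambda>\<Delta>. \<forall>k\<in>{1..n}. \<Delta> k < \<delta>) ?F"
  proof (rule eventually_ball_finite)
    show "\<forall>k\<in>{1..n}. eventually (\<lambda>\<Delta>. \<Delta> k < \<delta>) ?F"
    proof
      fix k
      \<comment> \<open>Functions \<open>nat \<Rightarrow> real\<close> carry the product topology,
        in which each coordinate is continuous; smallness is then combined over finitely many
        coordinates.\<close>
      have "continuous_on UNIV (\<lambda>\<Delta>::nat \<Rightarrow> real. \<Delta> k)" by (rule continuous_on_product_coordinates)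
      then have "((\<lambda>\<Delta>::nat \<Rightarrow> real. \<Delta> k) \<longlongrightarrow> 0) (at (\<lambda>_. 0))"
        unfolding continuous_on_def by force
      then have "((\<lambda>\<Delta>. \<Delta> k) \<longlongrightarrow> 0) ?F" by (rule tendsto_within_subset) simp
      then show "eventually (\<lambda>\<Delta>. \<Delta> k < \<delta>) ?F" using \<delta>(1) by (rule order_tendstoD(2))
    qed
  qed simp
  have pos: "eventually (\<lambda>\<Delta>. \<forall>k\<in>{1..n}. 0 < \<Delta> k) ?F" by (simp add: eventually_at_filter)
  show "eventually (\<lambda>\<Delta>. dist (window_cond s \<Delta> (cyl M Z us B)) (measure (cond_law s) (cyl M Z us B)) < e) ?F"
    using small pos
  proof eventually_elim
    fix \<Delta> assume \<Delta>: "\<forall>k\<in>{1..n}. \<Delta> k < \<delta>" "\<forall>k\<in>{1..n}. 0 < \<Delta> k"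
    have "separated s \<Delta>" using \<Delta> \<delta> by (intro \<delta>0(2)) force
    then have "\<bar>window_cond s \<Delta> (cyl M Z us B) - path_law i s us B\<bar> \<le> K * \<delta>"
      unfolding K_def using us \<Delta> \<delta> by (intro window_estimate[OF s]) (auto simp: valid_times_def less_imp_le)
    then show "dist (window_cond s \<Delta> (cyl M Z us B)) (measure (cond_law s) (cyl M Z us B)) < e"
      using K\<delta> by (simp add: dist_real_def measure_cond_law_cyl[OF us])
  qed
qed

end

section \<open>From cylinders to the whole sigma-algebra of \<open>Y\<close>\<close>

lemma FY_induct [consumes 1, case_names cyl empty compl union]:
  assumes A: "A \<in> FY M Z"
    and "\<And>us B. valid_times us \<Longrightarrow> P (cyl M Z us B)" and "P {}"
    and "\<And>A. A \<in> FY M Z \<Longrightarrow> P A \<Longrightarrow> P (space M - A)"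
    and "\<And>A :: nat \<Rightarrow> 'w set. disjoint_family A \<Longrightarrow> range A \<subseteq> FY M Z \<Longrightarrow> (\<And>j. P (A j)) \<Longrightarrow> P (\<Union>j. A j)"
  shows "P A"
proof -
  interpret cyl: algebra "space M" cylinders by (rule algebra_cylinders)
  have Int: "Int_stable cylinders" by (auto simp: Int_stable_def)
  have A': "A \<in> sigma_sets (space M) cylinders" using A by (simp add: FY_eq)
  show ?thesis
    using Int cylinders_subset_Pow A'
  proof (induction rule: sigma_sets_induct_disjoint)
    case (basic A)
    then show ?case using assms(2) by (auto simp: cylinders_def)
  next
    case (union A)
    then show ?case using assms(5)[of A] by (simp add: FY_eq)
  qed (use assms(3,4) in \<open>auto simp: FY_eq\<close>)
qed

lemma measurable_cond_law:
  assumes "A \<in> FY M Z"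
  shows "(\<lambda>s. measure (cond_law s) A) \<in> borel_measurable (restrict_space (PiR n) (open_simplex n))"
    (is "?m A \<in> borel_measurable ?R")
  using assms
proof (induction rule: FY_induct)
  case (cyl us B)
  have "(\<lambda>s. path_law i s us B) \<in> borel_measurable ?R"
    by (rule measurable_restrict_space1) simp
  moreover have "?m (cyl M Z us B) s = path_law i s us B" if "s \<in> space ?R" for s
    using that cyl by (simp add: space_restrict_space measure_cond_law_cyl)
  ultimately show ?case
    using measurable_cong[of ?R "?m (cyl M Z us B)" "\<lambda>s. path_law i s us B"] by blast
next
  case (compl A)
  have "?m (space M - A) s = 1 - ?m A s" if "s \<in> space ?R" for s
  proof -
    have s: "s \<in> open_simplex n" using that by (simp add: space_restrict_space)
    interpret N: prob_space "cond_law s" by (rule prob_space_cond_law[OF s])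
    show ?thesis using N.prob_compl[of A] compl by (simp add: space_cond_law[OF s] sets_cond_law[OF s])
  qed
  then have "?m (space M - A) \<in> borel_measurable ?R \<longleftrightarrow> (\<lambda>s. 1 - ?m A s) \<in> borel_measurable ?R"
    by (rule measurable_cong)
  then show ?case using compl by simp
next
  case (union A)
  have "?m (\<Union>j. A j) s = (\<Sum>j. ?m (A j) s)" if "s \<in> space ?R" for s
  proof -
    have s: "s \<in> open_simplex n" using that by (simp add: space_restrict_space)
    interpret N: prob_space "cond_law s" by (rule prob_space_cond_law[OF s])
    show ?thesis using N.finite_measure_UNION[of A] union by (simp add: sets_cond_law[OF s] sums_unique)
  qed
  then have "?m (\<Union>j. A j) \<in> borel_measurable ?R \<longleftrightarrow> (\<lambda>s. \<Sum>j. ?m (A j) s) \<in> borel_measurable ?R"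
    by (rule measurable_cong)
  moreover note [measurable] = union(3)
  have "(\<lambda>s. \<Sum>j. ?m (A j) s) \<in> borel_measurable ?R" by measurable
  ultimately show ?case by simp
qed simp

text \<open>Multiplying by the indicator extends measurability from the simplex to the whole product
  space, where the value of \<open>cond_law s\<close> is not controlled.\<close>

lemma borel_measurable_cond_law:
  assumes "A \<in> FY M Z"
  shows "(\<lambda>s. indicator (open_simplex n) s * ennreal (measure (cond_law s) A)) \<in> borel_measurable (PiR n)"
proof -
  have "(\<lambda>s. ennreal (measure (cond_law s) A)) \<in> borel_measurable (restrict_space (PiR n) (open_simplex n))"
    using measurable_cond_law[OF assms] by measurable
  then show ?thesis
    by (subst (asm) borel_measurable_restrict_space_iff_ennreal) (auto simp: mult.commute)
qed

text \<open>Both sides are probability measures in \<open>A\<close>. On cylinders they agree by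
  \<open>joint_law\<close> without phase conditions, and Dynkin's argument carries the equality to
  all of \<open>FY M Z\<close>.\<close>

lemma cond_law_mixture:
  assumes "A \<in> FY M Z"
  shows "emeasure P0 A = (\<integral>\<^sup>+ s. indicator (open_simplex n) s * ennreal (measure (cond_law s) A) \<partial>switch_law)"
    (is "_ = ?I A")
  using assms
proof (induction rule: FY_induct)
  case (cyl us B)
  have "ennreal (measure P0 (cyl M Z us B)) = (\<integral>\<^sup>+ s. ennreal (path_law i s us B) \<partial>switch_law)"
  proof -
    have "cyl M Z us B \<inter> {\<omega> \<in> space M. \<forall>u\<in>{}. True} = cyl M Z us B" by (auto simp: cyl_def)
    then show ?thesis using joint_law[of us "{}" B "\<lambda>_ _. True"] cyl by (simp add: valid_times_def)
  qed
  also have "\<dots> = ?I (cyl M Z us B)"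
    using cyl by (intro nn_integral_cong_AE eventually_mono[OF AE_switch_law]) (simp add: measure_cond_law_cyl)
  finally show ?case by (simp add: P0.emeasure_eq_measure)
next
  case (compl A)
  have A: "A \<in> sets P0" "space M - A \<in> FY M Z"
    using compl FY_subset_sets by (auto simp: FY_eq intro: sigma_sets.Compl)
  have "emeasure P0 A + emeasure P0 (space M - A) = 1"
    using A FY_subset_sets P0.emeasure_space_1 by (subst plus_emeasure) (auto simp: Un_absorb1 sets.sets_into_space)
  moreover have "?I A + ?I (space M - A) = 1"
  proof -
    have meas: "(\<lambda>s. indicator (open_simplex n) s * ennreal (measure (cond_law s) D)) \<in> borel_measurable switch_law"
      if "D \<in> FY M Z" for D
      using borel_measurable_cond_law[OF that] by (simp only: measurable_cong_sets[OF sets_switch_law refl])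
    have "?I A + ?I (space M - A) = (\<integral>\<^sup>+ s. indicator (open_simplex n) s * ennreal (measure (cond_law s) A)
        + indicator (open_simplex n) s * ennreal (measure (cond_law s) (space M - A)) \<partial>switch_law)"
      using A compl meas by (intro nn_integral_add[symmetric]) auto
    also have "\<dots> = (\<integral>\<^sup>+ s. 1 \<partial>switch_law)"
    proof (intro nn_integral_cong_AE eventually_mono[OF AE_switch_law])
      fix s assume s: "s \<in> open_simplex n"
      interpret N: prob_space "cond_law s" by (rule prob_space_cond_law[OF s])
      show "indicator (open_simplex n) s * ennreal (measure (cond_law s) A)
        + indicator (open_simplex n) s * ennreal (measure (cond_law s) (space M - A)) = 1"
        using s N.prob_compl[of A] compl
        by (simp add: space_cond_law[OF s] sets_cond_law[OF s] ennreal_plus[symmetric] del: ennreal_plus)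
    qed
    also have "\<dots> = 1" using emeasure_switch_law by simp
    finally show ?thesis .
  qed
  \<comment> \<open>The complement is handled by cancelling the finite value \<open>?I A\<close>
    from two sums equal to one, which avoids subtraction in \<open>ennreal\<close>.\<close>
  ultimately have "?I A + emeasure P0 (space M - A) = ?I A + ?I (space M - A)"
    using compl(2) by simp
  moreover have "?I A \<noteq> \<infinity>" using compl(2)[symmetric] by simp
  ultimately show ?case by (simp add: ennreal_add_left_cancel)
next
  case (union A)
  have meas: "(\<lambda>s. indicator (open_simplex n) s * ennreal (measure (cond_law s) (A j))) \<in> borel_measurable switch_law" for j
    using borel_measurable_cond_law[of "A j"] union(2) by (simp add: measurable_cong_sets[OF sets_switch_law refl] range_subsetD)
  have "emeasure P0 (\<Union>j. A j) = (\<Sum>j. emeasure P0 (A j))"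
    using union(1,2) FY_subset_sets by (intro suminf_emeasure[symmetric]) auto
  also have "\<dots> = (\<integral>\<^sup>+ s. (\<Sum>j. indicator (open_simplex n) s * ennreal (measure (cond_law s) (A j))) \<partial>switch_law)"
    unfolding union(3) by (intro nn_integral_suminf[symmetric] meas)
  also have "\<dots> = ?I (\<Union>j. A j)"
  proof (intro nn_integral_cong_AE eventually_mono[OF AE_switch_law])
    fix s assume s: "s \<in> open_simplex n"
    interpret N: prob_space "cond_law s" by (rule prob_space_cond_law[OF s])
    have "(\<Sum>j. emeasure (cond_law s) (A j)) = emeasure (cond_law s) (\<Union>j. A j)"
      using union(1,2) by (intro suminf_emeasure) (auto simp: sets_cond_law[OF s])
    then show "(\<Sum>j. indicator (open_simplex n) s * ennreal (measure (cond_law s) (A j)))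
        = indicator (open_simplex n) s * ennreal (measure (cond_law s) (\<Union>j. A j))"
      using s by (simp add: N.emeasure_eq_measure)
  qed
  finally show ?case .
qed simp

lemma cond_law_iterated_integral:
  assumes A: "A \<in> FY M Z"
  shows "ennreal (condP M Z i A) = iterated_integral n (\<lambda>s. ennreal (measure (cond_law s) A *
           (\<Prod>k\<in>{1..n}. q k * exp (- q k * (s k - prev_s s k)))))"
proof -
  have u: "(\<lambda>_. undefined) \<in> open_simplex 0" by (simp add: open_simplex_def)
  have "ennreal (condP M Z i A) = emeasure P0 A"
    using A FY_subset_sets by (simp add: condP_eq P0.emeasure_eq_measure subsetD)
  also have "\<dots> = iterated_integral n (\<lambda>s. indicator (open_simplex n) s * ennreal (measure (cond_law s) A)
      * ennreal (switch_density 0 s))"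
    unfolding cond_law_mixture[OF A] by (rule nn_integral_switch_law_eq_iterated[OF borel_measurable_cond_law[OF A]])
  also have "\<dots> = iterated_integral n (\<lambda>s. ennreal (measure (cond_law s) A *
           (\<Prod>k\<in>{1..n}. q k * exp (- q k * (s k - prev_s s k)))))"
    unfolding iterated_integral_def
  proof (rule nested_cong[OF _ u])
    fix s assume "s \<in> open_simplex n"
    then show "indicator (open_simplex n) s * ennreal (measure (cond_law s) A) * ennreal (switch_density 0 s)
      = ennreal (measure (cond_law s) A * (\<Prod>k\<in>{1..n}. q k * exp (- q k * (s k - prev_s s k))))"
      using switch_density_pos[of 0 s] by (simp add: ennreal_mult switch_density_def One_nat_def)
  qed simp
  finally show ?thesis .
qed

end

theorem theorem3p2:
  fixes M :: "'w measure" and Z :: "real \<Rightarrow> 'w \<Rightarrow> nat \<times> 'e::finite"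
    and n :: nat and G :: "nat \<Rightarrow> 'e \<Rightarrow> 'e \<Rightarrow> real" and q :: "nat \<Rightarrow> real" and i :: 'e
  assumes "prob_space M"
    and "\<forall>k\<in>{1..Suc n}. generator_matrix (G k)"
    and "\<forall>k\<in>{1..n}. 0 < q k"
    and "ctmc M ({..n} \<times> UNIV) (lifted_gen n G q) Z"
    and "0 < measure M {\<omega>\<in>space M. Z 0 \<omega> = (0, i)}"
  shows "\<exists>Pbar :: (nat \<Rightarrow> real) \<Rightarrow> 'w measure.
     (\<forall>s\<in>open_simplex n.
        prob_space (Pbar s) \<and> space (Pbar s) = space M \<and> sets (Pbar s) = FY M Z \<and>
        (\<forall>us B. sorted_wrt (<) us \<and> (\<forall>u\<in>set us. 0 \<le> u) \<longrightarrow>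
           ((\<lambda>\<Delta>. condP M Z i (cyl M Z us B \<inter> hit_window M Z n s \<Delta>)
                   / condP M Z i (hit_window M Z n s \<Delta>))
             \<longlongrightarrow> measure (Pbar s) (cyl M Z us B))
           (at (\<lambda>_. 0) within {\<Delta>. \<forall>k\<in>{1..n}. 0 < \<Delta> k}))) \<and>
     (\<forall>A\<in>FY M Z.
        (\<lambda>s. measure (Pbar s) A)
          \<in> borel_measurable (restrict_space (PiM {1..n} (\<lambda>_. lborel)) (open_simplex n))) \<and>
     (\<forall>A\<in>FY M Z.
        ennreal (condP M Z i A)
        = iterated_integral n (\<lambda>s. ennreal (measure (Pbar s) A *
             (\<Prod>k\<in>{1..n}. q k * exp (- q k * (s k - prev_s s k))))))"
proof -
  interpret prob_space M by fact
  interpret switching_chain n G q M Z i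
    using assms by unfold_locales auto
  have "condP M Z i (cyl M Z us B \<inter> hit_window M Z n s \<Delta>) / condP M Z i (hit_window M Z n s \<Delta>)
      = window_cond s \<Delta> (cyl M Z us B)" if "valid_times us" for us B s \<Delta>
    using that sets_cyl[of us B] sets_hit_window by (simp add: condP_eq valid_times_def)
  then show ?thesis
    using prob_space_cond_law space_cond_law sets_cond_law window_cond_tendsto
      measurable_cond_law cond_law_iterated_integral
    by (intro exI[of _ cond_law] conjI ballI allI impI) (simp_all add: valid_times_def)
qed

end
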